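(* Consider the Villain model $\theta$ at inverse temperature $\beta$. The following hold uniformly in $n\ge1$ and $\beta\ge\tfrac13$. (1) (Zero boundary conditions.) For every $\delta>0$ there is a constant $K=K(\delta)>0$ such that for all $n\ge 1$ and $\beta\ge\frac13$, for the Villain model on $\Lambda_n$ with zero boundary conditions, $$\mathbb E^{Vil}_\beta[\cos(\theta(0))]\le K\,n^{-\frac{1+M(\beta)/2}{4\pi\beta}},\qquad \mathbb E^{Vil}_\beta[\cos(\theta(0)-\theta(v))]\le K\,\|v\|_2^{-\frac{1+M(\beta)/2}{2\pi\beta}}$$ for all $v\in\Lambda_{\lfloor(1-\delta)n\rfloor}$, $v\neq0$. (2) (Free boundary conditions.) There is a constant $K$ such that for all $n\ge1$, $\beta\ge\frac13$ and $v\in\partial\Lambda_n$, for the Villain model on $\Lambda_n$ with free boundary conditions, $$\mathbb E^{Vil}_\beta[\cos(\theta(0)-\theta(v))]\le K\,\|v\|_2^{-\frac{3(1+M(\beta)/2)}{4\pi\beta}} .$$ (3) (Infinite volume.) There is a constant $K$ such that for all $\beta\ge\tfrac13$ and all $v\in\mathbb Z^2\setminus\{0\}$, $$\mathbb E^{Vil}_{\beta,\mathbb Z^2}[\cos(\theta(0)-\theta(v))]\le K\,\|v\|_2^{-\frac{1+M(\beta)/2}{2\pi\beta}} .$$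
   Context: Graphs. Free boundary conditions: $\Lambda_n$ is $[-n,n]^2\cap\mathbb Z^2$ with nearest-neighbour edges and marked vertex $v_0=(0,0)$. Zero (Dirichlet) boundary conditions: $\Lambda_n$ is $([-n,n]^2\cap\mathbb Z^2)\cup\{\infty\}$ with nearest-neighbour edges and the vertices of $\partial[-n,n]^2$ connected to $\infty$ so that the graph is the planar dual of a square-grid box (one edge to $\infty$ for each non-corner boundary vertex, two parallel edges for each corner), with marked vertex $v_0=\infty$. In "$v\in\Lambda_k$" and "$v\in\partial\Lambda_n$", $\Lambda_k$ is the box $[-k,k]^2\cap\mathbb Z^2$ and $\partial\Lambda_n$ the set of its boundary vertices. $V,E$ are the sets of vertices and (arbitrarily oriented) edges; $\mathrm d w(\overrightarrow{xy})=w(y)-w(x)$. Villain model at inverse temperature $\beta$: random $\theta:V\to[0,2\pi)$ with $\theta(v_0)=0$ and law $\mathbb P^{Vil}_\beta(d\theta)\propto\prod_{e\in E}\sum_{k\in\mathbb Z}\exp\big(-\tfrac\beta2(\mathrm d\theta(e)+2\pi k)^2\big)\,d\theta$ on $[0,2\pi)^{V\setminus\{v_0\}}$. $\mathbb P^{Vil}_{\beta,\mathbb Z^2}$ is its unique translation invariant infinite-volume Gibbs state on $\mathbb Z^2$, which is the limit as $n\to\infty$ of the models on $\Lambda_n$ with free or zero boundary conditions. Error function. An integer-valued Gaussian with parameters $(a,\beta)$ is a $\mathbb Z$-valued $X$ with $\mathbb P^{IG}_{\beta,a}[X=k]\propto e^{-\frac\beta2(k-a)^2}$; $\operatorname{Var}^{IG}(a,\beta)$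 is its variance. $M(\beta):=(2\pi)^2\beta\inf_{a\in[0,1/2]}\operatorname{Var}^{IG}(a,(2\pi)^2\beta)$. *)

theory Defs
  imports "HOL-Probability.Probability" "Graph_Theory.Graph_Theory"
begin

section \<open>Graphs\<close>

text \<open>Graphs are the multi-digraphs of the Graph Theory entry, so that edges carry an
  (arbitrary) orientation and may be parallel.\<close>

type_synonym site = "int \<times> int"

definition Z2_lattice :: "(site, site \<times> site) pre_digraph" where
  "Z2_lattice = \<lparr>verts = UNIV, arcs = {(x, y). y = x + (1, 0) \<or> y = x + (0, 1)},
              tail = fst, head = snd\<rparr>"

definition lattice_box :: "int \<Rightarrow> site set" where
  "lattice_box k = {-k..k} \<times> {-k..k}"

definition box_boundary :: "int \<Rightarrow> site set" where
  "box_boundary k = {v \<in> lattice_box k. \<bar>fst v\<bar> = k \<or> \<bar>snd v\<bar> = k}"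

definition edges_meeting :: "site set \<Rightarrow> (site \<times> site) set" where
  "edges_meeting S = {e \<in> arcs Z2_lattice. tail Z2_lattice e \<in> S \<or> head Z2_lattice e \<in> S}"

definition free_box :: "nat \<Rightarrow> (site, site \<times> site) pre_digraph" where
  "free_box n = Z2_lattice \<restriction> lattice_box (int n)"

text \<open>The vertex \<open>\<infinity>\<close> is \<open>None\<close>. Every lattice edge with an endpoint in the box is kept, its
  other endpoint being identified with \<open>\<infinity>\<close> if it lies outside. For \<open>n \<ge> 1\<close> this gives one
  edge to \<open>\<infinity>\<close> for each non-corner boundary vertex and two parallel ones for each corner.\<close>

definition wire :: "site set \<Rightarrow> site \<Rightarrow> site option" where
  "wire S x = (if x \<in> S then Some x else None)"

definition zero_box :: "nat \<Rightarrow> (site option, site \<times> site) pre_digraph" where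
  "zero_box n = \<lparr>verts = insert None (Some ` lattice_box (int n)), arcs = edges_meeting (lattice_box (int n)),
                 tail = wire (lattice_box (int n)) \<circ> fst, head = wire (lattice_box (int n)) \<circ> snd\<rparr>"

definition norm2 :: "site \<Rightarrow> real" where
  "norm2 v = sqrt ((of_int (fst v))\<^sup>2 + (of_int (snd v))\<^sup>2)"


section \<open>The Villain model\<close>

definition angle_space :: "real measure" where
  "angle_space = restrict_space lborel {0..<2 * pi}"

definition villain_weight :: "real \<Rightarrow> real \<Rightarrow> real" where
  "villain_weight \<beta> t = (\<Sum>\<^sub>\<infinity>k\<in>(UNIV :: int set). exp (- (\<beta> / 2) * (t + 2 * pi * of_int k)\<^sup>2))"

definition villain_product ::
  "('v, 'e) pre_digraph \<Rightarrow> 'e set \<Rightarrow> real \<Rightarrow> ('v \<Rightarrow> real) \<Rightarrow> real" where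
  "villain_product G F \<beta> \<theta> = (\<Prod>e\<in>F. villain_weight \<beta> (\<theta> (head G e) - \<theta> (tail G e)))"

text \<open>The law on \<open>M\<close> whose density is proportional to \<open>w\<close>.\<close>

definition normalized_density :: "'a measure \<Rightarrow> ('a \<Rightarrow> real) \<Rightarrow> 'a measure" where
  "normalized_density M w = density M (\<lambda>x. ennreal (w x / (\<integral>y. w y \<partial>M)))"

definition villain :: "('v, 'e) pre_digraph \<Rightarrow> 'v \<Rightarrow> real \<Rightarrow> ('v \<Rightarrow> real) measure" where
  "villain G v\<^sub>0 \<beta> =
     distr (normalized_density (Pi\<^sub>M (verts G - {v\<^sub>0}) (\<lambda>_. angle_space))
                               (\<lambda>\<theta>. villain_product G (arcs G) \<beta> (\<theta>(v\<^sub>0 := 0))))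
           (Pi\<^sub>M (verts G) (\<lambda>_. angle_space))
           (\<lambda>\<theta>. \<theta>(v\<^sub>0 := 0))"

definition villain_free :: "nat \<Rightarrow> real \<Rightarrow> (site \<Rightarrow> real) measure" where
  "villain_free n \<beta> = villain (free_box n) (0, 0) \<beta>"

definition villain_zero :: "nat \<Rightarrow> real \<Rightarrow> (site option \<Rightarrow> real) measure" where
  "villain_zero n \<beta> = villain (zero_box n) None \<beta>"


section \<open>Infinite volume\<close>

definition config_space :: "(site \<Rightarrow> real) measure" where
  "config_space = Pi\<^sub>M UNIV (\<lambda>_. angle_space)"

text \<open>The specification: the conditional law given that the configuration agrees with \<open>\<eta>\<close>
  off the finite set \<open>S\<close>.\<close>

definition villain_kernel ::
  "real \<Rightarrow> site set \<Rightarrow> (site \<Rightarrow> real) \<Rightarrow> (site \<Rightarrow> real) measure" where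
  "villain_kernel \<beta> S \<eta> =
     distr (normalized_density (Pi\<^sub>M S (\<lambda>_. angle_space))
              (\<lambda>\<theta>. villain_product Z2_lattice (edges_meeting S) \<beta> (override_on \<eta> \<theta> S)))
           config_space
           (\<lambda>\<theta>. override_on \<eta> \<theta> S)"

text \<open>The DLR equations. There is no marked vertex here: a Gibbs state is a law on
  unpinned configurations.\<close>

definition villain_gibbs_state :: "real \<Rightarrow> (site \<Rightarrow> real) measure \<Rightarrow> bool" where
  "villain_gibbs_state \<beta> \<mu> \<longleftrightarrow>
     prob_space \<mu> \<and> sets \<mu> = sets config_space \<and>
     (\<forall>S. finite S \<longrightarrow> (\<forall>A\<in>sets \<mu>.
        emeasure \<mu> A = (\<integral>\<^sup>+ \<eta>. emeasure (villain_kernel \<beta> S \<eta>) A \<partial>\<mu>)))"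

definition translation_invariant :: "(site \<Rightarrow> real) measure \<Rightarrow> bool" where
  "translation_invariant \<mu> \<longleftrightarrow> (\<forall>a. distr \<mu> \<mu> (\<lambda>\<theta> x. \<theta> (x + a)) = \<mu>)"


section \<open>The error function\<close>

definition IG :: "real \<Rightarrow> real \<Rightarrow> int pmf" where
  "IG a \<beta> = embed_pmf (\<lambda>k. exp (- (\<beta> / 2) * (of_int k - a)\<^sup>2) /
                        (\<Sum>\<^sub>\<infinity>j\<in>(UNIV :: int set). exp (- (\<beta> / 2) * (of_int j - a)\<^sup>2)))"

definition Var_IG :: "real \<Rightarrow> real \<Rightarrow> real" where
  "Var_IG a \<beta> = measure_pmf.variance (IG a \<beta>) real_of_int"

definition M_err :: "real \<Rightarrow> real" where
  "M_err \<beta> = (2 * pi)\<^sup>2 * \<beta> * (INF a\<in>{0..1/2}. Var_IG a ((2 * pi)\<^sup>2 * \<beta>))"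

end

theory Submission
  imports Defs "HOL-Complex_Analysis.Complex_Analysis"
begin

text \<open>The Villain weight \<open>w\<close> is the restriction to the real line of an entire \<open>2\<pi>\<close>-periodic function.
  In the spirit of McBryan and Spencer the angles are therefore shifted to \<open>\<theta> + i g\<close> without
  changing the partition function, so that for \<open>g = u / \<beta>\<close> the correlation \<open>E cos (\<theta> x - \<theta> y)\<close> is
  at most \<open>exp (- (u x - u y) / \<beta>)\<close> times the product over the edges of the suprema over \<open>t\<close> of
  \<open>\<bar>w (t + i h / \<beta>)\<bar> / w t\<close>, where \<open>h = du\<close>. That quotient is \<open>exp (h\<^sup>2 / (2 \<beta>))\<close> times the modulus of
  the characteristic function at \<open>2 \<pi> h\<close> of an integer-valued Gaussian, whose variance produces the
  gain \<open>exp (- M h\<^sup>2 / (4 \<beta>) + C \<bar>h\<bar>\<^sup>3)\<close>. No exact Green function is needed for \<open>u\<close>: truncated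
  logarithms have the right energy up to a constant, and \<open>\<bar>du\<bar>\<^sup>3\<close> is summable on the lattice. Near a
  free boundary the bump around \<open>v\<close> is doubled but only half of its edges lie in the box.\<close>

section \<open>Sums over the integers\<close>

text \<open>The exponents come from one balance. The test function \<open>u\<close> is chosen so
  that \<open>u x - u y\<close> and its Dirichlet energy are both \<open>\<kappa> * ln r\<close> up
  to a bounded error. To the coefficient of \<open>ln r / (2 * \<beta>)\<close> the linear term
  contributes \<open>- 2 * \<kappa>\<close> and the energy \<open>(1 - M / 2) * \<kappa>\<close>, in
  total \<open>- \<kappa> * (1 + M / 2)\<close>: so the factor \<open>1 - M / 2\<close> on each edge
  becomes \<open>1 + M / 2\<close> in the result. One bump against a pinned boundary has
  \<open>\<kappa> = 1 / (2 * pi)\<close>, two bumps have \<open>1 / pi\<close>. At a free boundary,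
  scaling the bump at \<open>v\<close> by \<open>k\<close> gives height difference
  \<open>1 + k\<close> and energy \<open>1 + k\<^sup>2 / 2\<close> in units of
  \<open>ln r / (2 * pi)\<close>; they agree at \<open>k = 2\<close>, whence
  \<open>3 / (2 * pi)\<close>. Uniformity in \<beta> shapes the estimates: \<open>u\<close>, the
  cubic constant and all moment bounds must be free of \<beta>. For \<beta> \<ge> 1/3 the Gaussian
  parameter \<open>(2 * pi)\<^sup>2 * \<beta>\<close> is at least 12, which bounds third moments
  uniformly for centres in \<open>{0..1/2}\<close> and gives \<open>M \<le> 2\<close>, so that
  \<open>1 - M / 2\<close> is nonnegative.\<close>

lemma inverse_square_le_arctan_diff:
  fixes a t :: real
  assumes "a > 0" "t \<ge> 1"
  shows "1 / (a\<^sup>2 + t\<^sup>2) \<le> (arctan (t / a) - arctan ((t - 1) / a)) / a"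
proof -
  have der: "((\<lambda>t. arctan (t / a) / a) has_real_derivative 1 / (a\<^sup>2 + s\<^sup>2)) (at s)" for s
  proof -
    have "((\<lambda>t. arctan (t / a) / a) has_real_derivative (inverse (1 + (s/a)\<^sup>2) * (1/a)) / a) (at s)"
      using assms by (auto intro!: derivative_eq_intros)
    moreover have "(inverse (1 + (s/a)\<^sup>2) * (1/a)) / a = 1 / (a\<^sup>2 + s\<^sup>2)"
    proof -
      have "1 + (s/a)\<^sup>2 = (a\<^sup>2 + s\<^sup>2) / a\<^sup>2"
        using assms by (simp add: power_divide add_divide_distrib)
      then show ?thesis using assms by (simp add: power2_eq_square)
    qed
    ultimately show ?thesis by simp
  qed
  \<comment> \<open>The mean value theorem on \<open>[t - 1, t]\<close> stands in for the integral;
    since \<open>t \<ge> 1\<close>, the intermediate point is nonnegative, where the integrand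
    decreases.\<close>
  obtain s where s: "t - 1 < s" "s < t"
    "arctan (t / a) / a - arctan ((t - 1) / a) / a = (t - (t - 1)) * (1 / (a\<^sup>2 + s\<^sup>2))"
    using MVT2[of "t - 1" t "\<lambda>t. arctan (t / a) / a" "\<lambda>s. 1 / (a\<^sup>2 + s\<^sup>2)"] der by auto
  have "s\<^sup>2 \<le> t\<^sup>2" using s assms by (intro power_mono) auto
  moreover have "a\<^sup>2 + s\<^sup>2 > 0" using assms by (simp add: add_pos_nonneg)
  ultimately have "1 / (a\<^sup>2 + t\<^sup>2) \<le> 1 / (a\<^sup>2 + s\<^sup>2)" by (intro divide_left_mono mult_pos_pos) auto
  with s show ?thesis by (simp add: diff_divide_distrib)
qed

lemma sum_inverse_square_nat_le:
  fixes a :: real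
  assumes "a > 0"
  shows "(\<Sum>k=1..n. 1 / (a\<^sup>2 + (real k)\<^sup>2)) \<le> pi / (2 * a)"
proof -
  have "(\<Sum>k=1..n. 1 / (a\<^sup>2 + (real k)\<^sup>2)) \<le> arctan (real n / a) / a"
  proof (induction n)
    case (Suc n)
    have "1 / (a\<^sup>2 + (real (Suc n))\<^sup>2) \<le> (arctan (real (Suc n) / a) - arctan (real n / a)) / a"
      using inverse_square_le_arctan_diff[OF assms, of "real (Suc n)"] by simp
    then show ?case using Suc by (simp add: diff_divide_distrib)
  qed auto
  also have "\<dots> \<le> (pi / 2) / a"
    using assms arctan_ubound[of "real n / a"] by (intro divide_right_mono) auto
  finally show ?thesis by simp
qed

lemma sum_nonneg_half_line_le:
  fixes a :: real and Y :: "int set"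
  assumes "a > 0" "finite Y" "\<And>y. y \<in> Y \<Longrightarrow> y > 0"
  shows "(\<Sum>y\<in>Y. 1 / (a\<^sup>2 + (of_int y)\<^sup>2)) \<le> pi / (2 * a)"
proof -
  obtain n where n: "nat ` Y \<subseteq> {1..n}"
  proof
    show "nat ` Y \<subseteq> {1..Max (nat ` Y)}"
      using assms by (auto simp: Suc_le_eq)
  qed
  have "(\<Sum>y\<in>Y. 1 / (a\<^sup>2 + (of_int y)\<^sup>2)) = (\<Sum>k\<in>nat ` Y. 1 / (a\<^sup>2 + (real k)\<^sup>2))"
    using assms(3) by (subst sum.reindex) (auto simp: inj_on_def intro!: sum.cong dest!: assms(3))
  also have "\<dots> \<le> (\<Sum>k=1..n. 1 / (a\<^sup>2 + (real k)\<^sup>2))"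
    using n by (intro sum_mono2) auto
  also have "\<dots> \<le> pi / (2 * a)" by (rule sum_inverse_square_nat_le[OF assms(1)])
  finally show ?thesis .
qed

text \<open>\<open>\<alpha> = 2\<close> imposes no condition; \<open>\<alpha> = 1\<close> confines the set to a half-line, which halves the
  leading term of sums over it. This is what a free boundary does to the energy of a bump.\<close>

definition int_sector :: "nat \<Rightarrow> int set \<Rightarrow> bool" where
  "int_sector \<alpha> A \<longleftrightarrow> \<alpha> = 2 \<or> \<alpha> = 1 \<and> ((\<forall>x\<in>A. x \<ge> 0) \<or> (\<forall>x\<in>A. x \<le> 0))"

text \<open>Split into positive part, negative part and the origin. Evenness reflects the negative
  part, which is why \<open>half\<close> is assumed for subsets of \<open>Y\<close> together with
  its mirror image; on a half-line one of the two parts is empty.\<close>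

lemma sum_int_sector_le:
  fixes f :: "int \<Rightarrow> real" and Y :: "int set"
  assumes sec: "int_sector \<alpha> Y" and fin: "finite Y"
    and even: "\<And>y. f (- y) = f y" and nn: "\<And>y. f y \<ge> 0"
    and half: "\<And>Z. Z \<subseteq> Y \<union> uminus ` Y \<Longrightarrow> (\<And>y. y \<in> Z \<Longrightarrow> y > 0) \<Longrightarrow> sum f Z \<le> h"
  shows "sum f Y \<le> real \<alpha> * h + f 0"
proof -
  let ?P = "{y\<in>Y. y > 0}" and ?N = "{y\<in>Y. y < 0}"
  have "h \<ge> 0" using half[of "{}"] by simp
  have P: "sum f ?P \<le> h" by (rule half) auto
  have "sum f ?N = sum f (uminus ` ?N)"
    by (subst sum.reindex) (auto simp: inj_on_def even)
  also have "\<dots> \<le> h" by (rule half) auto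
  finally have N: "sum f ?N \<le> h" .
  have "sum f Y = sum f (?P \<union> ?N \<union> (Y \<inter> {0}))"
    by (rule sum.cong) auto
  also have "\<dots> = sum f ?P + sum f ?N + sum f (Y \<inter> {0})"
    using fin by (subst sum.union_disjoint; (subst sum.union_disjoint)?) auto
  finally have eq: "sum f Y = sum f ?P + sum f ?N + sum f (Y \<inter> {0})" .
  have Z: "sum f (Y \<inter> {0}) \<le> f 0" using nn[of 0] by (cases "0 \<in> Y") auto
  consider "\<alpha> = 2" | "\<alpha> = 1" "\<forall>x\<in>Y. x \<ge> 0" | "\<alpha> = 1" "\<forall>x\<in>Y. x \<le> 0"
    using sec unfolding int_sector_def by auto
  then show ?thesis
  proof cases
    case 1 then show ?thesis using eq P N Z by simp
  next
    case 2
    then have "?N = {}" by force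
    then have "sum f ?N = 0" by (metis sum.empty)
    then show ?thesis using 2 eq P Z by simp
  next
    case 3
    then have "?P = {}" by force
    then have "sum f ?P = 0" by (metis sum.empty)
    then show ?thesis using 3 eq N Z by simp
  qed
qed

lemma sum_row_le:
  fixes a :: real and Y :: "int set"
  assumes "a > 0" "finite Y" "int_sector \<alpha> Y"
  shows "(\<Sum>y\<in>Y. 1 / (a\<^sup>2 + (of_int y)\<^sup>2)) \<le> real \<alpha> * (pi / (2 * a)) + 1 / a\<^sup>2"
proof -
  have "(\<Sum>y\<in>Y. 1 / (a\<^sup>2 + (of_int y)\<^sup>2)) \<le>
      real \<alpha> * (pi / (2 * a)) + (\<lambda>y::int. 1 / (a\<^sup>2 + (of_int y)\<^sup>2)) 0"
    by (rule sum_int_sector_le[OF assms(3,2)])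
       (use assms in \<open>auto intro!: sum_nonneg_half_line_le intro: finite_subset\<close>)
  then show ?thesis by simp
qed

lemma sum_inverse_one_plus_square_le:
  fixes Y :: "int set"
  assumes "finite Y"
  shows "(\<Sum>y\<in>Y. 1 / (1 + (of_int y)\<^sup>2)) \<le> pi + (1 :: real)"
  using sum_row_le[of 1 Y 2] assms by (simp add: int_sector_def)

lemma summable_on_inverse_one_plus_square:
  "(\<lambda>k::int. 1 / (1 + (of_int k)\<^sup>2) :: real) summable_on UNIV"
proof (rule nonneg_bounded_partial_sums_imp_summable_on)
  show "\<forall>\<^sub>F F in finite_subsets_at_top UNIV. (\<Sum>k\<in>F. 1 / (1 + (of_int k)\<^sup>2)) \<le> pi + (1::real)"
    by (intro eventually_finite_subsets_at_top_weakI sum_inverse_one_plus_square_le)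
qed auto

text \<open>The common majorant \<open>C / (1 + k\<^sup>2)\<close> serves all the Gaussian series
  below, real and complex.\<close>

lemma summable_on_int_comparison:
  fixes f :: "int \<Rightarrow> 'a :: banach"
  assumes "\<And>k. norm (f k) \<le> C / (1 + (of_int k)\<^sup>2)"
  shows "f summable_on UNIV"
proof -
  have "(\<lambda>k::int. C * (1 / (1 + (of_int k)\<^sup>2)) :: real) summable_on UNIV"
    by (intro summable_on_cmult_right summable_on_inverse_one_plus_square)
  then have "(\<lambda>k. norm (f k)) summable_on UNIV"
    by (rule summable_on_comparison_test) (use assms in auto)
  then show ?thesis by (rule abs_summable_summable)
qed

section \<open>Integer-valued Gaussians\<close>

text \<open>A bridge: the Villain weight and the normalisation of \<open>IG\<close> are
  \<open>infsum\<close>s, whereas expectations are Bochner integrals.\<close>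

lemma count_space_int_infsum:
  fixes f :: "int \<Rightarrow> 'a :: {banach, second_countable_topology}"
  assumes "\<And>k. norm (f k) \<le> C / (1 + (of_int k)\<^sup>2)"
  shows "integrable (count_space UNIV) f" "integral\<^sup>L (count_space UNIV) f = infsum f UNIV"
proof -
  have "(\<lambda>k. norm (f k)) summable_on UNIV"
    by (rule summable_on_int_comparison) (use assms in auto)
  then have *: "Infinite_Set_Sum.abs_summable_on f UNIV"
    by (simp only: abs_summable_equivalent)
  then show "integrable (count_space UNIV) f"
    by (simp add: abs_summable_on_def)
  show "integral\<^sup>L (count_space UNIV) f = infsum f UNIV"
    using infsetsum_infsum[OF *] by (simp add: infsetsum_def)
qed

lemma measure_pmf_int_infsum:
  fixes f :: "int \<Rightarrow> 'a :: {banach, second_countable_topology}"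
  assumes "\<And>k. pmf p k * norm (f k) \<le> C / (1 + (of_int k)\<^sup>2)"
  shows "integrable (measure_pmf p) f"
    "measure_pmf.expectation p f = (\<Sum>\<^sub>\<infinity>k. pmf p k *\<^sub>R f k)"
proof -
  note * = count_space_int_infsum[of "\<lambda>k. pmf p k *\<^sub>R f k" C]
  have "integrable (count_space UNIV) (\<lambda>k. pmf p k *\<^sub>R f k)"
    using assms by (intro *) auto
  then show "integrable (measure_pmf p) f"
    unfolding measure_pmf_eq_density by (subst integrable_density) auto
  show "measure_pmf.expectation p f = (\<Sum>\<^sub>\<infinity>k. pmf p k *\<^sub>R f k)"
    unfolding measure_pmf_eq_density using assms
    by (subst integral_density) (auto intro!: *)
qed

lemma exp_neg_square_le:
  fixes x c :: real
  assumes "c > 0"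
  shows "exp (- (c * x\<^sup>2)) \<le> max 1 (1 / c) / (1 + x\<^sup>2)"
proof -
  have "1 + x\<^sup>2 \<le> max 1 (1 / c) * (1 + c * x\<^sup>2)"
  proof (cases "c \<ge> 1")
    case True
    then show ?thesis using mult_right_mono[of 1 c "x\<^sup>2"] by (simp add: max_def)
  next
    case False
    then have "1 / c > 1" "1/c * (c * x\<^sup>2) = x\<^sup>2" using assms by auto
    then show ?thesis by (simp add: max_def distrib_left)
  qed
  also have "\<dots> \<le> max 1 (1 / c) * exp (c * x\<^sup>2)"
    by (intro mult_left_mono) auto
  finally show ?thesis
    by (simp add: exp_minus divide_simps add_pos_nonneg)
qed

definition gauss_weight :: "real \<Rightarrow> real \<Rightarrow> int \<Rightarrow> real" where
  "gauss_weight \<gamma> a k = exp (- (\<gamma> / 2) * (of_int k - a)\<^sup>2)"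

lemma square_diff_ge: "(x - a)\<^sup>2 \<ge> x\<^sup>2 / 2 - a\<^sup>2" for x a :: real
  using zero_le_power2[of "x / 2 - a"] zero_le_power2[of "x - 2 * a"]
  by (simp add: power2_eq_square algebra_simps)

lemma gauss_weight_le:
  assumes "\<gamma> > 0"
  obtains C where "\<And>k. gauss_weight \<gamma> a k \<le> C / (1 + (of_int k)\<^sup>2)"
proof
  fix k :: int
  have "gauss_weight \<gamma> a k \<le> exp (\<gamma> / 2 * a\<^sup>2) * exp (- (\<gamma> / 4 * (of_int k)\<^sup>2))"
    unfolding gauss_weight_def exp_add[symmetric]
    using mult_left_mono[OF square_diff_ge[of "of_int k" a], of "\<gamma> / 2"] assms
    by (simp add: algebra_simps)
  also have "\<dots> \<le> exp (\<gamma> / 2 * a\<^sup>2) * (max 1 (1 / (\<gamma> / 4)) / (1 + (of_int k)\<^sup>2))"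
    using assms by (intro mult_left_mono exp_neg_square_le) auto
  finally show "gauss_weight \<gamma> a k \<le> exp (\<gamma> / 2 * a\<^sup>2) * max 1 (1 / (\<gamma> / 4)) / (1 + (of_int k)\<^sup>2)"
    by simp
qed

lemma gauss_weight_pos: "gauss_weight \<gamma> a k > 0"
  by (simp add: gauss_weight_def)

lemma gauss_weight_summable:
  assumes "\<gamma> > 0"
  shows "gauss_weight \<gamma> a summable_on UNIV"
proof -
  obtain C where "\<And>k. gauss_weight \<gamma> a k \<le> C / (1 + (of_int k)\<^sup>2)"
    using gauss_weight_le[OF assms] by metis
  then show ?thesis
    by (intro summable_on_int_comparison[of _ C]) (simp add: gauss_weight_pos less_imp_le)
qed

lemma gauss_weight_le_infsum:
  assumes "\<gamma> > 0"
  shows "gauss_weight \<gamma> a k \<le> infsum (gauss_weight \<gamma> a) UNIV"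
  using finite_sum_le_infsum[OF gauss_weight_summable[OF assms], of "{k}"]
  by (simp add: gauss_weight_pos less_imp_le)

text \<open>\<open>embed_pmf\<close> has the intended mass function only for weights that are
  nonnegative with total mass 1, so the normalisation has to be verified here.\<close>

lemma pmf_IG:
  assumes "\<gamma> > 0"
  shows "pmf (IG a \<gamma>) k = gauss_weight \<gamma> a k / infsum (gauss_weight \<gamma> a) UNIV"
proof -
  define Z where "Z = infsum (gauss_weight \<gamma> a) UNIV"
  have Zpos: "Z > 0"
    using gauss_weight_le_infsum[OF assms, of a 0] gauss_weight_pos[of \<gamma> a 0] by (simp add: Z_def)
  obtain C where C: "\<And>k. gauss_weight \<gamma> a k \<le> C / (1 + (of_int k)\<^sup>2)"
    using gauss_weight_le[OF assms] by metis
  have nrm: "norm (gauss_weight \<gamma> a k) \<le> C / (1 + (of_int k)\<^sup>2)" for k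
    using C gauss_weight_pos[of \<gamma> a k] by simp
  have "(\<integral>\<^sup>+k. ennreal (gauss_weight \<gamma> a k / Z) \<partial>count_space UNIV) =
      ennreal (\<integral>k. gauss_weight \<gamma> a k / Z \<partial>count_space UNIV)"
    using count_space_int_infsum(1)[OF nrm] Zpos
    by (intro nn_integral_eq_integral) (auto simp: gauss_weight_pos less_imp_le)
  also have "\<dots> = 1"
    using count_space_int_infsum(2)[OF nrm] Zpos by (simp add: Z_def)
  finally have *: "(\<integral>\<^sup>+k. ennreal (gauss_weight \<gamma> a k / Z) \<partial>count_space UNIV) = 1" .
  have "IG a \<gamma> = embed_pmf (\<lambda>k. gauss_weight \<gamma> a k / Z)"
    by (simp add: IG_def gauss_weight_def[abs_def] Z_def)
  then show ?thesis
    using Zpos * by (simp add: pmf_embed_pmf gauss_weight_pos less_imp_le Z_def)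
qed

section \<open>Moment bounds for integer-valued Gaussians\<close>

lemma exp_ge_power4: "x \<ge> 0 \<Longrightarrow> x ^ 4 / 24 \<le> exp x" for x :: real
proof -
  assume "x \<ge> 0"
  have "(\<Sum>k<5. x ^ k / fact k) \<le> exp x"
    unfolding exp_def by (rule order_trans[OF _ sum_le_suminf[OF summable_exp_generic, of "{..<5}"]])
       (use \<open>x \<ge> 0\<close> in \<open>auto simp: divide_simps\<close>)
  moreover have "x ^ 4 / 24 \<le> (\<Sum>k<5. x ^ k / fact k)"
    using \<open>x \<ge> 0\<close> by (simp add: eval_nat_numeral)
  ultimately show ?thesis by linarith
qed

text \<open>The partition function is at least the weight at 0, and dividing by that weight leaves
  the exponent \<open>- (\<gamma> / 2) * (k\<^sup>2 - 2 * k * a)\<close>. For \<open>a\<close> in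
  \<open>{0..1/2}\<close> the bracket is at least \<open>k\<^sup>2 - \<bar>k\<bar> \<ge> 0\<close>,
  so \<gamma> can be lowered to 12 and the bound depends on neither parameter.\<close>

lemma pmf_IG_le:
  assumes "\<gamma> \<ge> 12" "a \<in> {0..1/2}"
  shows "pmf (IG a \<gamma>) k \<le> exp (- 6 * ((of_int k)\<^sup>2 - \<bar>of_int k\<bar>))"
proof -
  have "gauss_weight \<gamma> a 0 \<le> infsum (gauss_weight \<gamma> a) UNIV"
    using assms by (intro gauss_weight_le_infsum) auto
  then have "pmf (IG a \<gamma>) k \<le> gauss_weight \<gamma> a k / gauss_weight \<gamma> a 0"
    using assms gauss_weight_pos[of \<gamma> a 0] gauss_weight_pos[of \<gamma> a k]
    by (subst pmf_IG) (auto intro!: divide_left_mono mult_pos_pos)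
  also have "\<dots> = exp (- (\<gamma> / 2) * ((of_int k)\<^sup>2 - 2 * of_int k * a))"
    by (simp add: gauss_weight_def exp_diff[symmetric] power2_eq_square algebra_simps)
  also have "\<dots> \<le> exp (- 6 * ((of_int k)\<^sup>2 - \<bar>of_int k\<bar>))"
  proof -
    have "\<bar>2 * of_int k * a\<bar> \<le> \<bar>of_int k\<bar> * 1"
      unfolding abs_mult using assms(2) mult_left_mono[of "2*a" 1 "\<bar>real_of_int k\<bar>"] by (simp add: mult_ac)
    then have "2 * of_int k * a \<le> \<bar>of_int k\<bar>" by linarith
    moreover have "\<bar>real_of_int k\<bar> \<le> (of_int k)\<^sup>2"
    proof -
      have "\<bar>k\<bar> \<le> k\<^sup>2"
        using mult_right_mono[of 1 "\<bar>k\<bar>" "\<bar>k\<bar>"] by (cases "k = 0") (auto simp: power2_eq_square)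
      then show ?thesis by (metis of_int_abs of_int_le_iff of_int_power)
    qed
    ultimately have "6 * ((of_int k)\<^sup>2 - \<bar>of_int k\<bar>) \<le> \<gamma> / 2 * ((of_int k)\<^sup>2 - 2 * of_int k * a)"
      using assms(1) by (intro mult_mono) auto
    then show ?thesis by simp
  qed
  finally show ?thesis .
qed

lemma pmf_IG_third_moment:
  obtains K where "K \<ge> 0"
    "\<And>\<gamma> a k. \<gamma> \<ge> 12 \<Longrightarrow> a \<in> {0..1/2} \<Longrightarrow>
       pmf (IG a \<gamma>) k * (1 + \<bar>of_int k\<bar> ^ 3) \<le> K / (1 + (of_int k)\<^sup>2)"
proof
  fix \<gamma> a :: real and k :: int
  assume "\<gamma> \<ge> 12" "a \<in> {0..1/2}"
  define x where "x = \<bar>real_of_int k\<bar>"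
  have x2: "x\<^sup>2 = (of_int k)\<^sup>2" by (simp add: x_def)
  have "pmf (IG a \<gamma>) k \<le> exp (- 6 * (x\<^sup>2 - x))"
    using pmf_IG_le[OF \<open>\<gamma> \<ge> 12\<close> \<open>a \<in> _\<close>, of k] by (simp add: x_def)
  \<comment> \<open>This is \<open>6 * x \<le> 3 + 3 * x\<^sup>2\<close>. The coefficient 3 then
    permits a cube of \<open>1 / (1 + x\<^sup>2)\<close>: two factors pay for the third moment, one
    remains for summability.\<close>
  also have "\<dots> \<le> exp (3 - 3 * x\<^sup>2)"
    using zero_le_power2[of "x - 1"] by (simp add: power2_eq_square algebra_simps)
  also have "\<dots> = exp 3 * exp (- x\<^sup>2) ^ 3"
    by (simp add: exp_of_nat_mult[symmetric] exp_add[symmetric])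
  also have "\<dots> \<le> exp 3 * (1 / (1 + x\<^sup>2)) ^ 3"
    using exp_neg_square_le[of 1 x] by (intro mult_left_mono power_mono) auto
  finally have "pmf (IG a \<gamma>) k * (1 + x ^ 3) \<le> exp 3 * (1 / (1 + x\<^sup>2)) ^ 3 * (1 + x ^ 3)"
    by (rule mult_right_mono) (auto simp: x_def)
  also have "\<dots> = exp 3 / (1 + x\<^sup>2) * ((1 + x ^ 3) / ((1 + x\<^sup>2) * (1 + x\<^sup>2)))"
    by (simp add: power3_eq_cube)
  also have "\<dots> \<le> exp 3 / (1 + x\<^sup>2) * 1"
  proof (intro mult_left_mono)
    have "x\<^sup>2 * (x - 1)\<^sup>2 \<ge> 0" "x ^ 4 \<ge> 0" by simp_all
    moreover have "x\<^sup>2 * (x - 1)\<^sup>2 = x ^ 4 - 2 * x ^ 3 + x\<^sup>2"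
      by (simp add: power2_eq_square power3_eq_cube power4_eq_xxxx algebra_simps)
    moreover have "(1 + x\<^sup>2) * (1 + x\<^sup>2) = 1 + 2 * x\<^sup>2 + x ^ 4"
      by (simp add: power2_eq_square power4_eq_xxxx algebra_simps)
    moreover have "x\<^sup>2 \<ge> 0" by simp
    ultimately have "1 + x ^ 3 \<le> (1 + x\<^sup>2) * (1 + x\<^sup>2)" by linarith
    then show "(1 + x ^ 3) / ((1 + x\<^sup>2) * (1 + x\<^sup>2)) \<le> 1"
      by (simp add: divide_le_eq_1 add_pos_nonneg)
  qed (auto simp: add_nonneg_nonneg)
  finally show "pmf (IG a \<gamma>) k * (1 + \<bar>of_int k\<bar> ^ 3) \<le> exp 3 / (1 + (of_int k)\<^sup>2)"
    by (simp add: x_def)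
qed auto

lemma abs_le_one_plus_cube: "\<bar>x\<bar> \<le> 1 + \<bar>x\<bar> ^ 3" and square_le_one_plus_cube: "x\<^sup>2 \<le> 1 + \<bar>x\<bar> ^ 3"
  for x :: real
proof -
  have "\<bar>x\<bar> ^ 1 \<le> 1 + \<bar>x\<bar> ^ 3" "\<bar>x\<bar> ^ 2 \<le> 1 + \<bar>x\<bar> ^ 3"
    by (cases "\<bar>x\<bar> \<ge> 1"; use power_increasing[of 1 3 "\<bar>x\<bar>"] power_increasing[of 2 3 "\<bar>x\<bar>"]
          power_le_one[of "\<bar>x\<bar>" 1] power_le_one[of "\<bar>x\<bar>" 2] in \<open>force intro: add_increasing2\<close>)+
  then show "\<bar>x\<bar> \<le> 1 + \<bar>x\<bar> ^ 3" "x\<^sup>2 \<le> 1 + \<bar>x\<bar> ^ 3" by simp_all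
qed

text \<open>Cubic growth covers everything required later: the mean, the second moment and a
  third-order Taylor remainder. The integrability clause is polymorphic because that remainder is
  complex-valued.\<close>

lemma IG_moments:
  obtains K where "K \<ge> 0"
    "\<And>\<gamma> a (f :: int \<Rightarrow> 'a :: {banach, second_countable_topology}) D. \<gamma> \<ge> 12 \<Longrightarrow> a \<in> {0..1/2} \<Longrightarrow>
       (\<And>k. norm (f k) \<le> D * (1 + \<bar>of_int k\<bar> ^ 3)) \<Longrightarrow> integrable (measure_pmf (IG a \<gamma>)) f"
    "\<And>\<gamma> a (f :: int \<Rightarrow> real) D. \<gamma> \<ge> 12 \<Longrightarrow> a \<in> {0..1/2} \<Longrightarrow>
       (\<And>k. \<bar>f k\<bar> \<le> D * (1 + \<bar>of_int k\<bar> ^ 3)) \<Longrightarrow> \<bar>measure_pmf.expectation (IG a \<gamma>) f\<bar> \<le> D * K"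
proof -
  obtain K where K: "K \<ge> 0" "\<And>\<gamma> a k. \<gamma> \<ge> 12 \<Longrightarrow> a \<in> {0..1/2} \<Longrightarrow>
       pmf (IG a \<gamma>) k * (1 + \<bar>of_int k\<bar> ^ 3) \<le> K / (1 + (of_int k)\<^sup>2)"
    using pmf_IG_third_moment by metis
  have bd: "pmf (IG a \<gamma>) k * norm (f k) \<le> (D * K) / (1 + (of_int k)\<^sup>2)"
    if "\<gamma> \<ge> 12" "a \<in> {0..1/2}" "\<And>k. norm (f k) \<le> D * (1 + \<bar>of_int k\<bar> ^ 3)"
    for \<gamma> a k D and f :: "int \<Rightarrow> 'b :: real_normed_vector"
  proof -
    have "D \<ge> 0" using order_trans[OF norm_ge_zero that(3)[of 0]] by simp
    have "pmf (IG a \<gamma>) k * norm (f k) \<le> pmf (IG a \<gamma>) k * (D * (1 + \<bar>of_int k\<bar> ^ 3))"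
      by (intro mult_left_mono that) auto
    also have "\<dots> = D * (pmf (IG a \<gamma>) k * (1 + \<bar>of_int k\<bar> ^ 3))" by simp
    also have "\<dots> \<le> D * (K / (1 + (of_int k)\<^sup>2))"
      by (intro mult_left_mono K that \<open>D \<ge> 0\<close>)
    finally show ?thesis by simp
  qed
  define S where "S = (\<Sum>\<^sub>\<infinity>k::int. 1 / (1 + (of_int k)\<^sup>2) :: real)"
  have "S \<ge> 0" unfolding S_def by (intro infsum_nonneg) auto
  show ?thesis
  proof (rule that[of "K * S"])
    show "K * S \<ge> 0" using K(1) \<open>S \<ge> 0\<close> by simp
  next
    fix \<gamma> a D :: real and f :: "int \<Rightarrow> 'a :: {banach, second_countable_topology}"
    assume "\<gamma> \<ge> 12" "a \<in> {0..1/2}" "\<And>k. norm (f k) \<le> D * (1 + \<bar>of_int k\<bar> ^ 3)"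
    then show "integrable (measure_pmf (IG a \<gamma>)) f"
      by (intro measure_pmf_int_infsum(1)[of _ f "D * K"] bd)
  next
    fix \<gamma> a D :: real and f :: "int \<Rightarrow> real"
    assume *: "\<gamma> \<ge> 12" "a \<in> {0..1/2}" "\<And>k. \<bar>f k\<bar> \<le> D * (1 + \<bar>of_int k\<bar> ^ 3)"
    have bd': "pmf (IG a \<gamma>) k * norm (f k) \<le> (D * K) / (1 + (of_int k)\<^sup>2)" for k
      by (rule bd[OF *(1,2)]) (use *(3) in auto)
    have nrm: "norm (pmf (IG a \<gamma>) k *\<^sub>R f k) \<le> (D * K) / (1 + (of_int k)\<^sup>2)" for k
      using bd'[of k] by (simp add: abs_mult)
    have abs_summable: "(\<lambda>k. norm (pmf (IG a \<gamma>) k *\<^sub>R f k)) summable_on UNIV"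
      by (rule summable_on_int_comparison[of _ "D * K"]) (use nrm in auto)
    have "measure_pmf.expectation (IG a \<gamma>) f = (\<Sum>\<^sub>\<infinity>k. pmf (IG a \<gamma>) k *\<^sub>R f k)"
      by (rule measure_pmf_int_infsum(2)[OF bd'])
    also have "norm \<dots> \<le> (\<Sum>\<^sub>\<infinity>k. norm (pmf (IG a \<gamma>) k *\<^sub>R f k))"
      by (intro norm_infsum_bound abs_summable)
    also have "\<dots> \<le> (\<Sum>\<^sub>\<infinity>k. D * K * (1 / (1 + (of_int k)\<^sup>2)))"
    proof (rule infsum_mono)
      show "(\<lambda>k. norm (pmf (IG a \<gamma>) k *\<^sub>R f k)) summable_on UNIV"
        by (rule abs_summable)
      show "(\<lambda>k::int. D * K * (1 / (1 + (of_int k)\<^sup>2))) summable_on UNIV"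
        by (intro summable_on_cmult_right summable_on_inverse_one_plus_square)
    qed (use nrm in auto)
    also have "\<dots> = D * K * S"
      unfolding S_def by (rule infsum_cmult_right) (use summable_on_inverse_one_plus_square in auto)
    finally show "\<bar>measure_pmf.expectation (IG a \<gamma>) f\<bar> \<le> D * (K * S)"
      by (simp add: mult.assoc)
  qed
qed

lemma Var_IG_nonneg: "Var_IG a \<gamma> \<ge> 0"
  unfolding Var_IG_def by (rule measure_pmf.variance_positive)

definition min_Var_IG :: "real \<Rightarrow> real" where
  "min_Var_IG \<gamma> = (INF a\<in>{0..1/2}. Var_IG a \<gamma>)"

lemma min_Var_IG_le: "a \<in> {0..1/2} \<Longrightarrow> min_Var_IG \<gamma> \<le> Var_IG a \<gamma>"
  unfolding min_Var_IG_def
  by (intro cINF_lower bdd_belowI2[of _ 0]) (auto simp: Var_IG_nonneg)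

lemma min_Var_IG_nonneg: "min_Var_IG \<gamma> \<ge> 0"
  unfolding min_Var_IG_def by (intro cINF_greatest) (auto simp: Var_IG_nonneg)

lemma M_err_eq: "M_err \<beta> = (2 * pi)\<^sup>2 * \<beta> * min_Var_IG ((2 * pi)\<^sup>2 * \<beta>)"
  by (simp add: M_err_def min_Var_IG_def)

lemma M_err_nonneg: "\<beta> \<ge> 0 \<Longrightarrow> M_err \<beta> \<ge> 0"
  by (simp add: M_err_eq min_Var_IG_nonneg)

text \<open>Second-order Taylor expansion about the mean, with the remainder controlled by the third
  absolute central moment. For \<open>h\<close> too large for the expansion to be useful, the
  trivial bound 1 suffices because the cubic term already outweighs the quadratic one.\<close>

lemma IG_charfun_bound:
  obtains C where "C \<ge> 0"
    "\<And>\<gamma> a h. \<gamma> \<ge> 12 \<Longrightarrow> a \<in> {0..1/2} \<Longrightarrow>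
      norm (measure_pmf.expectation (IG a \<gamma>) (\<lambda>k. cis (2 * pi * h * of_int k)))
        \<le> exp (- (pi\<^sup>2 * h\<^sup>2 * min_Var_IG \<gamma>) + C * \<bar>h\<bar> ^ 3)"
proof -
  obtain K where K: "K \<ge> 0"
    "\<And>\<gamma> a (f :: int \<Rightarrow> complex) D. \<gamma> \<ge> 12 \<Longrightarrow> a \<in> {0..1/2} \<Longrightarrow>
       (\<And>k. norm (f k) \<le> D * (1 + \<bar>of_int k\<bar> ^ 3)) \<Longrightarrow> integrable (measure_pmf (IG a \<gamma>)) f"
    "\<And>\<gamma> a (f :: int \<Rightarrow> real) D. \<gamma> \<ge> 12 \<Longrightarrow> a \<in> {0..1/2} \<Longrightarrow>
       (\<And>k. \<bar>f k\<bar> \<le> D * (1 + \<bar>of_int k\<bar> ^ 3)) \<Longrightarrow> \<bar>measure_pmf.expectation (IG a \<gamma>) f\<bar> \<le> D * K"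
    using IG_moments by metis
  \<comment> \<open>The integrability clause is tied to one value type for each use of
    \<open>IG_moments\<close>; the complex instance is above, this is the real one.\<close>
  obtain K' where K': "\<And>\<gamma> a (f :: int \<Rightarrow> real) D. \<gamma> \<ge> 12 \<Longrightarrow> a \<in> {0..1/2} \<Longrightarrow>
       (\<And>k. norm (f k) \<le> D * (1 + \<bar>of_int k\<bar> ^ 3)) \<Longrightarrow> integrable (measure_pmf (IG a \<gamma>)) f"
    using IG_moments by metis
  \<comment> \<open>\<open>c\<^sub>3\<close> is \<open>(2 * pi) ^ 3 / 6\<close> times the bound
    \<open>(4 + 4 * K ^ 3) * K\<close> for the third absolute central moment. The second entry of
    the maximum below serves large \<open>h\<close>.\<close>
  define c\<^sub>3 where "c\<^sub>3 = 8 * pi ^ 3 * ((4 + 4 * K ^ 3) * K) / 6"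
  define C where "C = max c\<^sub>3 (pi\<^sup>2 * K * sqrt (2 * pi\<^sup>2 * K))"
  have "c\<^sub>3 \<ge> 0" using K(1) by (simp add: c\<^sub>3_def)
  show ?thesis
  proof (rule that[of C])
    show "C \<ge> 0" using \<open>c\<^sub>3 \<ge> 0\<close> by (simp add: C_def)
  next
    fix \<gamma> a h :: real
    assume \<gamma>: "\<gamma> \<ge> 12" and a: "a \<in> {0..1/2}"
    let ?E = "\<lambda>f. measure_pmf.expectation (IG a \<gamma>) f"
    define m where "m = ?E real_of_int"
    have int1: "integrable (measure_pmf (IG a \<gamma>)) real_of_int"
      by (rule K'[OF \<gamma> a, of _ 1]) (use abs_le_one_plus_cube in auto)
    have int2: "integrable (measure_pmf (IG a \<gamma>)) (\<lambda>k. (real_of_int k)\<^sup>2)"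
      by (rule K'[OF \<gamma> a, of _ 1]) (use square_le_one_plus_cube in auto)
    have "\<bar>m\<bar> \<le> 1 * K"
      unfolding m_def by (rule K(3)[OF \<gamma> a]) (use abs_le_one_plus_cube in auto)
    have cube: "\<bar>of_int k - m\<bar> ^ 3 \<le> (4 + 4 * K ^ 3) * (1 + \<bar>of_int k\<bar> ^ 3)" for k :: int
    proof -
      define x where "x = \<bar>real_of_int k\<bar>"
      have "\<bar>of_int k - m\<bar> \<le> x + K" using \<open>\<bar>m\<bar> \<le> 1 * K\<close> by (simp add: x_def)
      then have "\<bar>of_int k - m\<bar> ^ 3 \<le> (x + K) ^ 3" by (intro power_mono) auto
      \<comment> \<open>Convexity of the cube, in the form of an explicit factorisation of the
        difference.\<close>
      also have "\<dots> \<le> 4 * x ^ 3 + 4 * K ^ 3"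
      proof -
        have "4 * x ^ 3 + 4 * K ^ 3 - (x + K) ^ 3 = 3 * (x + K) * (x - K)\<^sup>2"
          by (simp add: power2_eq_square power3_eq_cube algebra_simps)
        also have "\<dots> \<ge> 0" using K(1) by (simp add: x_def)
        finally show ?thesis by simp
      qed
      also have "\<dots> \<le> (4 + 4 * K ^ 3) * (1 + x ^ 3)"
        using K(1) by (simp add: algebra_simps x_def)
      finally show ?thesis by (simp add: x_def)
    qed
    define V where "V = Var_IG a \<gamma>"
    have V: "V = ?E (\<lambda>k. (of_int k - m)\<^sup>2)" by (simp add: V_def Var_IG_def m_def)
    have "V = ?E (\<lambda>k. (real_of_int k)\<^sup>2) - m\<^sup>2"
      unfolding V_def Var_IG_def m_def by (rule measure_pmf.variance_eq) (use int1 int2 in auto)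
    moreover have "\<bar>?E (\<lambda>k. (real_of_int k)\<^sup>2)\<bar> \<le> 1 * K"
      by (rule K(3)[OF \<gamma> a]) (use square_le_one_plus_cube in auto)
    ultimately have "V \<le> K" using zero_le_power2[of m] by linarith
    have v: "0 \<le> min_Var_IG \<gamma>" "min_Var_IG \<gamma> \<le> V"
      using a by (auto simp: V_def min_Var_IG_le min_Var_IG_nonneg)
    have cis_le1: "norm (?E (\<lambda>k. cis (2 * pi * h * of_int k))) \<le> 1"
    proof -
      have "norm (?E (\<lambda>k. cis (2 * pi * h * of_int k))) \<le> ?E (\<lambda>k. norm (cis (2 * pi * h * of_int k)))"
        by (rule integral_norm_bound)
      then show ?thesis by simp
    qed
    show "norm (?E (\<lambda>k. cis (2 * pi * h * of_int k))) \<le> exp (- (pi\<^sup>2 * h\<^sup>2 * min_Var_IG \<gamma>) + C * \<bar>h\<bar> ^ 3)"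
    proof (cases "2 * pi\<^sup>2 * h\<^sup>2 * V \<le> 1")
      \<comment> \<open>In this range \<open>1 - 2 * pi\<^sup>2 * h\<^sup>2 * V\<close> is
        nonnegative and equals its absolute value.\<close>
      case True
      define X where "X = (\<lambda>k::int. 2 * pi * h * (of_int k - m))"
      define R where "R = (\<lambda>x. iexp x - (1 + \<i> * complex_of_real x - complex_of_real (x\<^sup>2) / 2))"
      have R: "norm (R x) \<le> \<bar>x\<bar> ^ 3 / 6" for x
        using iexp_approx1[of x 2]
        by (simp add: R_def numeral_2_eq_2 power2_eq_square fact_numeral algebra_simps numeral_3_eq_3)
      have intX: "integrable (measure_pmf (IG a \<gamma>)) X"
        unfolding X_def using int1 by auto
      have "integrable (measure_pmf (IG a \<gamma>)) (\<lambda>k. (of_int k - m)\<^sup>2)"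
        unfolding power2_diff using int1 int2 by (intro Bochner_Integration.integrable_add Bochner_Integration.integrable_diff) auto
      then have intX2: "integrable (measure_pmf (IG a \<gamma>)) (\<lambda>k. (X k)\<^sup>2)"
        unfolding X_def power_mult_distrib by auto
      have intX2': "integrable (measure_pmf (IG a \<gamma>)) (\<lambda>k. (complex_of_real (X k))\<^sup>2)"
        using integrable_of_real[OF intX2, where 'a = complex] by simp
      have EX2': "?E (\<lambda>k. (complex_of_real (X k))\<^sup>2) = complex_of_real (?E (\<lambda>k. (X k)\<^sup>2))"
        by (simp flip: of_real_power)
      have normR: "norm (R (X k)) \<le> 8 * pi ^ 3 * \<bar>h\<bar> ^ 3 / 6 * (4 + 4 * K ^ 3) * (1 + \<bar>of_int k\<bar> ^ 3)" for k
      proof -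
        have "norm (R (X k)) \<le> 8 * pi ^ 3 * \<bar>h\<bar> ^ 3 / 6 * \<bar>of_int k - m\<bar> ^ 3"
          using R[of "X k"] by (simp add: X_def abs_mult power_mult_distrib)
        also have "\<dots> \<le> 8 * pi ^ 3 * \<bar>h\<bar> ^ 3 / 6 * ((4 + 4 * K ^ 3) * (1 + \<bar>of_int k\<bar> ^ 3))"
          by (intro mult_left_mono cube) auto
        finally show ?thesis by (simp add: mult.assoc)
      qed
      have intR: "integrable (measure_pmf (IG a \<gamma>)) (\<lambda>k. R (X k))"
        by (rule K(2)[OF \<gamma> a]) (rule normR)
      have EX: "?E X = 0"
        unfolding X_def using int1 by (simp add: m_def)
      have EX2: "?E (\<lambda>k. (X k)\<^sup>2) = 4 * pi\<^sup>2 * h\<^sup>2 * V"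
        unfolding X_def V power_mult_distrib by simp
      \<comment> \<open>Centring at the mean costs a phase of modulus one and removes the linear
        term in expectation.\<close>
      have eq: "cis (2 * pi * h * of_int k) =
          cis (2 * pi * h * m) * ((1 + \<i> * complex_of_real (X k) - complex_of_real ((X k)\<^sup>2) / 2) + R (X k))" for k
        by (simp add: R_def cis_conv_exp exp_add[symmetric] X_def algebra_simps)
      have "?E (\<lambda>k. cis (2 * pi * h * of_int k)) = cis (2 * pi * h * m) *
          ?E (\<lambda>k. (1 + \<i> * complex_of_real (X k) - complex_of_real ((X k)\<^sup>2) / 2) + R (X k))"
        unfolding eq by simp
      also have "?E (\<lambda>k. (1 + \<i> * complex_of_real (X k) - complex_of_real ((X k)\<^sup>2) / 2) + R (X k)) =
          ?E (\<lambda>k. 1 + \<i> * complex_of_real (X k) - complex_of_real ((X k)\<^sup>2) / 2) + ?E (\<lambda>k. R (X k))"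
        using intX intX2' intR by (intro Bochner_Integration.integral_add) auto
      also have "?E (\<lambda>k. 1 + \<i> * complex_of_real (X k) - complex_of_real ((X k)\<^sup>2) / 2) =
          1 + \<i> * complex_of_real (?E X) - complex_of_real (?E (\<lambda>k. (X k)\<^sup>2)) / 2"
        using intX intX2' by (simp add: EX2')
      also have "\<dots> = complex_of_real (1 - 2 * pi\<^sup>2 * h\<^sup>2 * V)"
        by (simp add: EX EX2)
      finally have "norm (?E (\<lambda>k. cis (2 * pi * h * of_int k))) =
          norm (complex_of_real (1 - 2 * pi\<^sup>2 * h\<^sup>2 * V) + ?E (\<lambda>k. R (X k)))"
        by (simp add: norm_mult)
      also have "\<dots> \<le> \<bar>1 - 2 * pi\<^sup>2 * h\<^sup>2 * V\<bar> + norm (?E (\<lambda>k. R (X k)))"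
        using norm_triangle_ineq[of "complex_of_real (1 - 2 * pi\<^sup>2 * h\<^sup>2 * V)" "?E (\<lambda>k. R (X k))"] 
        by (simp only: norm_of_real)
      finally have N: "norm (?E (\<lambda>k. cis (2 * pi * h * of_int k))) \<le>
          \<bar>1 - 2 * pi\<^sup>2 * h\<^sup>2 * V\<bar> + norm (?E (\<lambda>k. R (X k)))" .
      have "norm (?E (\<lambda>k. R (X k))) \<le> ?E (\<lambda>k. norm (R (X k)))"
        by (rule integral_norm_bound)
      also have "?E (\<lambda>k. norm (R (X k))) \<le> 8 * pi ^ 3 * \<bar>h\<bar> ^ 3 / 6 * (4 + 4 * K ^ 3) * K"
        by (rule order_trans[OF abs_ge_self K(3)[OF \<gamma> a]]) (use normR in auto)
      also have "\<dots> = c\<^sub>3 * \<bar>h\<bar> ^ 3" by (simp add: c\<^sub>3_def)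
      also have "\<dots> \<le> C * \<bar>h\<bar> ^ 3" by (intro mult_right_mono) (auto simp: C_def)
      finally have "norm (?E (\<lambda>k. R (X k))) \<le> C * \<bar>h\<bar> ^ 3" .
      \<comment> \<open>Only half of the second-order term
        \<open>2 * pi\<^sup>2 * h\<^sup>2 * V\<close> is kept, which is exactly the amount encoded
        by \<open>M_err \<beta> / 2\<close>.\<close>
      moreover have "pi\<^sup>2 * h\<^sup>2 * min_Var_IG \<gamma> \<le> pi\<^sup>2 * h\<^sup>2 * V" "0 \<le> pi\<^sup>2 * h\<^sup>2 * V"
        using v by (auto intro!: mult_left_mono)
      moreover have "1 - pi\<^sup>2 * h\<^sup>2 * min_Var_IG \<gamma> + C * \<bar>h\<bar> ^ 3 \<le>
          exp (- (pi\<^sup>2 * h\<^sup>2 * min_Var_IG \<gamma>) + C * \<bar>h\<bar> ^ 3)"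
        using exp_ge_add_one_self[of "- (pi\<^sup>2 * h\<^sup>2 * min_Var_IG \<gamma>) + C * \<bar>h\<bar> ^ 3"] by linarith
      ultimately show ?thesis using N True by linarith
    next
      \<comment> \<open>Here \<open>1 \<le> sqrt (2 * pi\<^sup>2 * K) * \<bar>h\<bar>\<close>;
        multiplying \<open>pi\<^sup>2 * K * h\<^sup>2\<close> by this factor bounds it by the cubic
        term, so the claimed bound is at least 1.\<close>
      case False
      have "2 * pi\<^sup>2 * h\<^sup>2 * V \<le> 2 * pi\<^sup>2 * h\<^sup>2 * K"
        using \<open>V \<le> K\<close> by (intro mult_left_mono) auto
      then have "1 \<le> 2 * pi\<^sup>2 * h\<^sup>2 * K" using False by linarith
      then have "1 \<le> sqrt (2 * pi\<^sup>2 * K * h\<^sup>2)" by (simp add: mult_ac)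
      then have "1 \<le> sqrt (2 * pi\<^sup>2 * K) * \<bar>h\<bar>" by (simp only: real_sqrt_mult real_sqrt_abs)
      then have "pi\<^sup>2 * K * h\<^sup>2 * 1 \<le> pi\<^sup>2 * K * h\<^sup>2 * (sqrt (2 * pi\<^sup>2 * K) * \<bar>h\<bar>)"
        using K(1) by (intro mult_left_mono) auto
      also have "\<dots> = (pi\<^sup>2 * K * sqrt (2 * pi\<^sup>2 * K)) * \<bar>h\<bar> ^ 3"
        by (simp add: power3_eq_cube power2_eq_square)
      also have "\<dots> \<le> C * \<bar>h\<bar> ^ 3" by (intro mult_right_mono) (auto simp: C_def)
      finally have "pi\<^sup>2 * h\<^sup>2 * K \<le> C * \<bar>h\<bar> ^ 3" by (simp add: mult_ac)
      moreover have "pi\<^sup>2 * h\<^sup>2 * min_Var_IG \<gamma> \<le> pi\<^sup>2 * h\<^sup>2 * K"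
        using v \<open>V \<le> K\<close> by (intro mult_left_mono) auto
      ultimately have "0 \<le> - (pi\<^sup>2 * h\<^sup>2 * min_Var_IG \<gamma>) + C * \<bar>h\<bar> ^ 3" by linarith
      then have "1 \<le> exp (- (pi\<^sup>2 * h\<^sup>2 * min_Var_IG \<gamma>) + C * \<bar>h\<bar> ^ 3)"
        by (simp only: one_le_exp_iff)
      with cis_le1 show ?thesis by linarith
    qed
  qed
qed


section \<open>Bounds on the error function for \<beta> \<ge> 1/3\<close>

lemma gamma_ge_12: "\<beta> \<ge> 1/3 \<Longrightarrow> (2 * pi)\<^sup>2 * \<beta> \<ge> 12"
proof -
  assume "\<beta> \<ge> 1/3"
  have "6\<^sup>2 \<le> (2 * pi)\<^sup>2" using pi_gt3 by (intro power_mono) auto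
  then have "36 * (1/3) \<le> (2 * pi)\<^sup>2 * \<beta>"
    using \<open>\<beta> \<ge> 1/3\<close> by (intro mult_mono) auto
  then show ?thesis by simp
qed

lemma infsum_inverse_one_plus_square_le:
  "(\<Sum>\<^sub>\<infinity>k::int. 1 / (1 + (of_int k)\<^sup>2)) \<le> pi + (1 :: real)"
  by (rule infsum_le_finite_sums[OF summable_on_inverse_one_plus_square])
     (use sum_inverse_one_plus_square_le in auto)

text \<open>The infimum is at most the variance at \<open>a = 0\<close>, hence at most the second
  moment there, and the Gaussian decay makes \<gamma> times that moment at most
  \<open>(4/9) * (pi + 1) < 2\<close>. It is used to keep the coefficient
  \<open>1 - M_err \<beta> / 2\<close> of the energy nonnegative.\<close>

lemma M_err_le_2:
  assumes "\<beta> \<ge> 1/3"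
  shows "M_err \<beta> \<le> 2"
proof -
  define \<gamma> where "\<gamma> = (2 * pi)\<^sup>2 * \<beta>"
  have \<gamma>: "\<gamma> \<ge> 12" using gamma_ge_12[OF assms] by (simp add: \<gamma>_def)
  \<comment> \<open>The constant is \<open>2 * (2/9)\<close>: \<open>384 / 12 ^ 3 = 2/9\<close>
    results from the quartic lower bound on \<open>exp\<close>, and
    \<open>1 / k\<^sup>2 \<le> 2 / (1 + k\<^sup>2)\<close> for nonzero \<open>k\<close>.\<close>
  have bd: "\<bar>pmf (IG 0 \<gamma>) k *\<^sub>R (\<gamma> * (of_int k)\<^sup>2)\<bar> \<le> (4/9) / (1 + (of_int k)\<^sup>2)" for k :: int
  proof (cases "k = 0")
    case False
    define x where "x = \<gamma> * (of_int k)\<^sup>2"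
    have k1: "(1::real) \<le> (of_int k)\<^sup>2" using False 
      by (metis of_int_1_le_iff of_int_power power2_eq_square int_one_le_iff_zero_less zero_less_power2)
    have x: "x \<ge> 12 * (of_int k)\<^sup>2" using \<gamma> by (simp add: x_def mult_right_mono)
    then have xpos: "x > 0" using k1 by linarith
    have "gauss_weight \<gamma> 0 0 \<le> infsum (gauss_weight \<gamma> 0) UNIV"
      using \<gamma> by (intro gauss_weight_le_infsum) auto
    then have "pmf (IG 0 \<gamma>) k \<le> gauss_weight \<gamma> 0 k / gauss_weight \<gamma> 0 0"
      using \<gamma> gauss_weight_pos[of \<gamma> 0 0] gauss_weight_pos[of \<gamma> 0 k]
      by (subst pmf_IG) (auto intro!: divide_left_mono mult_pos_pos)
    also have "\<dots> = 1 / exp (x / 2)" by (simp add: gauss_weight_def x_def exp_minus divide_simps)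
    also have "\<dots> \<le> 1 / ((x / 2) ^ 4 / 24)"
      using exp_ge_power4[of "x/2"] xpos by (intro divide_left_mono) auto
    also have "\<dots> = 384 / x ^ 4" by (simp add: power_divide)
    finally have "pmf (IG 0 \<gamma>) k * x \<le> 384 / x ^ 4 * x"
      using xpos by (intro mult_right_mono) auto
    also have "\<dots> = 384 / x ^ 3" using xpos by (simp add: field_simps eval_nat_numeral)
    also have "\<dots> \<le> 384 / (12 * (of_int k)\<^sup>2) ^ 3"
      using x k1 xpos False by (intro divide_left_mono power_mono) auto
    also have "\<dots> = (2/9) / ((of_int k)\<^sup>2) ^ 3" by (simp add: power_mult_distrib)
    also have "\<dots> \<le> (2/9) / (of_int k)\<^sup>2"
      using k1 self_le_power[of "(real_of_int k)\<^sup>2" 3] by (intro divide_left_mono) auto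
    also have "\<dots> \<le> (4/9) / (1 + (of_int k)\<^sup>2)"
      using k1 by (simp add: divide_simps)
    finally show ?thesis using xpos by (simp add: x_def)
  qed auto
  have bd': "pmf (IG 0 \<gamma>) k * norm (\<gamma> * (of_int k)\<^sup>2) \<le> (4/9) / (1 + (of_int k)\<^sup>2)" for k :: int
    using bd[of k] by (simp add: abs_mult)
  note E = measure_pmf_int_infsum[of "IG 0 \<gamma>" "\<lambda>k. \<gamma> * (of_int k)\<^sup>2", OF bd']
  have "measure_pmf.expectation (IG 0 \<gamma>) (\<lambda>k. \<gamma> * (of_int k)\<^sup>2) \<le>
      (\<Sum>\<^sub>\<infinity>k::int. (4/9) * (1 / (1 + (of_int k)\<^sup>2)))"
    unfolding E(2)
  proof (rule infsum_mono)
    show "(\<lambda>k. pmf (IG 0 \<gamma>) k *\<^sub>R (\<gamma> * (real_of_int k)\<^sup>2)) summable_on UNIV"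
      by (rule summable_on_int_comparison[of _ "4/9"]) (use bd in auto)
    show "(\<lambda>k::int. (4/9) * (1 / (1 + (of_int k)\<^sup>2)) :: real) summable_on UNIV"
      by (intro summable_on_cmult_right summable_on_inverse_one_plus_square)
  qed (use bd in \<open>auto simp: abs_le_iff\<close>)
  also have "\<dots> = (4/9) * (\<Sum>\<^sub>\<infinity>k::int. 1 / (1 + (of_int k)\<^sup>2))"
    by (rule infsum_cmult_right) (use summable_on_inverse_one_plus_square in auto)
  also have "\<dots> \<le> (4/9) * (pi + 1)"
    using infsum_inverse_one_plus_square_le by (intro mult_left_mono) auto
  also have "\<dots> \<le> 2" using pi_approx by simp
  finally have E2: "\<gamma> * measure_pmf.expectation (IG 0 \<gamma>) (\<lambda>k. (of_int k)\<^sup>2) \<le> 2" by simp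
  have int2: "integrable (measure_pmf (IG 0 \<gamma>)) (\<lambda>k. (real_of_int k)\<^sup>2)"
    using E(1) \<gamma> by simp
  have int1: "integrable (measure_pmf (IG 0 \<gamma>)) real_of_int"
  proof (rule Bochner_Integration.integrable_bound[OF int2])
    have "norm (real_of_int k) \<le> norm ((real_of_int k)\<^sup>2)" for k
    proof -
      have "\<bar>k\<bar> \<le> k\<^sup>2"
        using mult_right_mono[of 1 "\<bar>k\<bar>" "\<bar>k\<bar>"] by (cases "k = 0") (auto simp: power2_eq_square)
      then show ?thesis by (metis of_int_abs of_int_le_iff of_int_power real_norm_def abs_power2)
    qed
    then show "AE k in measure_pmf (IG 0 \<gamma>). norm (real_of_int k) \<le> norm ((real_of_int k)\<^sup>2)" by simp
  qed auto
  have "Var_IG 0 \<gamma> \<le> measure_pmf.expectation (IG 0 \<gamma>) (\<lambda>k. (of_int k)\<^sup>2)"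
    unfolding Var_IG_def by (subst measure_pmf.variance_eq) (use int1 int2 in auto)
  then have "min_Var_IG \<gamma> \<le> measure_pmf.expectation (IG 0 \<gamma>) (\<lambda>k. (of_int k)\<^sup>2)"
    using min_Var_IG_le[of 0 \<gamma>] by auto
  then have "\<gamma> * min_Var_IG \<gamma> \<le> \<gamma> * measure_pmf.expectation (IG 0 \<gamma>) (\<lambda>k. (of_int k)\<^sup>2)"
    using \<gamma> by (intro mult_left_mono) auto
  moreover have "M_err \<beta> = \<gamma> * min_Var_IG \<gamma>" by (simp add: M_err_eq \<gamma>_def)
  ultimately show ?thesis using E2 by linarith
qed

section \<open>The entire extension of the Villain weight\<close>

definition villain_ext_term :: "real \<Rightarrow> complex \<Rightarrow> int \<Rightarrow> complex" where
  "villain_ext_term \<beta> z k = exp (- (of_real (\<beta> / 2)) * (z + of_real (2 * pi * of_int k))\<^sup>2)"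

definition villain_ext :: "real \<Rightarrow> complex \<Rightarrow> complex" where
  "villain_ext \<beta> z = infsum (villain_ext_term \<beta> z) UNIV"

lemma norm_villain_ext_term:
  "norm (villain_ext_term \<beta> z k) = exp (- (\<beta> / 2) * ((Re z + 2 * pi * of_int k)\<^sup>2 - (Im z)\<^sup>2))"
  by (simp add: villain_ext_term_def norm_exp_eq_Re power2_eq_square field_simps)

text \<open>The imaginary part only inflates each term by a factor that is bounded on discs; the
  summable majorant is uniform in \<open>norm z \<le> r\<close>, as the Weierstrass test
  requires.\<close>

lemma norm_villain_ext_term_le:
  assumes "\<beta> > 0" "norm z \<le> r"
  shows "norm (villain_ext_term \<beta> z k) \<le>
    exp (\<beta> / 2 * r\<^sup>2) * max 1 (1 / (\<beta> * pi\<^sup>2)) / (1 + (of_int k)\<^sup>2)"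
proof -
  have "(norm z)\<^sup>2 \<le> r\<^sup>2" using assms by (intro power_mono) auto
  then have "(Re z)\<^sup>2 + (Im z)\<^sup>2 \<le> r\<^sup>2" by (simp add: cmod_power2)
  moreover have "(Re z + 2 * pi * of_int k)\<^sup>2 \<ge> 2 * pi\<^sup>2 * (of_int k)\<^sup>2 - (Re z)\<^sup>2"
    using square_diff_ge[of "2 * pi * of_int k" "- Re z"] by (simp add: power_mult_distrib add.commute)
  ultimately have "2 * pi\<^sup>2 * (of_int k)\<^sup>2 - r\<^sup>2 \<le> (Re z + 2 * pi * of_int k)\<^sup>2 - (Im z)\<^sup>2"
    by linarith
  then have "\<beta> / 2 * (2 * pi\<^sup>2 * (of_int k)\<^sup>2 - r\<^sup>2) \<le> \<beta> / 2 * ((Re z + 2 * pi * of_int k)\<^sup>2 - (Im z)\<^sup>2)"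
    using assms by (intro mult_left_mono) auto
  then have "norm (villain_ext_term \<beta> z k) \<le> exp (\<beta> / 2 * r\<^sup>2) * exp (- ((\<beta> * pi\<^sup>2) * (of_int k)\<^sup>2))"
    unfolding norm_villain_ext_term exp_add[symmetric] by (simp add: algebra_simps)
  also have "\<dots> \<le> exp (\<beta> / 2 * r\<^sup>2) * (max 1 (1 / (\<beta> * pi\<^sup>2)) / (1 + (of_int k)\<^sup>2))"
    using assms by (intro mult_left_mono exp_neg_square_le) auto
  finally show ?thesis by simp
qed

lemma villain_ext_term_summable:
  assumes "\<beta> > 0"
  shows "villain_ext_term \<beta> z summable_on UNIV"
  by (rule summable_on_int_comparison) (rule norm_villain_ext_term_le[OF assms order.refl])

lemma villain_ext_holomorphic:
  assumes "\<beta> > 0"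
  shows "villain_ext \<beta> holomorphic_on UNIV"
proof -
  have "villain_ext \<beta> holomorphic_on ball 0 r" for r
  proof -
    have lim: "uniform_limit (cball 0 r) (\<lambda>F z. \<Sum>k\<in>F. villain_ext_term \<beta> z k) (villain_ext \<beta>)
        (finite_subsets_at_top UNIV)"
      unfolding villain_ext_def
    proof (rule Weierstrass_m_test_general)
      show "norm (villain_ext_term \<beta> z k) \<le>
          exp (\<beta> / 2 * r\<^sup>2) * max 1 (1 / (\<beta> * pi\<^sup>2)) / (1 + (of_int k)\<^sup>2)" if "z \<in> cball 0 r" for z k
        using that assms by (intro norm_villain_ext_term_le) auto
      show "(\<lambda>k::int. exp (\<beta> / 2 * r\<^sup>2) * max 1 (1 / (\<beta> * pi\<^sup>2)) / (1 + (of_int k)\<^sup>2)) summable_on UNIV"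
        using summable_on_cmult_right[OF summable_on_inverse_one_plus_square,
            of "exp (\<beta> / 2 * r\<^sup>2) * max 1 (1 / (\<beta> * pi\<^sup>2))"] by simp
    qed
    have "(\<lambda>z. \<Sum>k\<in>F. villain_ext_term \<beta> z k) holomorphic_on A" for F A
      unfolding villain_ext_term_def by (intro holomorphic_intros)
    then have ev: "\<forall>\<^sub>F F in finite_subsets_at_top UNIV.
        continuous_on (cball 0 r) (\<lambda>z. \<Sum>k\<in>F. villain_ext_term \<beta> z k) \<and>
        (\<lambda>z. \<Sum>k\<in>F. villain_ext_term \<beta> z k) holomorphic_on ball 0 r"
      by (intro always_eventually allI conjI holomorphic_on_imp_continuous_on)
    show ?thesis
      by (rule holomorphic_uniform_limit[OF ev lim]) auto
  qed
  then have "villain_ext \<beta> field_differentiable at z" for z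
    by (rule holomorphic_on_imp_differentiable_at[of _ "ball 0 (norm z + 1)"]) auto
  then show ?thesis
    by (simp add: holomorphic_on_def field_differentiable_at_within)
qed

lemma villain_ext_term_shift: "villain_ext_term \<beta> (z + of_real (2 * pi * of_int m)) k = villain_ext_term \<beta> z (m + k)"
  by (simp add: villain_ext_term_def algebra_simps)

lemma villain_ext_periodic: "villain_ext \<beta> (z + of_real (2 * pi * of_int m)) = villain_ext \<beta> z"
  unfolding villain_ext_def villain_ext_term_shift
  by (rule infsum_reindex_bij_betw[where g = "\<lambda>k. m + k"])
     (auto intro!: bij_betwI[of _ _ _ "\<lambda>k. k - m"])

lemma villain_ext_uminus: "villain_ext \<beta> (- z) = villain_ext \<beta> z"
proof -
  have "villain_ext_term \<beta> (- z) k = villain_ext_term \<beta> z (- k)" for k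
    using power2_minus[of "z - of_real (2 * pi * of_int k)"]
    by (simp add: villain_ext_term_def)
  then have "villain_ext \<beta> (- z) = (\<Sum>\<^sub>\<infinity>k. villain_ext_term \<beta> z (- k))"
    unfolding villain_ext_def by (intro infsum_cong)
  also have "\<dots> = villain_ext \<beta> z"
    unfolding villain_ext_def
    by (rule infsum_reindex_bij_betw[where g = uminus]) (auto intro!: bij_betwI[of _ _ _ uminus])
  finally show ?thesis .
qed

lemma villain_ext_of_real:
  assumes "\<beta> > 0"
  shows "villain_ext \<beta> (of_real t) = of_real (villain_weight \<beta> t)"
proof -
  have eq: "villain_ext_term \<beta> (of_real t) k = of_real (exp (- (\<beta> / 2) * (t + 2 * pi * of_int k)\<^sup>2))" for k
    by (simp add: villain_ext_term_def flip: exp_of_real)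
  have "Re (villain_ext \<beta> (of_real t)) = (\<Sum>\<^sub>\<infinity>k. Re (villain_ext_term \<beta> (of_real t) k))"
    unfolding villain_ext_def by (rule infsum_Re[symmetric]) (rule villain_ext_term_summable[OF assms])
  moreover have "Im (villain_ext \<beta> (of_real t)) = (\<Sum>\<^sub>\<infinity>k. Im (villain_ext_term \<beta> (of_real t) k))"
    unfolding villain_ext_def by (rule infsum_Im[symmetric]) (rule villain_ext_term_summable[OF assms])
  ultimately show ?thesis
    unfolding eq by (simp add: complex_eq_iff villain_weight_def)
qed

text \<open>With \<open>a = - t / (2 * pi)\<close> one has
  \<open>t + 2 * pi * k = 2 * pi * (k - a)\<close>; this is the dictionary between winding numbers
  in the Villain weight and integer-valued Gaussians.\<close>

lemma gauss_weight_villain: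
  assumes "\<beta> > 0"
  shows "gauss_weight ((2 * pi)\<^sup>2 * \<beta>) (- t / (2 * pi)) k = exp (- (\<beta> / 2) * (t + 2 * pi * of_int k)\<^sup>2)"
proof -
  have "of_int k - - t / (2 * pi) = (t + 2 * pi * of_int k) / (2 * pi)"
    by (simp add: field_simps)
  then have "(2 * pi)\<^sup>2 * \<beta> / 2 * (of_int k - - t / (2 * pi))\<^sup>2 = \<beta> / 2 * (t + 2 * pi * of_int k)\<^sup>2"
    by (simp add: power_divide power_mult_distrib)
  then show ?thesis by (simp add: gauss_weight_def)
qed

lemma infsum_gauss_weight_villain:
  assumes "\<beta> > 0"
  shows "infsum (gauss_weight ((2 * pi)\<^sup>2 * \<beta>) (- t / (2 * pi))) UNIV = villain_weight \<beta> t"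
  unfolding villain_weight_def by (intro infsum_cong gauss_weight_villain[OF assms])

lemma villain_weight_pos:
  assumes "\<beta> > 0"
  shows "villain_weight \<beta> t > 0"
  using infsum_gauss_weight_villain[OF assms, of t] assms
    gauss_weight_le_infsum[of "(2 * pi)\<^sup>2 * \<beta>" "- t / (2 * pi)" 0]
    gauss_weight_pos[of "(2 * pi)\<^sup>2 * \<beta>" "- t / (2 * pi)" 0]
  by simp

text \<open>Expand the square in each term with \<open>u = t + 2 * pi * k\<close>: the imaginary
  shift produces the constant factor \<open>exp (h\<^sup>2 / (2 * \<beta>))\<close> and the phase
  \<open>cis (- h * u)\<close>, whose dependence on \<open>k\<close> is the character of frequency
  \<open>2 * pi * h\<close>.\<close>

lemma villain_ext_shift_eq:
  assumes "\<beta> > 0"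
  shows "villain_ext \<beta> (of_real t + \<i> * of_real (h / \<beta>)) =
    of_real (exp (h\<^sup>2 / (2 * \<beta>)) * villain_weight \<beta> t) * cis (- h * t) *
    measure_pmf.expectation (IG (- t / (2 * pi)) ((2 * pi)\<^sup>2 * \<beta>)) (\<lambda>k. cis (2 * pi * (- h) * of_int k))"
proof -
  let ?\<gamma> = "(2 * pi)\<^sup>2 * \<beta>" and ?a = "- t / (2 * pi)"
  define w where "w = villain_weight \<beta> t"
  have w: "w > 0" using villain_weight_pos[OF assms] by (simp add: w_def)
  have \<gamma>: "?\<gamma> > 0" using assms by simp
  obtain C where C: "\<And>k. gauss_weight ?\<gamma> ?a k \<le> C / (1 + (of_int k)\<^sup>2)"
    using gauss_weight_le[OF \<gamma>] by metis
  have pmf: "pmf (IG ?a ?\<gamma>) k = gauss_weight ?\<gamma> ?a k / w" for k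
    using pmf_IG[OF \<gamma>, of ?a k] infsum_gauss_weight_villain[OF assms, of t] by (simp add: w_def)
  have "pmf (IG ?a ?\<gamma>) k * norm (cis (2 * pi * (- h) * of_int k)) \<le> (C / w) / (1 + (of_int k)\<^sup>2)" for k
    using divide_right_mono[OF C[of k], of w] w unfolding pmf by (simp add: mult.commute)
  then have E: "measure_pmf.expectation (IG ?a ?\<gamma>) (\<lambda>k. cis (2 * pi * (- h) * of_int k)) =
      (\<Sum>\<^sub>\<infinity>k. pmf (IG ?a ?\<gamma>) k *\<^sub>R cis (2 * pi * (- h) * of_int k))"
    by (rule measure_pmf_int_infsum(2))
  define c where "c = of_real (exp (h\<^sup>2 / (2 * \<beta>)) * w) * cis (- h * t)"
  have "c \<noteq> 0" using w by (simp add: c_def)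
  have "villain_ext_term \<beta> (of_real t + \<i> * of_real (h / \<beta>)) k =
      c * (pmf (IG ?a ?\<gamma>) k *\<^sub>R cis (2 * pi * (- h) * of_int k))" for k
  proof -
    define u where "u = t + 2 * pi * of_int k"
    have "villain_ext_term \<beta> (of_real t + \<i> * of_real (h / \<beta>)) k =
        exp (- (of_real (\<beta> / 2)) * (of_real u + \<i> * of_real (h / \<beta>))\<^sup>2)"
      by (simp add: villain_ext_term_def u_def algebra_simps)
    also have "- (of_real (\<beta> / 2)) * (of_real u + \<i> * of_real (h / \<beta>))\<^sup>2 =
        of_real (- (\<beta> / 2) * u\<^sup>2 + h\<^sup>2 / (2 * \<beta>)) + \<i> * of_real (- h * u)"
      using assms by (simp add: complex_eq_iff power2_eq_square field_simps)
    also have "exp \<dots> = of_real (exp (- (\<beta> / 2) * u\<^sup>2) * exp (h\<^sup>2 / (2 * \<beta>))) * cis (- h * u)"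
      by (simp only: exp_add cis_conv_exp exp_of_real[symmetric] of_real_add of_real_mult)
    also have "exp (- (\<beta> / 2) * u\<^sup>2) = w * pmf (IG ?a ?\<gamma>) k"
      using w unfolding pmf gauss_weight_villain[OF assms] u_def by simp
    also have "cis (- h * u) = cis (- h * t) * cis (2 * pi * (- h) * of_int k)"
      by (simp add: cis_mult u_def algebra_simps)
    finally show ?thesis by (simp add: c_def scaleR_conv_of_real)
  qed
  then have "villain_ext \<beta> (of_real t + \<i> * of_real (h / \<beta>)) =
      (\<Sum>\<^sub>\<infinity>k. c * (pmf (IG ?a ?\<gamma>) k *\<^sub>R cis (2 * pi * (- h) * of_int k)))"
    unfolding villain_ext_def by (intro infsum_cong)
  also have "\<dots> = c * (\<Sum>\<^sub>\<infinity>k. pmf (IG ?a ?\<gamma>) k *\<^sub>R cis (2 * pi * (- h) * of_int k))"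
    by (rule infsum_cmult_right') 
  finally show ?thesis unfolding E c_def w_def .
qed

text \<open>The Gaussian centre \<open>- t / (2 * pi)\<close> ranges over all reals, while the
  infimum in \<open>M_err\<close> is over \<open>{0..1/2}\<close>. Periodicity brings
  \<open>t\<close> into one period, and evenness, which also flips \<open>h\<close>, brings it into
  \<open>{-pi..0}\<close>.\<close>

lemma villain_ext_bound:
  obtains C where "C \<ge> 0"
    "\<And>\<beta> t h. \<beta> \<ge> 1/3 \<Longrightarrow> norm (villain_ext \<beta> (of_real t + \<i> * of_real (h / \<beta>))) \<le>
      exp ((1 - M_err \<beta> / 2) * h\<^sup>2 / (2 * \<beta>) + C * \<bar>h\<bar> ^ 3) * villain_weight \<beta> t"
proof -
  obtain C where C: "C \<ge> 0"
    "\<And>\<gamma> a h. \<gamma> \<ge> 12 \<Longrightarrow> a \<in> {0..1/2} \<Longrightarrow>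
      norm (measure_pmf.expectation (IG a \<gamma>) (\<lambda>k. cis (2 * pi * h * of_int k)))
        \<le> exp (- (pi\<^sup>2 * h\<^sup>2 * min_Var_IG \<gamma>) + C * \<bar>h\<bar> ^ 3)"
    using IG_charfun_bound by metis
  have main: "norm (villain_ext \<beta> (of_real t + \<i> * of_real (h / \<beta>))) \<le>
      exp ((1 - M_err \<beta> / 2) * h\<^sup>2 / (2 * \<beta>) + C * \<bar>h\<bar> ^ 3) * villain_weight \<beta> t"
    if \<beta>: "\<beta> \<ge> 1/3" and t: "t \<in> {-pi..0}" for \<beta> t h
  proof -
    let ?\<gamma> = "(2 * pi)\<^sup>2 * \<beta>"
    have a: "- t / (2 * pi) \<in> {0..1/2}" using t by (auto simp: divide_simps)
    have "norm (villain_ext \<beta> (of_real t + \<i> * of_real (h / \<beta>))) =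
        exp (h\<^sup>2 / (2 * \<beta>)) * villain_weight \<beta> t *
        norm (measure_pmf.expectation (IG (- t / (2 * pi)) ?\<gamma>) (\<lambda>k. cis (2 * pi * (- h) * of_int k)))"
      using \<beta> villain_weight_pos[of \<beta> t]
      by (subst villain_ext_shift_eq) (auto simp: norm_mult)
    also have "\<dots> \<le> exp (h\<^sup>2 / (2 * \<beta>)) * villain_weight \<beta> t *
        exp (- (pi\<^sup>2 * (- h)\<^sup>2 * min_Var_IG ?\<gamma>) + C * \<bar>- h\<bar> ^ 3)"
      using \<beta> villain_weight_pos[of \<beta> t]
      by (intro mult_left_mono C gamma_ge_12 a) auto
    also have "\<dots> = exp (h\<^sup>2 / (2 * \<beta>) - pi\<^sup>2 * h\<^sup>2 * min_Var_IG ?\<gamma> + C * \<bar>h\<bar> ^ 3) * villain_weight \<beta> t"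
      by (simp only: power2_minus abs_minus_cancel exp_add exp_diff exp_minus divide_inverse mult_ac)
    also have "h\<^sup>2 / (2 * \<beta>) - pi\<^sup>2 * h\<^sup>2 * min_Var_IG ?\<gamma> = (1 - M_err \<beta> / 2) * h\<^sup>2 / (2 * \<beta>)"
      using \<beta> by (simp add: M_err_eq field_simps power2_eq_square)
    finally show ?thesis .
  qed
  show ?thesis
  proof (rule that[OF C(1)])
    fix \<beta> t h :: real
    assume \<beta>: "\<beta> \<ge> 1/3"
    then have \<beta>0: "\<beta> > 0" by simp
    \<comment> \<open>The floor places \<open>t'\<close> in the interval from \<open>- pi\<close> to
      \<open>pi\<close>, symmetric about 0 so that a reflection stays inside.\<close>
    define m where "m = \<lfloor>(pi - t) / (2 * pi)\<rfloor>"
    define t' where "t' = t + 2 * pi * of_int m"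
    have "of_int m \<le> (pi - t) / (2 * pi)" "(pi - t) / (2 * pi) < of_int m + 1"
      unfolding m_def by linarith+
    then have t': "- pi \<le> t'" "t' \<le> pi"
      by (auto simp: t'_def field_simps)
    have W: "villain_ext \<beta> (of_real t' + z) = villain_ext \<beta> (of_real t + z)" for z
      using villain_ext_periodic[of \<beta> "of_real t + z" m] by (simp add: t'_def algebra_simps)
    have w: "villain_weight \<beta> t' = villain_weight \<beta> t"
      using W[of 0] by (simp add: villain_ext_of_real[OF \<beta>0])
    have w': "villain_weight \<beta> (- t') = villain_weight \<beta> t'"
      using villain_ext_uminus[of \<beta> "of_real t'"] villain_ext_of_real[OF \<beta>0, of "- t'"]
      by (simp add: villain_ext_of_real[OF \<beta>0])
    show "norm (villain_ext \<beta> (of_real t + \<i> * of_real (h / \<beta>))) \<le>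
        exp ((1 - M_err \<beta> / 2) * h\<^sup>2 / (2 * \<beta>) + C * \<bar>h\<bar> ^ 3) * villain_weight \<beta> t"
    proof (cases "t' \<le> 0")
      case True
      then show ?thesis using main[OF \<beta>, of t' h] t' W[of "\<i> * of_real (h / \<beta>)"] w by simp
    next
      case False
      have "villain_ext \<beta> (of_real (- t') + \<i> * of_real (- h / \<beta>)) = villain_ext \<beta> (of_real t' + \<i> * of_real (h / \<beta>))"
        using villain_ext_uminus[of \<beta> "of_real t' + \<i> * of_real (h / \<beta>)"] by simp
      then show ?thesis
        using main[OF \<beta>, of "- t'" "- h"] False t' W[of "\<i> * of_real (h / \<beta>)"] w w' by simp
    qed
  qed
qed

section \<open>Complex shift of the angles\<close>

lemma space_angle_space: "space angle_space = {0..<2 * pi}"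
  by (simp add: angle_space_def space_restrict_space)

lemma measurable_angle_space: "f \<in> borel_measurable borel \<Longrightarrow> f \<in> borel_measurable angle_space"
  unfolding angle_space_def by (rule measurable_restrict_space1) simp

lemma measurable_to_angle_space: "f \<in> measurable M angle_space \<Longrightarrow> f \<in> borel_measurable M"
  using measurable_compose[OF _ measurable_angle_space[of "\<lambda>x. x"]] by simp

lemma emeasure_angle_space: "emeasure angle_space (space angle_space) = ennreal (2 * pi)"
  unfolding space_angle_space angle_space_def by (subst emeasure_restrict_space) auto

interpretation angle_space: finite_measure angle_space
  by standard (simp add: emeasure_angle_space)

interpretation angle_product: product_sigma_finite "\<lambda>_::'v. angle_space"
  by standard

lemma finite_measure_angle_product:
  assumes "finite S"
  shows "finite_measure (Pi\<^sub>M S (\<lambda>_. angle_space))"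
proof
  have "space (Pi\<^sub>M S (\<lambda>_. angle_space)) = Pi\<^sub>E S (\<lambda>_. space angle_space)"
    by (simp add: space_PiM)
  also have "emeasure (Pi\<^sub>M S (\<lambda>_. angle_space)) \<dots> = (\<Prod>i\<in>S. emeasure angle_space (space angle_space))"
    using assms by (intro angle_product.emeasure_PiM) auto
  also have "\<dots> \<noteq> \<infinity>"
    by (simp add: emeasure_angle_space ennreal_power)
  finally show "emeasure (Pi\<^sub>M S (\<lambda>_. angle_space)) (space (Pi\<^sub>M S (\<lambda>_. angle_space))) \<noteq> \<infinity>" .
qed

lemma integral_angle_space_FTC:
  fixes f :: "real \<Rightarrow> complex"
  assumes "\<And>t. (F has_vector_derivative f t) (at t)" "continuous_on UNIV f"
  shows "(\<integral>t. f t \<partial>angle_space) = F (2 * pi) - F 0"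
proof -
  have m: "f \<in> borel_measurable borel"
    using assms(2) by (rule borel_measurable_continuous_onI)
  have "(\<integral>t. f t \<partial>angle_space) = (\<integral>t. indicator {0..<2*pi} t *\<^sub>R f t \<partial>lborel)"
    unfolding angle_space_def by (subst integral_restrict_space) auto
  \<comment> \<open>The fundamental theorem is available on the closed interval; the added endpoint
    is a null set.\<close>
  also have "\<dots> = (\<integral>t. indicator {0..2*pi} t *\<^sub>R f t \<partial>lborel)"
    using m AE_lborel_singleton[of "2*pi"]
    by (intro integral_cong_AE) (auto elim!: eventually_mono simp: indicator_def)
  also have "\<dots> = F (2 * pi) - F 0"
    by (rule integral_FTC_Icc)
       (use assms in \<open>auto intro: has_vector_derivative_at_within continuous_on_subset\<close>)
  finally show ?thesis .
qed

text \<open>If \<open>P\<close> is a primitive of \<open>G\<close>, then both integrals equal the constant \<open>P (z + 2\<pi>) - P z\<close>.\<close>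

lemma integral_shift_periodic:
  fixes G :: "complex \<Rightarrow> complex"
  assumes hol: "G holomorphic_on UNIV" and per: "\<And>z. G (z + of_real (2 * pi)) = G z"
  shows "(\<integral>t. G (of_real t + \<i> * of_real s) \<partial>angle_space) = (\<integral>t. G (of_real t + \<i> * of_real s') \<partial>angle_space)"
proof -
  obtain P where P: "\<And>z. (P has_field_derivative G z) (at z)"
    using holomorphic_convex_primitive'[OF convex_UNIV open_UNIV hol] by auto
  have "((\<lambda>z. P (z + of_real (2 * pi)) - P z) has_field_derivative 0) (at z)" for z
  proof -
    have "((\<lambda>z. P (z + of_real (2 * pi))) has_field_derivative G (z + of_real (2 * pi))) (at z)"
      using P[of "z + of_real (2 * pi)"] by (simp only: DERIV_shift)
    then have "((\<lambda>z. P (z + of_real (2 * pi)) - P z) has_field_derivative G (z + of_real (2 * pi)) - G z) (at z)"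
      using P by (intro DERIV_diff)
    then show ?thesis by (simp only: per diff_self)
  qed
  then obtain c where c: "\<And>z. P (z + of_real (2 * pi)) - P z = c"
    using has_field_derivative_zero_constant[of UNIV "\<lambda>z. P (z + of_real (2 * pi)) - P z"] by auto
  have "(\<integral>t. G (of_real t + \<i> * of_real s) \<partial>angle_space) = c" for s
  proof -
    have "((\<lambda>t. P (of_real t + \<i> * of_real s)) has_vector_derivative G (of_real t + \<i> * of_real s)) (at t)" for t
    proof -
      have "((\<lambda>t. of_real t + \<i> * of_real s) has_vector_derivative (1 :: complex)) (at t)"
        unfolding has_vector_derivative_def
        by (auto intro!: derivative_eq_intros simp: scaleR_conv_of_real)
      from field_vector_diff_chain_at[OF this P] show ?thesis by (simp add: o_def)
    qed
    moreover have "continuous_on UNIV (\<lambda>t. G (of_real t + \<i> * of_real s))"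
      by (intro continuous_on_compose2[OF holomorphic_on_imp_continuous_on[OF hol]] continuous_intros) auto
    ultimately have "(\<integral>t. G (of_real t + \<i> * of_real s) \<partial>angle_space) =
        P (of_real (2 * pi) + \<i> * of_real s) - P (of_real 0 + \<i> * of_real s)"
      by (rule integral_angle_space_FTC)
    then show ?thesis using c[of "\<i> * of_real s"] by (simp add: add.commute)
  qed
  then show ?thesis by simp
qed

text \<open>The integrand \<open>exp (i * (\<theta> x - \<theta> y))\<close> times the unnormalised
  density, continued to complex angles. The edge set \<open>F\<close> is a separate argument so that
  conditional laws on the infinite lattice are covered as well.\<close>

definition villain_phase ::
  "('v, 'e) pre_digraph \<Rightarrow> 'e set \<Rightarrow> real \<Rightarrow> 'v \<Rightarrow> 'v \<Rightarrow> ('v \<Rightarrow> complex) \<Rightarrow> complex" where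
  "villain_phase G F \<beta> x y \<zeta> =
     exp (\<i> * (\<zeta> x - \<zeta> y)) * (\<Prod>e\<in>F. villain_ext \<beta> (\<zeta> (head G e) - \<zeta> (tail G e)))"

lemma villain_phase_holomorphic:
  assumes "\<beta> > 0"
  shows "(\<lambda>z. villain_phase G F \<beta> x y (\<zeta>(a := z))) holomorphic_on UNIV"
proof -
  have coord: "(\<lambda>z. (\<zeta>(a := z)) v) holomorphic_on UNIV" for v
    by (cases "v = a") (auto intro: holomorphic_intros)
  have "(villain_ext \<beta> \<circ> (\<lambda>z. (\<zeta>(a := z)) v - (\<zeta>(a := z)) w)) holomorphic_on UNIV" for v w
    by (rule holomorphic_on_compose_gen[OF _ villain_ext_holomorphic[OF assms]])
       (auto intro!: holomorphic_intros coord simp del: fun_upd_apply)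
  then show ?thesis
    unfolding villain_phase_def o_def by (intro holomorphic_intros coord)
qed

lemma villain_phase_periodic:
  "villain_phase G F \<beta> x y (\<zeta>(a := z + of_real (2 * pi))) = villain_phase G F \<beta> x y (\<zeta>(a := z))"
proof -
  have E: "exp (\<i> * (w + of_real (2 * pi))) = exp (\<i> * w)" "exp (\<i> * (w - of_real (2 * pi))) = exp (\<i> * w)" for w
    by (simp_all add: distrib_left right_diff_distrib exp_add exp_diff mult_ac)
  have V: "villain_ext \<beta> (w + of_real (2 * pi)) = villain_ext \<beta> w" "villain_ext \<beta> (w - of_real (2 * pi)) = villain_ext \<beta> w" for w
    using villain_ext_periodic[of \<beta> w 1] villain_ext_periodic[of \<beta> w "-1"] by simp_all
  have "z + of_real (2 * pi) - w = (z - w) + of_real (2 * pi)" "w - (z + of_real (2 * pi)) = (w - z) - of_real (2 * pi)" for w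
    by simp_all
  then have "exp (\<i> * ((\<zeta>(a := z + of_real (2 * pi))) v - (\<zeta>(a := z + of_real (2 * pi))) w)) =
        exp (\<i> * ((\<zeta>(a := z)) v - (\<zeta>(a := z)) w))"
      "villain_ext \<beta> ((\<zeta>(a := z + of_real (2 * pi))) v - (\<zeta>(a := z + of_real (2 * pi))) w) =
        villain_ext \<beta> ((\<zeta>(a := z)) v - (\<zeta>(a := z)) w)" for v w
    by (cases "v = a"; cases "w = a"; simp only: fun_upd_apply if_True if_False E V diff_self simp_thms)+
  then show ?thesis by (simp only: villain_phase_def)
qed

lemma villain_ext_borel_measurable:
  assumes "\<beta> > 0"
  shows "villain_ext \<beta> \<in> borel_measurable borel"
  by (intro borel_measurable_continuous_onI holomorphic_on_imp_continuous_on villain_ext_holomorphic assms)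

lemma villain_weight_borel_measurable:
  assumes "\<beta> > 0"
  shows "villain_weight \<beta> \<in> borel_measurable borel"
proof -
  have "villain_weight \<beta> = (\<lambda>t. Re (villain_ext \<beta> (of_real t)))"
    by (simp add: villain_ext_of_real[OF assms])
  moreover have "(\<lambda>t. Re (villain_ext \<beta> (of_real t))) \<in> borel_measurable borel"
    using villain_ext_borel_measurable[OF assms] by measurable
  ultimately show ?thesis by simp
qed

lemma villain_product_borel_measurable:
  assumes "\<beta> > 0" "\<And>v. (\<lambda>\<omega>. Z \<omega> v) \<in> borel_measurable N"
  shows "(\<lambda>\<omega>. villain_product G F \<beta> (Z \<omega>)) \<in> borel_measurable N"
  unfolding villain_product_def
  using measurable_compose[OF borel_measurable_diff[OF assms(2) assms(2)] villain_weight_borel_measurable[OF assms(1)]]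
  by (intro borel_measurable_prod) auto

lemma villain_phase_borel_measurable:
  assumes "\<beta> > 0" "\<And>v. (\<lambda>\<omega>. Z \<omega> v) \<in> borel_measurable N"
  shows "(\<lambda>\<omega>. villain_phase G F \<beta> x y (Z \<omega>)) \<in> borel_measurable N"
  unfolding villain_phase_def
proof (intro borel_measurable_times borel_measurable_prod)
  show "(\<lambda>\<omega>. exp (\<i> * (Z \<omega> x - Z \<omega> y))) \<in> borel_measurable N"
    using assms(2) by measurable
  show "(\<lambda>\<omega>. villain_ext \<beta> (Z \<omega> (head G e) - Z \<omega> (tail G e))) \<in> borel_measurable N" for e
    using measurable_compose[OF borel_measurable_diff[OF assms(2) assms(2)] villain_ext_borel_measurable[OF assms(1)]]
    by simp
qed

text \<open>Compactness of a disc that contains a full period of the strip, combined with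
  periodicity. The size of \<open>B\<close> is irrelevant: it serves only boundedness and
  integrability.\<close>

lemma villain_ext_bounded_strip:
  assumes "\<beta> > 0"
  obtains B where "B > 0" "\<And>z. \<bar>Im z\<bar> \<le> r \<Longrightarrow> norm (villain_ext \<beta> z) \<le> B"
proof -
  have "compact (villain_ext \<beta> ` cball 0 (2 * pi + r))"
    using assms by (intro compact_continuous_image holomorphic_on_imp_continuous_on
        holomorphic_on_subset[OF villain_ext_holomorphic]) auto
  then obtain B where B: "B > 0" "\<And>z. z \<in> cball 0 (2 * pi + r) \<Longrightarrow> norm (villain_ext \<beta> z) \<le> B"
    by (auto dest!: compact_imp_bounded simp: bounded_pos)
  show ?thesis
  proof (rule that[OF B(1)])
    fix z assume z: "\<bar>Im z\<bar> \<le> r"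
    define m where "m = - \<lfloor>Re z / (2 * pi)\<rfloor>"
    define z' where "z' = z + of_real (2 * pi * of_int m)"
    have "- of_int m \<le> Re z / (2 * pi)" "Re z / (2 * pi) < - of_int m + 1"
      unfolding m_def by linarith+
    then have "\<bar>Re z'\<bar> \<le> 2 * pi" by (auto simp: z'_def field_simps)
    moreover have "Im z' = Im z" by (simp add: z'_def)
    ultimately have "norm z' \<le> 2 * pi + r" using cmod_le[of z'] z by linarith
    then have "norm (villain_ext \<beta> z') \<le> B" by (intro B) auto
    then show "norm (villain_ext \<beta> z) \<le> B" by (simp add: z'_def villain_ext_periodic del: of_real_mult)
  qed
qed

lemma villain_product_bounded:
  assumes "\<beta> > 0" "finite F"
  obtains B where "\<And>\<theta>. villain_product G F \<beta> \<theta> \<le> B"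
proof -
  obtain B where B: "B > 0" "\<And>z. \<bar>Im z\<bar> \<le> 0 \<Longrightarrow> norm (villain_ext \<beta> z) \<le> B"
    using villain_ext_bounded_strip[OF assms(1)] by metis
  have w: "villain_weight \<beta> t \<le> B" for t
    using B(2)[of "of_real t"] villain_weight_pos[OF assms(1), of t]
    by (simp add: villain_ext_of_real[OF assms(1)])
  have "villain_product G F \<beta> \<theta> \<le> (\<Prod>e\<in>F. B)" for \<theta>
    unfolding villain_product_def
    by (intro prod_mono) (auto intro: w less_imp_le villain_weight_pos[OF assms(1)])
  then show ?thesis by (rule that)
qed

lemma villain_product_nonneg: "\<beta> > 0 \<Longrightarrow> villain_product G F \<beta> \<theta> \<ge> 0"
  unfolding villain_product_def by (intro prod_nonneg) (auto intro: less_imp_le villain_weight_pos)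

text \<open>The angles in \<open>S\<close> are integrated, those outside are frozen at \<eta>.
  Taking \<eta> to be 0 describes a pinned vertex, an arbitrary \<eta> a boundary condition of a
  Gibbs state.\<close>

definition complex_config :: "'v set \<Rightarrow> ('v \<Rightarrow> real) \<Rightarrow> ('v \<Rightarrow> real) \<Rightarrow> ('v \<Rightarrow> real) \<Rightarrow> 'v \<Rightarrow> complex" where
  "complex_config S \<eta> \<theta> g v = of_real (override_on \<eta> \<theta> S v) + \<i> * of_real (g v)"

lemma override_on_borel_measurable:
  "(\<lambda>\<theta>. override_on \<eta> \<theta> S v) \<in> borel_measurable (Pi\<^sub>M S (\<lambda>_. angle_space))"
  by (cases "v \<in> S") (auto simp: override_on_def intro: measurable_to_angle_space measurable_component_singleton)

lemma villain_phase_integrable: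
  assumes "\<beta> > 0" "finite S" "finite F"
  shows "integrable (Pi\<^sub>M S (\<lambda>_. angle_space)) (\<lambda>\<theta>. villain_phase G F \<beta> x y (complex_config S \<eta> \<theta> g))"
proof -
  interpret finite_measure "Pi\<^sub>M S (\<lambda>_. angle_space)" by (rule finite_measure_angle_product[OF assms(2)])
  obtain r where r: "\<And>e. e \<in> F \<Longrightarrow> \<bar>g (head G e) - g (tail G e)\<bar> \<le> r"
  proof
    show "\<bar>g (head G e) - g (tail G e)\<bar> \<le> (\<Sum>e\<in>F. \<bar>g (head G e) - g (tail G e)\<bar>)" if "e \<in> F" for e
      by (rule member_le_sum[OF that]) (use assms(3) in auto)
  qed
  obtain B where B: "B > 0" "\<And>z. \<bar>Im z\<bar> \<le> r \<Longrightarrow> norm (villain_ext \<beta> z) \<le> B"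
    using villain_ext_bounded_strip[OF assms(1)] by metis
  show ?thesis
  proof (rule integrable_const_bound)
    show "(\<lambda>\<theta>. villain_phase G F \<beta> x y (complex_config S \<eta> \<theta> g)) \<in> borel_measurable (Pi\<^sub>M S (\<lambda>_. angle_space))"
    proof (rule villain_phase_borel_measurable[OF assms(1)])
      show "(\<lambda>\<theta>. complex_config S \<eta> \<theta> g v) \<in> borel_measurable (Pi\<^sub>M S (\<lambda>_. angle_space))" for v
        unfolding complex_config_def
        using override_on_borel_measurable[of \<eta> S v] by measurable
    qed
    have "norm (villain_phase G F \<beta> x y (complex_config S \<eta> \<theta> g)) \<le> exp (- (g x - g y)) * (\<Prod>e\<in>F. B)" for \<theta>
      unfolding villain_phase_def norm_mult prod_norm[symmetric]
    proof (intro mult_mono prod_mono)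
      show "norm (exp (\<i> * (complex_config S \<eta> \<theta> g x - complex_config S \<eta> \<theta> g y))) \<le> exp (- (g x - g y))"
        by (simp add: norm_exp_eq_Re complex_config_def)
    qed (auto intro!: B r prod_nonneg simp: complex_config_def)
    then show "AE \<theta> in Pi\<^sub>M S (\<lambda>_. angle_space).
        norm (villain_phase G F \<beta> x y (complex_config S \<eta> \<theta> g)) \<le> exp (- (g x - g y)) * (\<Prod>e\<in>F. B)"
      by simp
  qed
qed

text \<open>Fubini isolates the angle at \<open>a\<close>. With all other angles fixed, the
  integrand is entire and periodic in this one, so its integral over a period does not depend on the
  height of the horizontal line.\<close>

lemma villain_phase_shift_one:
  assumes "\<beta> > 0" "finite S" "finite F" "a \<in> S"
  shows "(\<integral>\<theta>. villain_phase G F \<beta> x y (complex_config S \<eta> \<theta> (g(a := s))) \<partial>Pi\<^sub>M S (\<lambda>_. angle_space)) =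
    (\<integral>\<theta>. villain_phase G F \<beta> x y (complex_config S \<eta> \<theta> g) \<partial>Pi\<^sub>M S (\<lambda>_. angle_space))"
proof -
  let ?T = "S - {a}"
  have S: "insert a ?T = S" using assms(4) by auto
  have split: "(\<integral>\<theta>. villain_phase G F \<beta> x y (complex_config S \<eta> \<theta> g) \<partial>Pi\<^sub>M S (\<lambda>_. angle_space)) =
      (\<integral>\<theta>. \<integral>t. villain_phase G F \<beta> x y (complex_config S \<eta> (\<theta>(a := t)) g) \<partial>angle_space \<partial>Pi\<^sub>M ?T (\<lambda>_. angle_space))" for g
    using angle_product.product_integral_insert[of ?T a, unfolded S, OF _ _ villain_phase_integrable[OF assms(1-3)]]
      assms(2) by simp
  have upd: "complex_config S \<eta> (\<theta>(a := t)) g =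
      (complex_config S \<eta> (\<theta>(a := 0)) g)(a := of_real t + \<i> * of_real (g a))"
    "complex_config S \<eta> (\<theta>(a := t)) (g(a := s)) =
      (complex_config S \<eta> (\<theta>(a := 0)) g)(a := of_real t + \<i> * of_real s)" for \<theta> t
    using assms(4) by (auto simp: complex_config_def override_on_def fun_eq_iff)
  have "(\<integral>t. villain_phase G F \<beta> x y (complex_config S \<eta> (\<theta>(a := t)) (g(a := s))) \<partial>angle_space) =
      (\<integral>t. villain_phase G F \<beta> x y (complex_config S \<eta> (\<theta>(a := t)) g) \<partial>angle_space)" for \<theta>
    unfolding ext[OF upd(1)[of \<theta>], THEN arg_cong[where f = "\<lambda>\<zeta>. \<integral>t. villain_phase G F \<beta> x y (\<zeta> t) \<partial>angle_space"]]
      ext[OF upd(2)[of \<theta>], THEN arg_cong[where f = "\<lambda>\<zeta>. \<integral>t. villain_phase G F \<beta> x y (\<zeta> t) \<partial>angle_space"]]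
    by (rule integral_shift_periodic) (intro villain_phase_holomorphic[OF assms(1)] villain_phase_periodic)+
  then show ?thesis by (simp only: split)
qed

text \<open>The imaginary parts are switched on one vertex at a time. Since \<open>g\<close>
  vanishes off \<open>S\<close>, only integrated angles are ever moved.\<close>

lemma villain_phase_shift:
  assumes "\<beta> > 0" "finite S" "finite F" "\<And>v. v \<notin> S \<Longrightarrow> g v = 0"
  shows "(\<integral>\<theta>. villain_phase G F \<beta> x y (complex_config S \<eta> \<theta> g) \<partial>Pi\<^sub>M S (\<lambda>_. angle_space)) =
    (\<integral>\<theta>. villain_phase G F \<beta> x y (complex_config S \<eta> \<theta> (\<lambda>_. 0)) \<partial>Pi\<^sub>M S (\<lambda>_. angle_space))"
proof -
  have "(\<integral>\<theta>. villain_phase G F \<beta> x y (complex_config S \<eta> \<theta> (override_on (\<lambda>_. 0) g T)) \<partial>Pi\<^sub>M S (\<lambda>_. angle_space)) =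
    (\<integral>\<theta>. villain_phase G F \<beta> x y (complex_config S \<eta> \<theta> (\<lambda>_. 0)) \<partial>Pi\<^sub>M S (\<lambda>_. angle_space))"
    if "finite T" "T \<subseteq> S" for T
    using that
  proof (induction T)
    case (insert a T)
    have eq: "override_on (\<lambda>_. 0) g (insert a T) = (override_on (\<lambda>_. 0) g T)(a := g a)"
      by (auto simp: override_on_def)
    have "a \<in> S" "T \<subseteq> S" using insert.prems by auto
    then show ?case
      by (simp only: eq villain_phase_shift_one[OF assms(1-3)] insert.IH)
  qed (simp add: override_on_def)
  from this[OF assms(2) order.refl]
  have "(\<integral>\<theta>. villain_phase G F \<beta> x y (complex_config S \<eta> \<theta> (override_on (\<lambda>_. 0) g S)) \<partial>Pi\<^sub>M S (\<lambda>_. angle_space)) =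
    (\<integral>\<theta>. villain_phase G F \<beta> x y (complex_config S \<eta> \<theta> (\<lambda>_. 0)) \<partial>Pi\<^sub>M S (\<lambda>_. angle_space))" .
  moreover have "override_on (\<lambda>_. 0) g S = g" using assms(4) by (auto simp: override_on_def)
  ultimately show ?thesis by (simp only:)
qed

text \<open>After the shift absolute values are taken inside the integral. The phase becomes the
  constant \<open>exp (- (g x - g y))\<close>, and each edge factor is compared with the weight at
  the unshifted real angle, so the original partition integral reappears.\<close>

lemma villain_cos_integral_le:
  assumes "\<beta> > 0" "finite S" "finite F" "\<And>v. v \<notin> S \<Longrightarrow> g v = 0"
    and B: "\<And>e t. e \<in> F \<Longrightarrow>
      norm (villain_ext \<beta> (of_real t + \<i> * of_real (g (head G e) - g (tail G e)))) \<le> B e * villain_weight \<beta> t"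
  shows "(\<integral>\<theta>. cos (override_on \<eta> \<theta> S x - override_on \<eta> \<theta> S y) * villain_product G F \<beta> (override_on \<eta> \<theta> S) \<partial>Pi\<^sub>M S (\<lambda>_. angle_space))
    \<le> exp (- (g x - g y)) * (\<Prod>e\<in>F. B e) *
      (\<integral>\<theta>. villain_product G F \<beta> (override_on \<eta> \<theta> S) \<partial>Pi\<^sub>M S (\<lambda>_. angle_space))"
proof -
  let ?M = "Pi\<^sub>M S (\<lambda>_. angle_space)" and ?Z = "\<lambda>g \<theta>. complex_config S \<eta> \<theta> g"
  interpret finite_measure ?M by (rule finite_measure_angle_product[OF assms(2)])
  have phase0: "villain_phase G F \<beta> x y (?Z (\<lambda>_. 0) \<theta>) =
      cis (override_on \<eta> \<theta> S x - override_on \<eta> \<theta> S y) * of_real (villain_product G F \<beta> (override_on \<eta> \<theta> S))" for \<theta>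
    by (simp add: villain_phase_def complex_config_def cis_conv_exp villain_product_def
        villain_ext_of_real[OF assms(1)] flip: of_real_diff)
  have int: "integrable ?M (\<lambda>\<theta>. villain_phase G F \<beta> x y (?Z g \<theta>))" for g
    by (rule villain_phase_integrable[OF assms(1-3)])
  obtain C where C: "\<And>\<theta>. villain_product G F \<beta> \<theta> \<le> C"
    using villain_product_bounded[OF assms(1,3), of G] by metis
  have int_prod: "integrable ?M (\<lambda>\<theta>. villain_product G F \<beta> (override_on \<eta> \<theta> S))"
    using C villain_product_nonneg[OF assms(1), of G F]
    by (intro integrable_const_bound[of _ C] villain_product_borel_measurable[OF assms(1)] override_on_borel_measurable) auto
  have "(\<integral>\<theta>. cos (override_on \<eta> \<theta> S x - override_on \<eta> \<theta> S y) * villain_product G F \<beta> (override_on \<eta> \<theta> S) \<partial>?M) =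
      (\<integral>\<theta>. Re (villain_phase G F \<beta> x y (?Z (\<lambda>_. 0) \<theta>)) \<partial>?M)"
    by (simp add: phase0)
  also have "\<dots> = Re (\<integral>\<theta>. villain_phase G F \<beta> x y (?Z (\<lambda>_. 0) \<theta>) \<partial>?M)"
    using int by simp
  also have "\<dots> = Re (\<integral>\<theta>. villain_phase G F \<beta> x y (?Z g \<theta>) \<partial>?M)"
    using villain_phase_shift[OF assms(1-3), of g G x y \<eta>] assms(4) by simp
  also have "\<dots> \<le> norm (\<integral>\<theta>. villain_phase G F \<beta> x y (?Z g \<theta>) \<partial>?M)"
    by (rule complex_Re_le_cmod)
  also have "\<dots> \<le> (\<integral>\<theta>. norm (villain_phase G F \<beta> x y (?Z g \<theta>)) \<partial>?M)"
    by (rule integral_norm_bound)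
  also have "\<dots> \<le> (\<integral>\<theta>. exp (- (g x - g y)) * (\<Prod>e\<in>F. B e) * villain_product G F \<beta> (override_on \<eta> \<theta> S) \<partial>?M)"
  proof (rule integral_mono)
    show "norm (villain_phase G F \<beta> x y (?Z g \<theta>)) \<le>
        exp (- (g x - g y)) * (\<Prod>e\<in>F. B e) * villain_product G F \<beta> (override_on \<eta> \<theta> S)" for \<theta>
    proof -
      have "norm (villain_phase G F \<beta> x y (?Z g \<theta>)) = exp (- (g x - g y)) *
          (\<Prod>e\<in>F. norm (villain_ext \<beta> (?Z g \<theta> (head G e) - ?Z g \<theta> (tail G e))))"
        by (simp add: villain_phase_def norm_mult prod_norm norm_exp_eq_Re complex_config_def)
      also have "\<dots> \<le> exp (- (g x - g y)) *
          (\<Prod>e\<in>F. B e * villain_weight \<beta> (override_on \<eta> \<theta> S (head G e) - override_on \<eta> \<theta> S (tail G e)))"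
      proof (intro mult_left_mono prod_mono conjI)
        fix e assume "e \<in> F"
        from B[OF this, of "override_on \<eta> \<theta> S (head G e) - override_on \<eta> \<theta> S (tail G e)"]
        show "norm (villain_ext \<beta> (?Z g \<theta> (head G e) - ?Z g \<theta> (tail G e))) \<le>
            B e * villain_weight \<beta> (override_on \<eta> \<theta> S (head G e) - override_on \<eta> \<theta> S (tail G e))"
          by (simp add: complex_config_def algebra_simps)
      qed auto
      finally show ?thesis by (simp add: prod.distrib villain_product_def)
    qed
  qed (use int int_prod in auto)
  also have "\<dots> = exp (- (g x - g y)) * (\<Prod>e\<in>F. B e) * (\<integral>\<theta>. villain_product G F \<beta> (override_on \<eta> \<theta> S) \<partial>?M)"
    by simp
  finally show ?thesis .
qed

section \<open>From energies to correlations\<close>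

text \<open>With \<open>g = u / \<beta>\<close> the function \<open>u\<close> itself is free of
  \<beta>: one computation of its energy and cubic sum then serves every \<beta>.\<close>

lemma villain_cos_integral_le_energy:
  obtains C where "C \<ge> 0"
    "\<And>\<beta> (G :: ('v, 'e) pre_digraph) S F u \<eta> x y. \<beta> \<ge> 1/3 \<Longrightarrow> finite S \<Longrightarrow> finite F \<Longrightarrow>
      (\<And>v. v \<notin> S \<Longrightarrow> u v = 0) \<Longrightarrow>
      (\<integral>\<theta>. cos (override_on \<eta> \<theta> S x - override_on \<eta> \<theta> S y) *
           villain_product G F \<beta> (override_on \<eta> \<theta> S) \<partial>Pi\<^sub>M S (\<lambda>_. angle_space))
      \<le> exp (- (u x - u y) / \<beta> + (1 - M_err \<beta> / 2) / (2 * \<beta>) * (\<Sum>e\<in>F. (u (head G e) - u (tail G e))\<^sup>2)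
             + C * (\<Sum>e\<in>F. \<bar>u (head G e) - u (tail G e)\<bar> ^ 3)) *
        (\<integral>\<theta>. villain_product G F \<beta> (override_on \<eta> \<theta> S) \<partial>Pi\<^sub>M S (\<lambda>_. angle_space))"
proof -
  obtain C where C: "C \<ge> 0"
    "\<And>\<beta> t h. \<beta> \<ge> 1/3 \<Longrightarrow> norm (villain_ext \<beta> (of_real t + \<i> * of_real (h / \<beta>))) \<le>
      exp ((1 - M_err \<beta> / 2) * h\<^sup>2 / (2 * \<beta>) + C * \<bar>h\<bar> ^ 3) * villain_weight \<beta> t"
    using villain_ext_bound by metis
  show ?thesis
  proof (rule that[OF C(1)])
    fix \<beta> :: real and G :: "('v, 'e) pre_digraph" and S :: "'v set" and F :: "'e set"
      and u \<eta> :: "'v \<Rightarrow> real" and x y :: 'v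
    assume \<beta>: "\<beta> \<ge> 1/3" and fin: "finite S" "finite F" and u: "\<And>v. v \<notin> S \<Longrightarrow> u v = (0::real)"
    define h where "h = (\<lambda>e. u (head G e) - u (tail G e))"
    define B where "B = (\<lambda>e. exp ((1 - M_err \<beta> / 2) * (h e)\<^sup>2 / (2 * \<beta>) + C * \<bar>h e\<bar> ^ 3))"
    have "(\<integral>\<theta>. cos (override_on \<eta> \<theta> S x - override_on \<eta> \<theta> S y) *
           villain_product G F \<beta> (override_on \<eta> \<theta> S) \<partial>Pi\<^sub>M S (\<lambda>_. angle_space))
      \<le> exp (- (u x / \<beta> - u y / \<beta>)) * (\<Prod>e\<in>F. B e) *
      (\<integral>\<theta>. villain_product G F \<beta> (override_on \<eta> \<theta> S) \<partial>Pi\<^sub>M S (\<lambda>_. angle_space))"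
    proof (rule villain_cos_integral_le[where g = "\<lambda>v. u v / \<beta>"])
      fix e t
      show "norm (villain_ext \<beta> (of_real t + \<i> * of_real (u (head G e) / \<beta> - u (tail G e) / \<beta>))) \<le> B e * villain_weight \<beta> t"
        using C(2)[OF \<beta>, of t "h e"] by (simp add: B_def h_def diff_divide_distrib)
    qed (use \<beta> fin u in auto)
    also have "(\<Prod>e\<in>F. B e) = exp (\<Sum>e\<in>F. (1 - M_err \<beta> / 2) * (h e)\<^sup>2 / (2 * \<beta>) + C * \<bar>h e\<bar> ^ 3)"
      using fin by (simp add: B_def exp_sum)
    also have "(\<Sum>e\<in>F. (1 - M_err \<beta> / 2) * (h e)\<^sup>2 / (2 * \<beta>) + C * \<bar>h e\<bar> ^ 3) =
        (1 - M_err \<beta> / 2) / (2 * \<beta>) * (\<Sum>e\<in>F. (h e)\<^sup>2) + C * (\<Sum>e\<in>F. \<bar>h e\<bar> ^ 3)"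
      by (simp add: sum.distrib sum_distrib_left)
    also have "exp (- (u x / \<beta> - u y / \<beta>)) * exp ((1 - M_err \<beta> / 2) / (2 * \<beta>) * (\<Sum>e\<in>F. (h e)\<^sup>2) + C * (\<Sum>e\<in>F. \<bar>h e\<bar> ^ 3)) =
        exp (- (u x - u y) / \<beta> + (1 - M_err \<beta> / 2) / (2 * \<beta>) * (\<Sum>e\<in>F. (h e)\<^sup>2) + C * (\<Sum>e\<in>F. \<bar>h e\<bar> ^ 3))"
      unfolding exp_add[symmetric] by (rule arg_cong[of _ _ exp]) (simp add: diff_divide_distrib)
    finally show "(\<integral>\<theta>. cos (override_on \<eta> \<theta> S x - override_on \<eta> \<theta> S y) *
           villain_product G F \<beta> (override_on \<eta> \<theta> S) \<partial>Pi\<^sub>M S (\<lambda>_. angle_space))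
      \<le> exp (- (u x - u y) / \<beta> + (1 - M_err \<beta> / 2) / (2 * \<beta>) * (\<Sum>e\<in>F. (u (head G e) - u (tail G e))\<^sup>2)
             + C * (\<Sum>e\<in>F. \<bar>u (head G e) - u (tail G e)\<bar> ^ 3)) *
        (\<integral>\<theta>. villain_product G F \<beta> (override_on \<eta> \<theta> S) \<partial>Pi\<^sub>M S (\<lambda>_. angle_space))"
      unfolding h_def .
  qed
qed

text \<open>\<open>A\<close> is the height difference, \<open>D\<close> the energy and
  \<open>Q\<close> the cubic sum. With \<open>m = M_err \<beta> / 2\<close>, the bound
  \<open>m \<le> 1\<close> lets the upper estimate on \<open>D\<close> be inserted, and \<beta>
  \<ge> 1/3 turns the leftover \<open>3 * c / (2 * \<beta>)\<close> into
  \<open>5 * c\<close>.\<close>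

lemma energy_exponent_le:
  fixes \<beta> :: real
  assumes \<beta>: "\<beta> \<ge> 1/3" and A: "A \<ge> \<kappa> * ln r - c" and D: "D \<le> \<kappa> * ln r + c" and Q: "Q \<le> c" and "C \<ge> 0" "c \<ge> 0" "r > 0"
  shows "exp (- A / \<beta> + (1 - M_err \<beta> / 2) / (2 * \<beta>) * D + C * Q) \<le>
    exp (5 * c + C * c) * r powr (- (\<kappa> * (1 + M_err \<beta> / 2) / (2 * \<beta>)))"
proof -
  define m where "m = M_err \<beta> / 2"
  have m: "0 \<le> m" "m \<le> 1" using M_err_nonneg[of \<beta>] M_err_le_2[OF \<beta>] \<beta> by (auto simp: m_def)
  have "(1 - m) * D \<le> (1 - m) * (\<kappa> * ln r + c)" using D m by (intro mult_left_mono) auto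
  moreover have "(1 - m) * c \<le> 1 * c" using m assms by (intro mult_right_mono) auto
  ultimately have "- 2 * A + (1 - m) * D \<le> - (\<kappa> * (1 + m) * ln r) + 3 * c"
    using A by (simp add: algebra_simps)
  then have "(- 2 * A + (1 - m) * D) / (2 * \<beta>) \<le> (- (\<kappa> * (1 + m) * ln r) + 3 * c) / (2 * \<beta>)"
    using \<beta> by (intro divide_right_mono) auto
  also have "(- 2 * A + (1 - m) * D) / (2 * \<beta>) = - A / \<beta> + (1 - m) / (2 * \<beta>) * D"
    using \<beta> by (simp add: field_simps)
  also have "(- (\<kappa> * (1 + m) * ln r) + 3 * c) / (2 * \<beta>) = - (\<kappa> * (1 + m) / (2 * \<beta>)) * ln r + 3 * c / (2 * \<beta>)"
    using \<beta> by (simp add: field_simps)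
  finally have "- A / \<beta> + (1 - m) / (2 * \<beta>) * D \<le> - (\<kappa> * (1 + m) / (2 * \<beta>)) * ln r + 3 * c / (2 * \<beta>)" .
  moreover have "3 * c / (2 * \<beta>) \<le> 5 * c"
  proof -
    have "c * 3 \<le> c * (10 * \<beta>)" using \<beta> \<open>c \<ge> 0\<close> by (intro mult_left_mono) auto
    then show ?thesis using \<beta> by (simp add: divide_simps mult_ac)
  qed
  moreover have "C * Q \<le> C * c" using Q \<open>C \<ge> 0\<close> by (intro mult_left_mono) auto
  ultimately have "- A / \<beta> + (1 - m) / (2 * \<beta>) * D + C * Q \<le>
      (5 * c + C * c) + - (\<kappa> * (1 + m) / (2 * \<beta>)) * ln r" by linarith
  then have "exp (- A / \<beta> + (1 - m) / (2 * \<beta>) * D + C * Q) \<le>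
      exp ((5 * c + C * c) + - (\<kappa> * (1 + m) / (2 * \<beta>)) * ln r)" by (simp only: exp_le_cancel_iff)
  also have "\<dots> = exp (5 * c + C * c) * r powr (- (\<kappa> * (1 + m) / (2 * \<beta>)))"
    using \<open>r > 0\<close> by (simp only: exp_add powr_def) simp
  finally show ?thesis by (simp only: m_def)
qed

section \<open>Transfer to the finite-volume and infinite-volume laws\<close>

lemma villain_product_cong:
  assumes "\<And>e. e \<in> F \<Longrightarrow> \<theta> (head G e) = \<theta>' (head G e) \<and> \<theta> (tail G e) = \<theta>' (tail G e)"
  shows "villain_product G F \<beta> \<theta> = villain_product G F \<beta> \<theta>'"
  unfolding villain_product_def by (intro prod.cong refl) (use assms in auto)

text \<open>Divide by the total weight. If that weight is 0, division by zero makes the density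
  vanish, and the claim reduces to \<open>b \<ge> 0\<close>.\<close>

lemma normalized_integral_le:
  fixes f w :: "'a \<Rightarrow> real"
  assumes "f \<in> borel_measurable M" "w \<in> borel_measurable M" "\<And>x. x \<in> space M \<Longrightarrow> w x \<ge> 0" "b \<ge> 0"
    "(\<integral>x. f x * w x \<partial>M) \<le> b * (\<integral>x. w x \<partial>M)"
  shows "(\<integral>x. f x \<partial>normalized_density M w) \<le> b"
proof -
  define Z where "Z = (\<integral>x. w x \<partial>M)"
  have Z: "Z \<ge> 0" unfolding Z_def by (rule Bochner_Integration.integral_nonneg) (use assms in auto)
  have "(\<integral>x. f x \<partial>normalized_density M w) = (\<integral>x. (w x / Z) *\<^sub>R f x \<partial>M)"
    unfolding normalized_density_def Z_def[symmetric]
    by (rule integral_density) (use assms Z in auto)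
  also have "\<dots> = (\<integral>x. f x * w x \<partial>M) / Z"
    by (simp add: mult.commute)
  also have "\<dots> \<le> b"
    using assms(4,5) Z by (cases "Z = 0") (auto simp: Z_def[symmetric] divide_simps)
  finally show ?thesis .
qed

text \<open>\<open>villain\<close> pins by \<open>\<theta>(v\<^sub>0 := 0)\<close>, the shift lemmas
  by \<open>override_on\<close>. The two configurations coincide on the vertices of
  \<open>G\<close>, and \<open>wf\<close> ensures that the edges see no other points.\<close>

lemma villain_cos_le:
  assumes "\<beta> > 0" "v\<^sub>0 \<in> verts G" "x \<in> verts G" "y \<in> verts G" "b \<ge> 0"
    and wf: "\<And>e. e \<in> arcs G \<Longrightarrow> head G e \<in> verts G \<and> tail G e \<in> verts G"
    and le: "(\<integral>\<theta>. cos (override_on (\<lambda>_. 0) \<theta> (verts G - {v\<^sub>0}) x - override_on (\<lambda>_. 0) \<theta> (verts G - {v\<^sub>0}) y) *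
           villain_product G (arcs G) \<beta> (override_on (\<lambda>_. 0) \<theta> (verts G - {v\<^sub>0})) \<partial>Pi\<^sub>M (verts G - {v\<^sub>0}) (\<lambda>_. angle_space))
      \<le> b * (\<integral>\<theta>. villain_product G (arcs G) \<beta> (override_on (\<lambda>_. 0) \<theta> (verts G - {v\<^sub>0})) \<partial>Pi\<^sub>M (verts G - {v\<^sub>0}) (\<lambda>_. angle_space))"
  shows "(\<integral>\<theta>. cos (\<theta> x - \<theta> y) \<partial>villain G v\<^sub>0 \<beta>) \<le> b"
proof -
  let ?S = "verts G - {v\<^sub>0}"
  let ?M = "Pi\<^sub>M ?S (\<lambda>_. angle_space)" and ?N = "Pi\<^sub>M (verts G) (\<lambda>_. angle_space)"
  let ?w = "\<lambda>\<theta>. villain_product G (arcs G) \<beta> (\<theta>(v\<^sub>0 := 0))"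
  have agree: "(\<theta>(v\<^sub>0 := 0)) v = override_on (\<lambda>_. 0) \<theta> ?S v" if "v \<in> verts G" for \<theta> :: "'a \<Rightarrow> real" and v
    using that by (auto simp: override_on_def)
  have w: "?w \<theta> = villain_product G (arcs G) \<beta> (override_on (\<lambda>_. 0) \<theta> ?S)" for \<theta>
    by (intro villain_product_cong conjI agree) (use wf in auto)
  have meas: "(\<lambda>\<theta>. \<theta>(v\<^sub>0 := 0)) \<in> measurable ?M ?N"
    by (rule measurable_fun_upd[where J = ?S]) (use assms(2) in \<open>auto simp: space_angle_space\<close>)
  have cos: "(\<lambda>\<theta>. cos (\<theta> x - \<theta> y)) \<in> borel_measurable ?N"
    using measurable_to_angle_space[OF measurable_component_singleton[OF assms(3)]]
      measurable_to_angle_space[OF measurable_component_singleton[OF assms(4)]] by measurable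
  have "(\<integral>\<theta>. cos (\<theta> x - \<theta> y) \<partial>villain G v\<^sub>0 \<beta>) =
      (\<integral>\<theta>. cos ((\<theta>(v\<^sub>0 := 0)) x - (\<theta>(v\<^sub>0 := 0)) y) \<partial>normalized_density ?M ?w)"
    unfolding villain_def
    by (rule integral_distr) (use meas cos in \<open>auto simp: normalized_density_def\<close>)
  also have "\<dots> \<le> b"
  proof (rule normalized_integral_le)
    show "(\<lambda>\<theta>. cos ((\<theta>(v\<^sub>0 := 0)) x - (\<theta>(v\<^sub>0 := 0)) y)) \<in> borel_measurable ?M"
      using measurable_compose[OF meas cos] .
    show "?w \<in> borel_measurable ?M"
      unfolding w by (intro villain_product_borel_measurable assms override_on_borel_measurable)
    show "(\<integral>\<theta>. cos ((\<theta>(v\<^sub>0 := 0)) x - (\<theta>(v\<^sub>0 := 0)) y) * ?w \<theta> \<partial>?M) \<le> b * (\<integral>\<theta>. ?w \<theta> \<partial>?M)"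
      unfolding w agree[OF assms(3)] agree[OF assms(4)] by (rule le)
  qed (use assms in \<open>auto intro: villain_product_nonneg\<close>)
  finally show ?thesis .
qed

lemma finite_edges_meeting: "finite S \<Longrightarrow> finite (edges_meeting S)"
proof -
  assume "finite S"
  have "edges_meeting S \<subseteq> (\<Union>x\<in>S. {(x, x + (1,0)), (x, x + (0,1)), (x - (1,0), x), (x - (0,1), x)})"
    by (auto simp: edges_meeting_def Z2_lattice_def)
  then show ?thesis by (rule finite_subset) (use \<open>finite S\<close> in auto)
qed

text \<open>The DLR equations say that \<open>\<mu>\<close> equals the resampled law \<open>\<nu>\<close>, to which Fubini applies. The
  function \<open>1 + cos\<close> is used because it is nonnegative.\<close>

lemma gibbs_state_cos_le:
  assumes \<beta>: "\<beta> > 0" and gibbs: "villain_gibbs_state \<beta> \<mu>" and S: "finite S" and b: "b \<ge> 0"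
    and le: "\<And>\<eta>. (\<integral>\<theta>. cos (override_on \<eta> \<theta> S x - override_on \<eta> \<theta> S y) *
           villain_product Z2_lattice (edges_meeting S) \<beta> (override_on \<eta> \<theta> S) \<partial>Pi\<^sub>M S (\<lambda>_. angle_space))
      \<le> b * (\<integral>\<theta>. villain_product Z2_lattice (edges_meeting S) \<beta> (override_on \<eta> \<theta> S) \<partial>Pi\<^sub>M S (\<lambda>_. angle_space))"
  shows "(\<integral>\<theta>. cos (\<theta> x - \<theta> y) \<partial>\<mu>) \<le> b"
proof -
  let ?P = "Pi\<^sub>M S (\<lambda>_. angle_space)"
  let ?w = "\<lambda>\<eta> \<theta>. villain_product Z2_lattice (edges_meeting S) \<beta> (override_on \<eta> \<theta> S)"
  define Z where "Z = (\<lambda>\<eta>. \<integral>\<theta>. ?w \<eta> \<theta> \<partial>?P)"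
  define f where "f = (\<lambda>\<theta>::site \<Rightarrow> real. 1 + cos (\<theta> x - \<theta> y))"
  have sets_\<mu>: "sets \<mu> = sets config_space" and prob: "prob_space \<mu>"
    and dlr: "\<And>A. A \<in> sets \<mu> \<Longrightarrow> emeasure \<mu> A = (\<integral>\<^sup>+ \<eta>. emeasure (villain_kernel \<beta> S \<eta>) A \<partial>\<mu>)"
    using gibbs S unfolding villain_gibbs_state_def by auto
  interpret \<mu>: prob_space \<mu> by (rule prob)
  interpret P: finite_measure ?P by (rule finite_measure_angle_product[OF S])
  have space_\<mu>: "space \<mu> = space config_space" using sets_eq_imp_space_eq[OF sets_\<mu>] .
  have coord: "(\<lambda>\<theta>. \<theta> v) \<in> measurable \<mu> angle_space" for v
    unfolding measurable_cong_sets[OF sets_\<mu> refl] config_space_def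
    by (rule measurable_component_singleton) simp
  have coord_borel: "(\<lambda>\<theta>. \<theta> v) \<in> borel_measurable \<mu>" for v
    using measurable_to_angle_space[OF coord] .
  have ov_coord: "(\<lambda>p. override_on (fst p) (snd p) S v) \<in> measurable (\<mu> \<Otimes>\<^sub>M ?P) angle_space" for v
  proof (cases "v \<in> S")
    case True
    then show ?thesis
      using measurable_compose[OF measurable_snd measurable_component_singleton[OF True, of "\<lambda>_. angle_space"]]
      by (simp add: override_on_def)
  next
    case False
    then show ?thesis
      using measurable_compose[OF measurable_fst coord] by (simp add: override_on_def)
  qed
  have ov: "(\<lambda>p. override_on (fst p) (snd p) S) \<in> measurable (\<mu> \<Otimes>\<^sub>M ?P) config_space"
    unfolding config_space_def
  proof (rule measurable_PiM_single')
    show "(\<lambda>p. override_on (fst p) (snd p) S) \<in> space (\<mu> \<Otimes>\<^sub>M ?P) \<rightarrow> (\<Pi>\<^sub>E i\<in>UNIV. space angle_space)"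
      using measurable_space[OF ov_coord] by auto
  qed (rule ov_coord)
  have ov1: "(\<lambda>\<theta>. override_on \<eta> \<theta> S) \<in> measurable ?P config_space" if "\<eta> \<in> space \<mu>" for \<eta>
    using measurable_compose[OF measurable_Pair1'[OF that] ov] by simp
  have w_meas: "(\<lambda>p. ?w (fst p) (snd p)) \<in> borel_measurable (\<mu> \<Otimes>\<^sub>M ?P)"
    by (intro villain_product_borel_measurable[OF \<beta>] measurable_to_angle_space[OF ov_coord])
  then have Z_meas: "Z \<in> borel_measurable \<mu>"
    unfolding Z_def by (intro P.borel_measurable_lebesgue_integral) (simp add: case_prod_beta)
  have w_meas1: "?w \<eta> \<in> borel_measurable ?P" for \<eta>
    by (intro villain_product_borel_measurable[OF \<beta>] override_on_borel_measurable)
  have w_nonneg: "?w \<eta> \<theta> \<ge> 0" for \<eta> \<theta> by (rule villain_product_nonneg[OF \<beta>])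
  obtain B where B: "\<And>\<theta>. villain_product Z2_lattice (edges_meeting S) \<beta> \<theta> \<le> B"
    using villain_product_bounded[OF \<beta> finite_edges_meeting[OF S]] by metis
  have w_int: "integrable ?P (?w \<eta>)" for \<eta>
    by (rule P.integrable_const_bound[of _ B]) (use w_meas1 w_nonneg B in auto)
  have Z_nonneg: "Z \<eta> \<ge> 0" for \<eta>
    unfolding Z_def by (rule Bochner_Integration.integral_nonneg) (rule w_nonneg)
  \<comment> \<open>Resampling is encoded as the image of one joint density on the pair (outer
    configuration, inner angles); measurability in \<eta> then comes from Tonelli instead of from
    the kernel as a measure-valued map.\<close>
  define \<nu> where "\<nu> = distr (density (\<mu> \<Otimes>\<^sub>M ?P) (\<lambda>p. ennreal (?w (fst p) (snd p) / Z (fst p)))) config_space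
      (\<lambda>p. override_on (fst p) (snd p) S)"
  have dens_meas: "(\<lambda>p. ennreal (?w (fst p) (snd p) / Z (fst p))) \<in> borel_measurable (\<mu> \<Otimes>\<^sub>M ?P)"
    using w_meas measurable_compose[OF measurable_fst Z_meas] by measurable
  have nn: "(\<integral>\<^sup>+\<theta>. h \<theta> \<partial>\<nu>) = (\<integral>\<^sup>+\<eta>. \<integral>\<^sup>+\<theta>. ennreal (?w \<eta> \<theta> / Z \<eta>) * h (override_on \<eta> \<theta> S) \<partial>?P \<partial>\<mu>)"
    if h: "h \<in> borel_measurable config_space" for h
  proof -
    have hm: "(\<lambda>p. h (override_on (fst p) (snd p) S)) \<in> borel_measurable (\<mu> \<Otimes>\<^sub>M ?P)"
      using measurable_compose[OF ov h] .
    have "(\<integral>\<^sup>+\<theta>. h \<theta> \<partial>\<nu>) = (\<integral>\<^sup>+p. h (override_on (fst p) (snd p) S)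
        \<partial>density (\<mu> \<Otimes>\<^sub>M ?P) (\<lambda>p. ennreal (?w (fst p) (snd p) / Z (fst p))))"
      unfolding \<nu>_def by (rule nn_integral_distr) (use ov h in auto)
    also have "\<dots> = (\<integral>\<^sup>+p. ennreal (?w (fst p) (snd p) / Z (fst p)) * h (override_on (fst p) (snd p) S) \<partial>(\<mu> \<Otimes>\<^sub>M ?P))"
      by (rule nn_integral_density[OF dens_meas hm])
    also have "\<dots> = (\<integral>\<^sup>+\<eta>. \<integral>\<^sup>+\<theta>. ennreal (?w \<eta> \<theta> / Z \<eta>) * h (override_on \<eta> \<theta> S) \<partial>?P \<partial>\<mu>)"
      by (subst P.nn_integral_fst[symmetric]) (use dens_meas hm in auto)
    finally show ?thesis .
  qed
  have "\<nu> = \<mu>"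
  proof (rule measure_eqI)
    show "sets \<nu> = sets \<mu>" by (simp add: \<nu>_def sets_\<mu>)
    fix A assume "A \<in> sets \<nu>"
    then have A: "A \<in> sets config_space" "A \<in> sets \<mu>" by (auto simp: \<nu>_def sets_\<mu>)
    have "emeasure \<nu> A = (\<integral>\<^sup>+\<theta>. indicator A \<theta> \<partial>\<nu>)"
      using \<open>A \<in> sets \<nu>\<close> by simp
    also have "\<dots> = (\<integral>\<^sup>+\<eta>. \<integral>\<^sup>+\<theta>. ennreal (?w \<eta> \<theta> / Z \<eta>) * indicator A (override_on \<eta> \<theta> S) \<partial>?P \<partial>\<mu>)"
      using A by (intro nn) auto
    also have "\<dots> = (\<integral>\<^sup>+ \<eta>. emeasure (villain_kernel \<beta> S \<eta>) A \<partial>\<mu>)"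
    proof (rule nn_integral_cong)
      fix \<eta> assume \<eta>: "\<eta> \<in> space \<mu>"
      have "emeasure (villain_kernel \<beta> S \<eta>) A = (\<integral>\<^sup>+\<theta>. indicator A \<theta> \<partial>villain_kernel \<beta> S \<eta>)"
        using A(1) by (subst nn_integral_indicator) (auto simp: villain_kernel_def)
      also have "\<dots> = (\<integral>\<^sup>+\<theta>. indicator A (override_on \<eta> \<theta> S) \<partial>normalized_density ?P (?w \<eta>))"
        unfolding villain_kernel_def
        by (rule nn_integral_distr) (use ov1[OF \<eta>] A(1) in \<open>auto simp: normalized_density_def\<close>)
      also have "\<dots> = (\<integral>\<^sup>+\<theta>. ennreal (?w \<eta> \<theta> / Z \<eta>) * indicator A (override_on \<eta> \<theta> S) \<partial>?P)"
        unfolding normalized_density_def Z_def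
        by (rule nn_integral_density)
           (use w_meas1 measurable_compose[OF ov1[OF \<eta>] borel_measurable_indicator[OF A(1)]] in auto)
      finally show "(\<integral>\<^sup>+\<theta>. ennreal (?w \<eta> \<theta> / Z \<eta>) * indicator A (override_on \<eta> \<theta> S) \<partial>?P) =
          emeasure (villain_kernel \<beta> S \<eta>) A" by simp
    qed
    also have "\<dots> = emeasure \<mu> A" using dlr[OF A(2)] by simp
    finally show "emeasure \<nu> A = emeasure \<mu> A" .
  qed
  have f_nonneg: "f \<theta> \<ge> 0" for \<theta>
    unfolding f_def using cos_ge_minus_one[of "\<theta> x - \<theta> y"] by linarith
  have f_meas\<mu>: "f \<in> borel_measurable \<mu>"
    unfolding f_def using coord_borel[of x] coord_borel[of y] by measurable
  then have f_meas: "f \<in> borel_measurable config_space"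
    by (simp add: measurable_cong_sets[OF sets_\<mu> refl])
  have f_int: "integrable \<mu> f"
    using f_nonneg f_meas\<mu> by (intro \<mu>.integrable_const_bound[of _ 2]) (auto simp: f_def)
  have cos_int: "integrable \<mu> (\<lambda>\<theta>. cos (\<theta> x - \<theta> y))"
    using Bochner_Integration.integrable_diff[OF f_int, of "\<lambda>_. 1"] by (simp add: f_def)
  have "ennreal (\<integral>\<theta>. f \<theta> \<partial>\<mu>) = (\<integral>\<^sup>+\<theta>. ennreal (f \<theta>) \<partial>\<mu>)"
    using f_int f_nonneg by (simp add: nn_integral_eq_integral)
  also have "\<dots> = (\<integral>\<^sup>+\<theta>. ennreal (f \<theta>) \<partial>\<nu>)" by (simp add: \<open>\<nu> = \<mu>\<close>)
  also have "\<dots> = (\<integral>\<^sup>+\<eta>. \<integral>\<^sup>+\<theta>. ennreal (?w \<eta> \<theta> / Z \<eta>) * ennreal (f (override_on \<eta> \<theta> S)) \<partial>?P \<partial>\<mu>)"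
    using f_meas by (intro nn) auto
  also have "\<dots> \<le> (\<integral>\<^sup>+\<eta>. ennreal (1 + b) \<partial>\<mu>)"
  proof (rule nn_integral_mono)
    fix \<eta>
    have c_int: "integrable ?P (\<lambda>\<theta>. cos (override_on \<eta> \<theta> S x - override_on \<eta> \<theta> S y) * ?w \<eta> \<theta>)"
    proof (rule P.integrable_const_bound[of _ B])
      show "(\<lambda>\<theta>. cos (override_on \<eta> \<theta> S x - override_on \<eta> \<theta> S y) * ?w \<eta> \<theta>) \<in> borel_measurable ?P"
        using override_on_borel_measurable[of \<eta> S x] override_on_borel_measurable[of \<eta> S y] w_meas1[of \<eta>]
        by measurable
      have "norm (cos (override_on \<eta> \<theta> S x - override_on \<eta> \<theta> S y) * ?w \<eta> \<theta>) \<le> 1 * B" for \<theta>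
        unfolding norm_mult using w_nonneg[of \<eta> \<theta>] B by (intro mult_mono) auto
      then show "AE \<theta> in ?P. norm (cos (override_on \<eta> \<theta> S x - override_on \<eta> \<theta> S y) * ?w \<eta> \<theta>) \<le> B" by simp
    qed
    have int: "integrable ?P (\<lambda>\<theta>. (?w \<eta> \<theta> + cos (override_on \<eta> \<theta> S x - override_on \<eta> \<theta> S y) * ?w \<eta> \<theta>) / Z \<eta>)"
      using c_int w_int by auto
    have "(\<integral>\<^sup>+\<theta>. ennreal (?w \<eta> \<theta> / Z \<eta>) * ennreal (f (override_on \<eta> \<theta> S)) \<partial>?P) =
        (\<integral>\<^sup>+\<theta>. ennreal ((?w \<eta> \<theta> + cos (override_on \<eta> \<theta> S x - override_on \<eta> \<theta> S y) * ?w \<eta> \<theta>) / Z \<eta>) \<partial>?P)"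
      using w_nonneg Z_nonneg f_nonneg
      by (intro nn_integral_cong) (auto simp: f_def ennreal_mult[symmetric] field_simps)
    also have "\<dots> = ennreal (\<integral>\<theta>. (?w \<eta> \<theta> + cos (override_on \<eta> \<theta> S x - override_on \<eta> \<theta> S y) * ?w \<eta> \<theta>) / Z \<eta> \<partial>?P)"
    proof (rule nn_integral_eq_integral[OF int])
      have "0 \<le> (1 + cos (override_on \<eta> \<theta> S x - override_on \<eta> \<theta> S y)) * ?w \<eta> \<theta> / Z \<eta>" for \<theta>
        using w_nonneg[of \<eta> \<theta>] Z_nonneg[of \<eta>] f_nonneg[of "override_on \<eta> \<theta> S"] by (simp add: f_def)
      then show "AE \<theta> in ?P. 0 \<le> (?w \<eta> \<theta> + cos (override_on \<eta> \<theta> S x - override_on \<eta> \<theta> S y) * ?w \<eta> \<theta>) / Z \<eta>"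
        by (simp add: distrib_right)
    qed
    also have "(\<integral>\<theta>. (?w \<eta> \<theta> + cos (override_on \<eta> \<theta> S x - override_on \<eta> \<theta> S y) * ?w \<eta> \<theta>) / Z \<eta> \<partial>?P) =
        (Z \<eta> + (\<integral>\<theta>. cos (override_on \<eta> \<theta> S x - override_on \<eta> \<theta> S y) * ?w \<eta> \<theta> \<partial>?P)) / Z \<eta>"
      using c_int w_int by (simp add: Z_def)
    also have "\<dots> \<le> 1 + b"
    proof (cases "Z \<eta> = 0")
      case False
      then have "Z \<eta> > 0" using Z_nonneg[of \<eta>] by simp
      moreover have "Z \<eta> + (\<integral>\<theta>. cos (override_on \<eta> \<theta> S x - override_on \<eta> \<theta> S y) * ?w \<eta> \<theta> \<partial>?P) \<le> (1 + b) * Z \<eta>"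
        using le[of \<eta>] unfolding Z_def distrib_right by simp
      ultimately show ?thesis by (simp add: pos_divide_le_eq)
    qed (use b in auto)
    finally show "(\<integral>\<^sup>+\<theta>. ennreal (?w \<eta> \<theta> / Z \<eta>) * ennreal (f (override_on \<eta> \<theta> S)) \<partial>?P) \<le> ennreal (1 + b)"
      by (simp add: ennreal_leI)
  qed
  also have "\<dots> = ennreal (1 + b)" by (simp add: \<mu>.emeasure_space_1)
  finally have "(\<integral>\<theta>. f \<theta> \<partial>\<mu>) \<le> 1 + b"
    by (subst (asm) ennreal_le_iff) (use b in auto)
  moreover have "(\<integral>\<theta>. f \<theta> \<partial>\<mu>) = 1 + (\<integral>\<theta>. cos (\<theta> x - \<theta> y) \<partial>\<mu>)"
    using cos_int by (simp add: f_def \<mu>.prob_space)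
  ultimately show ?thesis by simp
qed

section \<open>Logarithmic bumps\<close>

text \<open>Squared distance regularised by 1: its logarithm is finite everywhere and vanishes at
  the origin, so a bump has height exactly \<open>ln r / (2 * pi)\<close>.\<close>

definition sq1 :: "real \<Rightarrow> real \<Rightarrow> real" where
  "sq1 x y = 1 + x\<^sup>2 + y\<^sup>2"

lemma sq1_pos: "sq1 x y > 0" and sq1_ge_1: "sq1 x y \<ge> 1"
  by (simp_all add: sq1_def add_pos_nonneg)

text \<open>Mean value theorem: half the derivative is \<open>\<xi> / sq1 \<xi> y\<close>. Moving
  \<xi> back to \<open>x\<close> must preserve the leading coefficient 1 of
  \<open>\<bar>x\<bar>\<close>, since the sharp energy depends on it; the additive 19 is
  harmless.\<close>

lemma abs_ln_sq1_diff_le: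
  "\<bar>ln (sq1 (x + 1) y) - ln (sq1 x y)\<bar> / 2 \<le> (\<bar>x\<bar> + 19) / sq1 x y"
proof -
  define q where "q = sq1 x y"
  have der: "((\<lambda>\<xi>. ln (sq1 \<xi> y)) has_real_derivative 2 * \<xi> / sq1 \<xi> y) (at \<xi>)" for \<xi>
    using sq1_pos[of \<xi> y] unfolding sq1_def
    by (auto intro!: derivative_eq_intros simp: divide_simps)
  obtain \<xi> where \<xi>: "x < \<xi>" "\<xi> < x + 1" "ln (sq1 (x + 1) y) - ln (sq1 x y) = 2 * \<xi> / sq1 \<xi> y"
    using MVT2[of x "x + 1" "\<lambda>\<xi>. ln (sq1 \<xi> y)" "\<lambda>\<xi>. 2 * \<xi> / sq1 \<xi> y"] der by auto
  define p where "p = sq1 \<xi> y"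
  have pos: "p > 0" "q > 0" by (simp_all add: p_def q_def sq1_pos)
  have "\<bar>\<xi>\<bar> \<le> \<bar>x\<bar> + 1" "\<bar>x\<bar> \<le> \<bar>\<xi>\<bar> + 1" using \<xi> by auto
  have "x\<^sup>2 \<le> (\<bar>\<xi>\<bar> + 1)\<^sup>2"
    using power_mono[OF \<open>\<bar>x\<bar> \<le> \<bar>\<xi>\<bar> + 1\<close>, of 2] by simp
  also have "\<dots> \<le> 2 * \<xi>\<^sup>2 + 2"
    using zero_le_power2[of "\<bar>\<xi>\<bar> - 1"] by (simp add: power2_eq_square algebra_simps)
  finally have "x\<^sup>2 \<le> 2 * \<xi>\<^sup>2 + 2" .
  then have q3p: "q \<le> 3 * p"
    unfolding q_def p_def sq1_def using zero_le_power2[of y] zero_le_power2[of \<xi>] by argo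
  have "x\<^sup>2 \<le> q" "1 \<le> q" by (simp_all add: q_def sq1_def)
  have xi_sq: "\<xi>\<^sup>2 \<le> x\<^sup>2 + 2 * \<bar>x\<bar> + 1"
    using power_mono[OF \<open>\<bar>\<xi>\<bar> \<le> \<bar>x\<bar> + 1\<close>, of 2] by (simp add: power2_eq_square algebra_simps)
  have x_sq: "x\<^sup>2 - \<xi>\<^sup>2 \<le> 2 * \<bar>x\<bar> + 1"
  proof -
    have "x\<^sup>2 - \<xi>\<^sup>2 = (x - \<xi>) * (x + \<xi>)" by (simp add: power2_eq_square algebra_simps)
    also have "\<dots> \<le> \<bar>x - \<xi>\<bar> * \<bar>x + \<xi>\<bar>" by (metis abs_ge_self abs_mult)
    also have "\<dots> \<le> 1 * (2 * \<bar>x\<bar> + 1)" using \<xi> by (intro mult_mono) auto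
    finally show ?thesis by simp
  qed
  \<comment> \<open>The number is \<open>19 = 1 + 6 * 3\<close>: 1 from
    \<open>\<bar>\<xi>\<bar> \<le> \<bar>x\<bar> + 1\<close>, 6 from the quadratic estimate below, 3
    from \<open>q \<le> 3 * p\<close>.\<close>
  have "\<bar>\<xi>\<bar> * q \<le> (\<bar>x\<bar> + 19) * p"
  proof -
    have "\<bar>\<xi>\<bar> * q \<le> (\<bar>x\<bar> + 1) * q"
      using \<open>\<bar>\<xi>\<bar> \<le> \<bar>x\<bar> + 1\<close> pos by (intro mult_right_mono) auto
    also have "\<dots> \<le> (\<bar>x\<bar> + 1) * p + (\<bar>x\<bar> + 1) * (2 * \<bar>x\<bar> + 1)"
      using mult_left_mono[of "q" "p + (2 * \<bar>x\<bar> + 1)" "\<bar>x\<bar> + 1"] x_sq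
      by (simp add: p_def q_def sq1_def distrib_left)
    also have "(\<bar>x\<bar> + 1) * (2 * \<bar>x\<bar> + 1) \<le> 6 * q"
    proof -
      have "\<bar>x\<bar> \<le> 1 + x\<^sup>2" using zero_le_power2[of "\<bar>x\<bar> - 1"] by (simp add: power2_eq_square algebra_simps)
      moreover have "(\<bar>x\<bar> + 1) * (2 * \<bar>x\<bar> + 1) = 2 * x\<^sup>2 + 3 * \<bar>x\<bar> + 1"
        by (simp add: power2_eq_square algebra_simps)
      moreover have "1 + x\<^sup>2 \<le> q" by (simp add: q_def sq1_def)
      ultimately show ?thesis by linarith
    qed
    also have "(\<bar>x\<bar> + 1) * p + 6 * q \<le> (\<bar>x\<bar> + 19) * p" using q3p by (simp add: algebra_simps)
    finally show ?thesis by simp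
  qed
  then have "\<bar>\<xi>\<bar> / p \<le> (\<bar>x\<bar> + 19) / q" using pos by (simp add: divide_simps mult_ac)
  then show ?thesis using \<xi>(3) pos by (simp add: p_def q_def abs_mult)
qed

text \<open>The squared increment separates into a leading term, which combines with its vertical
  counterpart to at most \<open>1 / sq1 x y\<close>, and an error of inverse cubic order in the
  distance, summable over the plane. Cubed increments are of that order from the start.\<close>

lemma ln_sq1_diff_square_le:
  "((ln (sq1 (x + 1) y) - ln (sq1 x y)) / 2)\<^sup>2 \<le> x\<^sup>2 / (sq1 x y)\<^sup>2 + 399 / (sq1 x y * sqrt (sq1 x y))"
  and ln_sq1_diff_cube_le:
  "\<bar>(ln (sq1 (x + 1) y) - ln (sq1 x y)) / 2\<bar> ^ 3 \<le> 8000 / (sq1 x y * sqrt (sq1 x y))"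
proof -
  define q where "q = sq1 x y"
  define s where "s = sqrt q"
  have q: "q \<ge> 1" by (simp add: q_def sq1_ge_1)
  have s: "s \<ge> 1" "s\<^sup>2 = q" using q by (simp_all add: s_def)
  have "\<bar>x\<bar> \<le> s" unfolding s_def by (rule real_le_rsqrt) (simp add: q_def sq1_def)
  define h where "h = \<bar>(ln (sq1 (x + 1) y) - ln (sq1 x y)) / 2\<bar>"
  have h: "h \<le> (\<bar>x\<bar> + 19) / q" "h \<ge> 0" using abs_ln_sq1_diff_le[of x y] by (simp_all add: h_def q_def)
  have "h\<^sup>2 \<le> ((\<bar>x\<bar> + 19) / q)\<^sup>2" using h by (intro power_mono) auto
  also have "\<dots> = (x\<^sup>2 + 38 * \<bar>x\<bar> + 361) / q\<^sup>2"
    by (simp add: power_divide power2_eq_square algebra_simps)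
  \<comment> \<open>\<open>399 = 38 + 361\<close>, the coefficients of
    \<open>(\<bar>x\<bar> + 19)\<^sup>2\<close>, with \<open>\<bar>x\<bar>\<close> and 1 both at
    most \<open>s\<close>.\<close>
  also have "\<dots> \<le> (x\<^sup>2 + 399 * s) / q\<^sup>2"
    using \<open>\<bar>x\<bar> \<le> s\<close> s(1) by (intro divide_right_mono) auto
  also have "\<dots> = x\<^sup>2 / q\<^sup>2 + 399 / (q * s)"
    using s q by (simp add: add_divide_distrib power2_eq_square[of q]) (simp add: s(2)[symmetric] power2_eq_square)
  finally show "((ln (sq1 (x + 1) y) - ln (sq1 x y)) / 2)\<^sup>2 \<le> x\<^sup>2 / (sq1 x y)\<^sup>2 + 399 / (sq1 x y * sqrt (sq1 x y))"
    unfolding h_def power2_abs by (simp add: q_def s_def)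
  have "h \<le> (20 * s) / q"
    by (rule order_trans[OF h(1)]) (use \<open>\<bar>x\<bar> \<le> s\<close> s(1) q in \<open>auto intro!: divide_right_mono\<close>)
  also have "\<dots> = 20 / s" using s by (simp add: s(2)[symmetric] power2_eq_square)
  finally have "h ^ 3 \<le> (20 / s) ^ 3" using h by (intro power_mono) auto
  also have "\<dots> = 8000 / (q * s)" by (simp add: power_divide s(2)[symmetric] power2_eq_square power3_eq_cube)
  finally show "\<bar>(ln (sq1 (x + 1) y) - ln (sq1 x y)) / 2\<bar> ^ 3 \<le> 8000 / (sq1 x y * sqrt (sq1 x y))"
    unfolding h_def by (simp add: q_def s_def)
qed

lemma harm_le_ln_plus_1: "n > 0 \<Longrightarrow> harm n \<le> ln (real n) + 1"
  using decseqD[OF decseq_harm_diff_ln, of 0 "n - 1"] by (simp add: harm_expand)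

text \<open>Comparison with the harmonic sum on each half-line; this is where the logarithm in the
  energy arises.\<close>

lemma sum_inverse_sqrt_le:
  assumes "finite A" "A \<subseteq> {- int N..int N}" "int_sector \<alpha> A" "N > 0"
  shows "(\<Sum>x\<in>A. 1 / sqrt (1 + (of_int x)\<^sup>2)) \<le> real \<alpha> * (ln (real N) + 1) + (1 :: real)"
proof -
  have "(\<Sum>x\<in>A. 1 / sqrt (1 + (of_int x)\<^sup>2)) \<le>
      real \<alpha> * (ln (real N) + 1) + (\<lambda>x::int. 1 / sqrt (1 + (of_int x)\<^sup>2) :: real) 0"
  proof (rule sum_int_sector_le[OF assms(3,1)])
    fix Z assume Z: "Z \<subseteq> A \<union> uminus ` A" "\<And>y. y \<in> Z \<Longrightarrow> y > 0"
    have sub: "Z \<subseteq> int ` {1..N}"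
    proof
      fix y assume "y \<in> Z"
      then have "y > 0" "y \<le> int N" using Z assms(2) by (auto, fastforce)
      then show "y \<in> int ` {1..N}" by (intro image_eqI[of _ _ "nat y"]) auto
    qed
    have "(\<Sum>x\<in>Z. 1 / sqrt (1 + (of_int x)\<^sup>2)) \<le> (\<Sum>x\<in>int ` {1..N}. 1 / sqrt (1 + (of_int x)\<^sup>2) :: real)"
      using sub by (intro sum_mono2) auto
    also have "\<dots> = (\<Sum>k=1..N. 1 / sqrt (1 + (real k)\<^sup>2))"
      by (subst sum.reindex) auto
    also have "\<dots> \<le> (\<Sum>k=1..N. inverse (real k))"
    proof (rule sum_mono)
      fix k assume "k \<in> {1..N}"
      then have "k > 0" by simp
      have "real k \<le> sqrt (1 + (real k)\<^sup>2)" by (rule real_le_rsqrt) simp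
      then show "1 / sqrt (1 + (real k)\<^sup>2) \<le> inverse (real k)"
        using \<open>k > 0\<close> by (simp add: inverse_eq_divide frac_le)
    qed
    also have "\<dots> \<le> ln (real N) + 1"
      using harm_le_ln_plus_1[OF assms(4)] by (simp add: harm_def)
    finally show "(\<Sum>x\<in>Z. 1 / sqrt (1 + (of_int x)\<^sup>2)) \<le> ln (real N) + 1" .
  qed auto
  then show ?thesis by simp
qed

lemma int_sector_2 [simp]: "int_sector 2 A"
  by (simp add: int_sector_def)

lemma int_sector_subset: "int_sector \<alpha> A \<Longrightarrow> B \<subseteq> A \<Longrightarrow> int_sector \<alpha> B"
  unfolding int_sector_def by blast

text \<open>Bounding each row by its arctangent integral over the whole line, rather than counting
  sites in discs, already gives the sharp leading constant.\<close>

lemma sum_inverse_sq1_le: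
  assumes "finite A" "finite B" "A \<subseteq> {- int N..int N}" "int_sector \<alpha> A" "int_sector \<alpha>' B" "N > 0"
  shows "(\<Sum>x\<in>A. \<Sum>y\<in>B. 1 / sq1 (of_int x) (of_int y)) \<le> real \<alpha>' * (pi / 2) * (real \<alpha> * (ln (real N) + 1) + 1) + (pi + 1)"
proof -
  have "(\<Sum>x\<in>A. \<Sum>y\<in>B. 1 / sq1 (of_int x) (of_int y)) \<le>
      (\<Sum>x\<in>A. real \<alpha>' * (pi / 2) * (1 / sqrt (1 + (of_int x)\<^sup>2)) + 1 / (1 + (of_int x)\<^sup>2))"
  proof (rule sum_mono)
    fix x assume "x \<in> A"
    have "sqrt (1 + (of_int x)\<^sup>2) > (0::real)" by (simp add: add_pos_nonneg)
    from sum_row_le[OF this assms(2,5)]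
    show "(\<Sum>y\<in>B. 1 / sq1 (of_int x) (of_int y)) \<le>
        real \<alpha>' * (pi / 2) * (1 / sqrt (1 + (of_int x)\<^sup>2)) + 1 / (1 + (of_int x)\<^sup>2)"
      by (simp add: sq1_def)
  qed
  also have "\<dots> = real \<alpha>' * (pi / 2) * (\<Sum>x\<in>A. 1 / sqrt (1 + (of_int x)\<^sup>2)) + (\<Sum>x\<in>A. 1 / (1 + (of_int x)\<^sup>2))"
    by (simp add: sum.distrib sum_distrib_left)
  also have "\<dots> \<le> real \<alpha>' * (pi / 2) * (real \<alpha> * (ln (real N) + 1) + 1) + (pi + 1)"
    using assms by (intro add_mono mult_left_mono sum_inverse_sqrt_le sum_inverse_one_plus_square_le) auto
  finally show ?thesis .
qed

text \<open>In row \<open>x\<close> the square root is at least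
  \<open>a = sqrt (1 + x\<^sup>2)\<close>. The remaining row sum is of order \<open>1 / a\<close>,
  so a row contributes order \<open>1 / a\<^sup>2\<close>, which is summable in
  \<open>x\<close>.\<close>

lemma sum_inverse_sq1_three_halves_le:
  assumes "finite A" "finite B"
  shows "(\<Sum>x\<in>A. \<Sum>y\<in>B. 1 / (sq1 (of_int x) (of_int y) * sqrt (sq1 (of_int x) (of_int y)))) \<le> (pi + 1)\<^sup>2"
proof -
  have "(\<Sum>x\<in>A. \<Sum>y\<in>B. 1 / (sq1 (of_int x) (of_int y) * sqrt (sq1 (of_int x) (of_int y)))) \<le>
      (\<Sum>x\<in>A. (pi + 1) * (1 / (1 + (of_int x)\<^sup>2)))"
  proof (rule sum_mono)
    fix x assume "x \<in> A"
    define a where "a = sqrt (1 + (real_of_int x)\<^sup>2)"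
    have a: "a \<ge> 1" "a\<^sup>2 = 1 + (real_of_int x)\<^sup>2" by (simp_all add: a_def)
    have "(\<Sum>y\<in>B. 1 / (sq1 (of_int x) (of_int y) * sqrt (sq1 (of_int x) (of_int y)))) \<le>
        (\<Sum>y\<in>B. 1 / a * (1 / (a\<^sup>2 + (of_int y)\<^sup>2)))"
    proof (rule sum_mono)
      fix y assume "y \<in> B"
      have "a \<le> sqrt (sq1 (of_int x) (of_int y))" by (simp add: a_def sq1_def)
      then have "1 / sqrt (sq1 (of_int x) (of_int y)) * (1 / sq1 (of_int x) (of_int y)) \<le> 1 / a * (1 / sq1 (of_int x) (of_int y))"
        using a(1) sq1_pos[of "of_int x" "of_int y"] by (intro mult_right_mono divide_left_mono mult_pos_pos) auto
      then show "1 / (sq1 (of_int x) (of_int y) * sqrt (sq1 (of_int x) (of_int y))) \<le> 1 / a * (1 / (a\<^sup>2 + (of_int y)\<^sup>2))"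
        by (simp add: a(2) sq1_def mult.commute)
    qed
    also have "\<dots> = 1 / a * (\<Sum>y\<in>B. 1 / (a\<^sup>2 + (of_int y)\<^sup>2))" by (simp only: sum_distrib_left)
    also have "\<dots> \<le> 1 / a * (real 2 * (pi / (2 * a)) + 1 / a\<^sup>2)"
      using a(1) assms(2) by (intro mult_left_mono sum_row_le) auto
    also have "\<dots> = (pi + 1 / a) / a\<^sup>2" using a(1) by (simp add: field_simps power2_eq_square)
    also have "\<dots> \<le> (pi + 1) / a\<^sup>2" using a(1) by (intro divide_right_mono add_left_mono) auto
    finally show "(\<Sum>y\<in>B. 1 / (sq1 (of_int x) (of_int y) * sqrt (sq1 (of_int x) (of_int y)))) \<le> (pi + 1) * (1 / (1 + (of_int x)\<^sup>2))"
      by (simp add: a(2))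
  qed
  also have "\<dots> = (pi + 1) * (\<Sum>x\<in>A. 1 / (1 + (of_int x)\<^sup>2))" by (simp only: sum_distrib_left)
  also have "\<dots> \<le> (pi + 1) * (pi + 1)"
    using assms by (intro mult_left_mono sum_inverse_one_plus_square_le) auto
  finally show ?thesis by (simp add: power2_eq_square)
qed

section \<open>Energy of a truncated logarithm\<close>

definition site_sq :: "site \<Rightarrow> real" where
  "site_sq z = sq1 (of_int (fst z)) (of_int (snd z))"

text \<open>A substitute for the Green function with zero boundary values at distance
  \<open>r\<close>. The factor \<open>1 / (2 * pi)\<close> is the one for which height and energy
  agree to leading order.\<close>

definition log_bump :: "real \<Rightarrow> site \<Rightarrow> real" where
  "log_bump r z = max 0 (ln r - ln (site_sq z) / 2) / (2 * pi)"

lemma log_bump_0: "r \<ge> 1 \<Longrightarrow> log_bump r (0, 0) = ln r / (2 * pi)"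
  by (simp add: log_bump_def site_sq_def sq1_def)

lemma log_bump_support:
  assumes "log_bump r z \<noteq> 0" "r > 0"
  shows "site_sq z < r\<^sup>2"
proof (rule ccontr)
  assume "\<not> site_sq z < r\<^sup>2"
  then have "ln (r\<^sup>2) \<le> ln (site_sq z)" using assms(2) by (subst ln_le_cancel_iff) (auto simp: site_sq_def sq1_pos)
  then have "ln r - ln (site_sq z) / 2 \<le> 0" using assms(2) by (simp add: ln_realpow)
  then have "log_bump r z = 0" by (simp add: log_bump_def max_def)
  then show False using assms(1) by simp
qed

text \<open>Truncation at 0 is 1-Lipschitz, so the gradient at the edge of the support needs no
  separate estimate.\<close>

lemma log_bump_diff_le:
  "\<bar>log_bump r z' - log_bump r z\<bar> \<le> \<bar>(ln (site_sq z') - ln (site_sq z)) / 2\<bar> / (2 * pi)"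
proof -
  have "\<bar>max 0 a - max 0 b\<bar> \<le> \<bar>b - a\<bar>" for a b :: real by (auto simp: max_def)
  from this[of "ln r - ln (site_sq z') / 2" "ln r - ln (site_sq z) / 2"]
  have "\<bar>max 0 (ln r - ln (site_sq z') / 2) - max 0 (ln r - ln (site_sq z) / 2)\<bar> \<le> \<bar>(ln (site_sq z') - ln (site_sq z)) / 2\<bar>"
    by (simp add: diff_divide_distrib)
  then have "\<bar>max 0 (ln r - ln (site_sq z') / 2) - max 0 (ln r - ln (site_sq z) / 2)\<bar> / (2 * pi) \<le>
      \<bar>(ln (site_sq z') - ln (site_sq z)) / 2\<bar> / (2 * pi)"
    by (intro divide_right_mono) auto
  then show ?thesis by (simp add: log_bump_def diff_divide_distrib[symmetric])
qed

lemma arcs_Z2_lattice_iff: "e \<in> arcs Z2_lattice \<longleftrightarrow> snd e = fst e + (1, 0) \<or> snd e = fst e + (0, 1)"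
  by (cases e) (simp add: Z2_lattice_def)

definition site_tail :: "site \<Rightarrow> real" where
  "site_tail z = 1 / (site_sq z * sqrt (site_sq z))"

lemma log_bump_diff_horizontal:
  "(log_bump r (z + (1, 0)) - log_bump r z)\<^sup>2 \<le> ((of_int (fst z))\<^sup>2 / (site_sq z)\<^sup>2 + 399 * site_tail z) / (2 * pi)\<^sup>2"
  "\<bar>log_bump r (z + (1, 0)) - log_bump r z\<bar> ^ 3 \<le> 8000 * site_tail z"
proof -
  let ?d = "log_bump r (z + (1, 0)) - log_bump r z"
  let ?h = "(ln (sq1 (of_int (fst z) + 1) (of_int (snd z))) - ln (sq1 (of_int (fst z)) (of_int (snd z)))) / 2 :: real"
  have d: "\<bar>?d\<bar> \<le> \<bar>?h\<bar> / (2 * pi)"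
    using log_bump_diff_le[of r "z + (1, 0)" z] by (simp add: site_sq_def)
  have "?d\<^sup>2 \<le> (\<bar>?h\<bar> / (2 * pi))\<^sup>2" using power_mono[OF d, of 2] by simp
  also have "\<dots> = ?h\<^sup>2 / (2 * pi)\<^sup>2" by (simp add: power_divide)
  also have "\<dots> \<le> ((of_int (fst z))\<^sup>2 / (site_sq z)\<^sup>2 + 399 * site_tail z) / (2 * pi)\<^sup>2"
    using ln_sq1_diff_square_le[of "of_int (fst z)" "of_int (snd z)"]
    by (intro divide_right_mono) (auto simp: site_sq_def site_tail_def)
  finally show "?d\<^sup>2 \<le> ((of_int (fst z))\<^sup>2 / (site_sq z)\<^sup>2 + 399 * site_tail z) / (2 * pi)\<^sup>2" .
  have "\<bar>?h\<bar> / (2 * pi) \<le> \<bar>?h\<bar> / 1" using pi_gt3 by (intro divide_left_mono) auto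
  then have "\<bar>?d\<bar> ^ 3 \<le> \<bar>?h\<bar> ^ 3" using d by (intro power_mono) auto
  also have "\<dots> \<le> 8000 * site_tail z"
    using ln_sq1_diff_cube_le[of "of_int (fst z)" "of_int (snd z)"] by (simp add: site_sq_def site_tail_def)
  finally show "\<bar>?d\<bar> ^ 3 \<le> 8000 * site_tail z" .
qed

lemma site_sq_swap: "site_sq (prod.swap z) = site_sq z"
  by (simp add: site_sq_def sq1_def)

lemma log_bump_swap: "log_bump r (prod.swap z) = log_bump r z"
  by (simp add: log_bump_def site_sq_swap)

text \<open>Reflection in the diagonal exchanges the two edge directions and preserves the
  bump.\<close>

lemma log_bump_diff_vertical:
  "(log_bump r (z + (0, 1)) - log_bump r z)\<^sup>2 \<le> ((of_int (snd z))\<^sup>2 / (site_sq z)\<^sup>2 + 399 * site_tail z) / (2 * pi)\<^sup>2"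
  "\<bar>log_bump r (z + (0, 1)) - log_bump r z\<bar> ^ 3 \<le> 8000 * site_tail z"
proof -
  have sw: "prod.swap z + (1, 0) = prod.swap (z + (0, 1))" by (cases z) simp
  have "site_tail (prod.swap z) = site_tail z" by (simp add: site_tail_def site_sq_swap)
  then show "(log_bump r (z + (0, 1)) - log_bump r z)\<^sup>2 \<le> ((of_int (snd z))\<^sup>2 / (site_sq z)\<^sup>2 + 399 * site_tail z) / (2 * pi)\<^sup>2"
    "\<bar>log_bump r (z + (0, 1)) - log_bump r z\<bar> ^ 3 \<le> 8000 * site_tail z"
    using log_bump_diff_horizontal[of r "prod.swap z"] unfolding sw log_bump_swap site_sq_swap by simp_all
qed

lemma site_sq_lessD:
  assumes "site_sq z < r\<^sup>2" "r > 0"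
  shows "\<bar>real_of_int (fst z)\<bar> < r" "\<bar>real_of_int (snd z)\<bar> < r" "norm2 z < r"
proof -
  have *: "(of_int (fst z))\<^sup>2 + (of_int (snd z))\<^sup>2 < r\<^sup>2"
    using assms by (simp add: site_sq_def sq1_def)
  then have "(of_int (fst z))\<^sup>2 < r\<^sup>2" "(of_int (snd z))\<^sup>2 < r\<^sup>2"
    by (smt (verit) zero_le_power2)+
  then show "\<bar>real_of_int (fst z)\<bar> < r" "\<bar>real_of_int (snd z)\<bar> < r"
    using assms(2) by (auto simp: abs_square_less_1 intro: power2_less_imp_less[of "\<bar>_\<bar>"])
  show "norm2 z < r"
    unfolding norm2_def using * assms(2) by (simp add: real_less_lsqrt)
qed

text \<open>Arcs of one fixed direction are determined by their tails, so a sum over them is a sum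
  over distinct sites, translated by \<open>c\<close>.\<close>

lemma sum_arcs_le:
  fixes f :: "site \<times> site \<Rightarrow> real"
  assumes "finite H" "finite A" "finite B"
    and "\<And>e. e \<in> H \<Longrightarrow> snd e = fst e + d"
    and "\<And>e. e \<in> H \<Longrightarrow> fst e - c \<in> A \<times> B"
    and "\<And>e. e \<in> H \<Longrightarrow> f e \<le> \<phi> (fst e - c)" "\<And>z. \<phi> z \<ge> 0"
  shows "(\<Sum>e\<in>H. f e) \<le> (\<Sum>x\<in>A. \<Sum>y\<in>B. \<phi> (x, y))"
proof -
  have "(\<Sum>e\<in>H. f e) \<le> (\<Sum>e\<in>H. \<phi> (fst e - c))" by (intro sum_mono assms)
  also have "\<dots> = (\<Sum>z\<in>(\<lambda>e. fst e - c) ` H. \<phi> z)"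
    by (subst sum.reindex) (auto simp: inj_on_def prod_eq_iff assms(4))
  also have "\<dots> \<le> (\<Sum>z\<in>A \<times> B. \<phi> z)"
  proof (rule sum_mono2)
    show "(\<lambda>e. fst e - c) ` H \<subseteq> A \<times> B" using assms(5) by (rule image_subsetI)
  qed (use assms in auto)
  also have "\<dots> = (\<Sum>x\<in>A. \<Sum>y\<in>B. \<phi> (x, y))"
    by (simp add: sum.cartesian_product)
  finally show ?thesis .
qed

text \<open>Horizontal and vertical leading terms at a site add up to
  \<open>(x\<^sup>2 + y\<^sup>2) / q\<^sup>2 \<le> 1 / q\<close> with
  \<open>q = site_sq (x, y)\<close>. Summation over the sector yields
  \<open>\<alpha> * \<alpha>' * (pi / 2) * ln r\<close>, and division by
  \<open>(2 * pi)\<^sup>2\<close> yields the stated coefficient; for the full plane it is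
  \<open>1 / (2 * pi)\<close>.\<close>

lemma log_bump_energy:
  obtains C where "C \<ge> 0"
    "\<And>r c F \<alpha> \<alpha>'. r \<ge> 1 \<Longrightarrow> finite F \<Longrightarrow> F \<subseteq> arcs Z2_lattice \<Longrightarrow>
      int_sector \<alpha> ((\<lambda>e. fst (fst e) - fst c) ` F) \<Longrightarrow> int_sector \<alpha>' ((\<lambda>e. snd (fst e) - snd c) ` F) \<Longrightarrow>
      (\<Sum>e\<in>F. (log_bump r (snd e - c) - log_bump r (fst e - c))\<^sup>2) \<le> real (\<alpha> * \<alpha>') / (8 * pi) * ln r + C \<and>
      (\<Sum>e\<in>F. \<bar>log_bump r (snd e - c) - log_bump r (fst e - c)\<bar> ^ 3) \<le> C"
proof -
  define T where "T = (pi + 1)\<^sup>2"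
  \<comment> \<open>\<open>7 * pi\<close> bounds
    \<open>\<alpha>' * (pi / 2) * (3 * \<alpha> + 1)\<close> for both sectors equal to 2; 798 and
    16000 are twice 399 and 8000, one share for each edge direction.\<close>
  define C where "C = max ((7 * pi + (pi + 1) + 798 * T) / (2 * pi)\<^sup>2) (16000 * T)"
  have "T \<ge> 0" by (simp add: T_def)
  show ?thesis
  proof (rule that[of C])
    show "C \<ge> 0" using \<open>T \<ge> 0\<close> by (simp add: C_def le_max_iff_disj)
  next
    fix r :: real and c :: site and F :: "(site \<times> site) set" and \<alpha> \<alpha>' :: nat
    assume r: "r \<ge> 1" and fin: "finite F" and F: "F \<subseteq> arcs Z2_lattice"
      and sec: "int_sector \<alpha> ((\<lambda>e. fst (fst e) - fst c) ` F)" "int_sector \<alpha>' ((\<lambda>e. snd (fst e) - snd c) ` F)"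
    define d where "d = (\<lambda>e :: site \<times> site. log_bump r (snd e - c) - log_bump r (fst e - c))"
    \<comment> \<open>Only arcs with nonzero increment count, which confines the tails to a box of
      size comparable to \<open>r\<close>, whatever \<open>F\<close> is.\<close>
    define Act where "Act = {e \<in> F. d e \<noteq> 0}"
    define H where "H = {e \<in> Act. snd e = fst e + (1, 0)}"
    define V where "V = {e \<in> Act. snd e = fst e + (0, 1)}"
    define A where "A = (\<lambda>e. fst (fst e) - fst c) ` Act"
    define B where "B = (\<lambda>e. snd (fst e) - snd c) ` Act"
    \<comment> \<open>The extra 1 is for arcs whose head lies in the support while the tail is one
      step outside.\<close>
    define N where "N = nat \<lceil>r\<rceil> + 1"
    have finAct: "finite Act" "finite H" "finite V" using fin by (auto simp: Act_def H_def V_def)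
    have finAB: "finite A" "finite B" using finAct by (auto simp: A_def B_def)
    have secA: "int_sector \<alpha> A" by (rule int_sector_subset[OF sec(1)]) (auto simp: A_def Act_def)
    have secB: "int_sector \<alpha>' B" by (rule int_sector_subset[OF sec(2)]) (auto simp: B_def Act_def)
    have ActHV: "Act = H \<union> V" "H \<inter> V = {}"
      using F by (auto simp: Act_def H_def V_def arcs_Z2_lattice_iff prod_eq_iff)
    have N: "N > 0" "real N \<le> r + 2" "real N \<ge> r + 1"
      using r by (auto simp: N_def) linarith+
    have A_sub: "A \<subseteq> {- int N..int N}"
    proof
      fix x assume "x \<in> A"
      then obtain e where e: "e \<in> Act" "x = fst (fst e) - fst c" by (auto simp: A_def)
      then have "log_bump r (snd e - c) \<noteq> 0 \<or> log_bump r (fst e - c) \<noteq> 0" by (auto simp: Act_def d_def)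
      then have "site_sq (snd e - c) < r\<^sup>2 \<or> site_sq (fst e - c) < r\<^sup>2"
        using log_bump_support r by (metis less_le_trans zero_less_one)
      then have "\<bar>real_of_int (fst (snd e - c))\<bar> < r \<or> \<bar>real_of_int (fst (fst e - c))\<bar> < r"
        using site_sq_lessD(1) r by (metis less_le_trans zero_less_one)
      moreover have "\<bar>fst (snd e - c) - x\<bar> \<le> 1"
      proof -
        have "e \<in> arcs Z2_lattice" using e(1) F by (auto simp: Act_def)
        then show ?thesis unfolding arcs_Z2_lattice_iff using e(2) by auto
      qed
      moreover have "fst (fst e - c) = x" using e by simp
      ultimately have "\<bar>real_of_int x\<bar> < r + 1" by linarith
      then show "x \<in> {- int N..int N}" using N(3) by auto
    qed
    have tails: "fst e - c \<in> A \<times> B" if "e \<in> Act" for e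
      using that by (auto simp: A_def B_def mem_Times_iff)
    define Q where "Q = (\<Sum>x\<in>A. \<Sum>y\<in>B. 1 / site_sq (x, y))"
    define E where "E = (\<Sum>x\<in>A. \<Sum>y\<in>B. site_tail (x, y))"
    have E: "E \<le> T"
      using sum_inverse_sq1_three_halves_le[OF finAB] by (simp add: E_def T_def site_tail_def site_sq_def)
    have tail_nonneg: "site_tail z \<ge> 0" for z
      using sq1_pos by (simp add: site_tail_def site_sq_def less_imp_le)
    have split: "(\<Sum>e\<in>F. g (d e)) = (\<Sum>e\<in>H. g (d e)) + (\<Sum>e\<in>V. g (d e))" if "g 0 = 0" for g :: "real \<Rightarrow> real"
    proof -
      have "(\<Sum>e\<in>F. g (d e)) = (\<Sum>e\<in>Act. g (d e))"
        by (rule sum.mono_neutral_right) (use fin that in \<open>auto simp: Act_def\<close>)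
      also have "\<dots> = (\<Sum>e\<in>H. g (d e)) + (\<Sum>e\<in>V. g (d e))"
        unfolding ActHV(1) by (rule sum.union_disjoint) (use finAct ActHV in auto)
      finally show ?thesis .
    qed
    have head: "snd e - c = (fst e - c) + (1, 0)" if "e \<in> H" for e
      using that by (simp add: H_def)
    have head': "snd e - c = (fst e - c) + (0, 1)" if "e \<in> V" for e
      using that by (simp add: V_def)
    define \<phi> where "\<phi> = (\<lambda>t z. ((of_int t)\<^sup>2 / (site_sq z)\<^sup>2 + 399 * site_tail z) / (2 * pi)\<^sup>2)"
    have \<phi>_nonneg: "\<phi> t z \<ge> 0" for t z using tail_nonneg[of z] by (simp add: \<phi>_def)
    have dH: "(d e)\<^sup>2 \<le> \<phi> (fst (fst e - c)) (fst e - c)" "\<bar>d e\<bar> ^ 3 \<le> 8000 * site_tail (fst e - c)" if "e \<in> H" for e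
      unfolding d_def head[OF that] \<phi>_def by (rule log_bump_diff_horizontal)+
    have dV: "(d e)\<^sup>2 \<le> \<phi> (snd (fst e - c)) (fst e - c)" "\<bar>d e\<bar> ^ 3 \<le> 8000 * site_tail (fst e - c)" if "e \<in> V" for e
      unfolding d_def head'[OF that] \<phi>_def by (rule log_bump_diff_vertical)+
    have tailsH: "fst e - c \<in> A \<times> B" "snd e = fst e + (1, 0)" if "e \<in> H" for e
      using that tails[of e] by (simp_all add: H_def)
    have tailsV: "fst e - c \<in> A \<times> B" "snd e = fst e + (0, 1)" if "e \<in> V" for e
      using that tails[of e] by (simp_all add: V_def)
    have "(\<Sum>e\<in>H. (d e)\<^sup>2) \<le> (\<Sum>x\<in>A. \<Sum>y\<in>B. \<phi> (fst (x, y)) (x, y))"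
      by (rule sum_arcs_le[OF finAct(2) finAB tailsH(2,1), where \<phi> = "\<lambda>z. \<phi> (fst z) z"]) (auto simp only: dH \<phi>_nonneg)
    moreover have "(\<Sum>e\<in>V. (d e)\<^sup>2) \<le> (\<Sum>x\<in>A. \<Sum>y\<in>B. \<phi> (snd (x, y)) (x, y))"
      by (rule sum_arcs_le[OF finAct(3) finAB tailsV(2,1), where \<phi> = "\<lambda>z. \<phi> (snd z) z"]) (auto simp only: dV \<phi>_nonneg)
    ultimately have "(\<Sum>e\<in>F. (d e)\<^sup>2) \<le>
        (\<Sum>x\<in>A. \<Sum>y\<in>B. \<phi> (fst (x, y)) (x, y)) + (\<Sum>x\<in>A. \<Sum>y\<in>B. \<phi> (snd (x, y)) (x, y))"
      using split[of "\<lambda>t. t\<^sup>2"] by simp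
    also have "\<dots> = (\<Sum>x\<in>A. \<Sum>y\<in>B. \<phi> (fst (x, y)) (x, y) + \<phi> (snd (x, y)) (x, y))"
      by (simp only: sum.distrib)
    also have "\<dots> \<le> (\<Sum>x\<in>A. \<Sum>y\<in>B. (1 / site_sq (x, y) + 798 * site_tail (x, y)) / (2 * pi)\<^sup>2)"
    proof (intro sum_mono)
      fix x y :: int
      define q where "q = site_sq (x, y)"
      have q: "q > 0" "(of_int x)\<^sup>2 + (of_int y)\<^sup>2 \<le> q" 
        using sq1_pos[of "of_int x" "of_int y"] by (simp_all add: q_def site_sq_def sq1_def)
      have "(of_int x)\<^sup>2 / q\<^sup>2 + (of_int y)\<^sup>2 / q\<^sup>2 \<le> q / q\<^sup>2"
        unfolding add_divide_distrib[symmetric] using q by (intro divide_right_mono) auto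
      also have "\<dots> = 1 / q" using q by (simp add: power2_eq_square)
      finally have "((of_int x)\<^sup>2 / q\<^sup>2 + 399 * site_tail (x, y)) + ((of_int y)\<^sup>2 / q\<^sup>2 + 399 * site_tail (x, y)) \<le>
          1 / q + 798 * site_tail (x, y)" by simp
      then show "\<phi> (fst (x, y)) (x, y) + \<phi> (snd (x, y)) (x, y) \<le>
          (1 / site_sq (x, y) + 798 * site_tail (x, y)) / (2 * pi)\<^sup>2"
        unfolding \<phi>_def
        unfolding add_divide_distrib[symmetric] fst_conv snd_conv q_def[symmetric]
        by (intro divide_right_mono) auto
    qed
    also have "\<dots> = (Q + 798 * E) / (2 * pi)\<^sup>2"
      by (simp add: Q_def E_def sum_divide_distrib[symmetric] sum_distrib_left[symmetric] sum.distrib)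
    also have "\<dots> \<le> (real (\<alpha> * \<alpha>') * (pi / 2) * ln r + (7 * pi + (pi + 1) + 798 * T)) / (2 * pi)\<^sup>2"
    proof (intro divide_right_mono)
      have \<alpha>: "\<alpha> \<le> 2" "\<alpha>' \<le> 2" using sec by (auto simp: int_sector_def)
      \<comment> \<open>\<open>N \<le> r + 2 \<le> 3 * r \<le> exp 2 * r\<close>, so replacing
        \<open>N\<close> by \<open>r\<close> costs an additive 2 in the logarithm.\<close>
      have "ln (real N) \<le> ln (exp 2 * r)"
      proof (subst ln_le_cancel_iff)
        have "1 + 2 + (2::real)\<^sup>2 / 2 \<le> exp 2" using exp_lower_Taylor_quadratic[of 2] by simp
        then have "3 \<le> exp (2::real)" by simp
        then have "3 * r \<le> exp 2 * r" using r by (intro mult_right_mono) auto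
        then show "real N \<le> exp 2 * r" using N r by linarith
      qed (use N r in auto)
      then have lnN: "ln (real N) \<le> 2 + ln r" using r by (simp add: ln_mult)
      have "Q \<le> real \<alpha>' * (pi / 2) * (real \<alpha> * (ln (real N) + 1) + 1) + (pi + 1)"
        using sum_inverse_sq1_le[OF finAB A_sub secA secB N(1)] by (simp add: Q_def site_sq_def)
      also have "\<dots> \<le> real \<alpha>' * (pi / 2) * (real \<alpha> * (2 + ln r + 1) + 1) + (pi + 1)"
        using lnN by (intro add_mono mult_left_mono) auto
      also have "\<dots> = real (\<alpha> * \<alpha>') * (pi / 2) * ln r + real \<alpha>' * (pi / 2) * (real \<alpha> * 3 + 1) + (pi + 1)"
        by (simp add: algebra_simps)
      also have "real \<alpha>' * (pi / 2) * (real \<alpha> * 3 + 1) \<le> 2 * (pi / 2) * (2 * 3 + 1)"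
        using \<alpha> by (intro mult_mono add_mono) auto
      finally show "Q + 798 * E \<le> real (\<alpha> * \<alpha>') * (pi / 2) * ln r + (7 * pi + (pi + 1) + 798 * T)"
        using E by simp
    qed auto
    also have "\<dots> = real (\<alpha> * \<alpha>') / (8 * pi) * ln r + (7 * pi + (pi + 1) + 798 * T) / (2 * pi)\<^sup>2"
      unfolding add_divide_distrib by (simp add: power2_eq_square)
    also have "\<dots> \<le> real (\<alpha> * \<alpha>') / (8 * pi) * ln r + C" by (simp add: C_def)
    finally have 1: "(\<Sum>e\<in>F. (d e)\<^sup>2) \<le> real (\<alpha> * \<alpha>') / (8 * pi) * ln r + C" .
    have "(\<Sum>e\<in>H. \<bar>d e\<bar> ^ 3) \<le> (\<Sum>x\<in>A. \<Sum>y\<in>B. 8000 * site_tail (x, y))"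
      by (rule sum_arcs_le[OF finAct(2) finAB tailsH(2,1), where \<phi> = "\<lambda>z. 8000 * site_tail z"]) (auto intro: dH tail_nonneg)
    moreover have "(\<Sum>e\<in>V. \<bar>d e\<bar> ^ 3) \<le> (\<Sum>x\<in>A. \<Sum>y\<in>B. 8000 * site_tail (x, y))"
      by (rule sum_arcs_le[OF finAct(3) finAB tailsV(2,1), where \<phi> = "\<lambda>z. 8000 * site_tail z"]) (auto intro: dV tail_nonneg)
    ultimately have "(\<Sum>e\<in>F. \<bar>d e\<bar> ^ 3) \<le> 16000 * E"
      using split[of "\<lambda>t. \<bar>t\<bar> ^ 3"] by (simp add: E_def sum_distrib_left[symmetric])
    also have "\<dots> \<le> 16000 * T" using E by simp
    also have "\<dots> \<le> C" by (simp add: C_def)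
    finally show "(\<Sum>e\<in>F. (log_bump r (snd e - c) - log_bump r (fst e - c))\<^sup>2) \<le> real (\<alpha> * \<alpha>') / (8 * pi) * ln r + C \<and>
      (\<Sum>e\<in>F. \<bar>log_bump r (snd e - c) - log_bump r (fst e - c)\<bar> ^ 3) \<le> C"
      using 1 by (simp add: d_def)
  qed
qed

section \<open>Pairs of bumps at the origin and at \<open>v\<close>\<close>

lemma norm2_eq_norm: "norm2 z = norm (Complex (of_int (fst z)) (of_int (snd z)))"
  by (simp add: norm2_def cmod_def)

lemma norm2_nonneg: "norm2 z \<ge> 0"
  by (simp add: norm2_def)

lemma norm2_uminus: "norm2 (- z) = norm2 z"
  by (simp add: norm2_def)

lemma norm2_triangle: "norm2 (x + y) \<le> norm2 x + norm2 y"
  using norm_triangle_ineq[of "Complex (of_int (fst x)) (of_int (snd x))" "Complex (of_int (fst y)) (of_int (snd y))"]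
  by (simp add: norm2_eq_norm complex_add)

lemma norm2_pos: "v \<noteq> (0, 0) \<Longrightarrow> norm2 v > 0"
  by (cases v) (auto simp: norm2_def sum_power2_gt_zero_iff)

lemma abs_le_norm2: "\<bar>of_int (fst v)\<bar> \<le> norm2 v" "\<bar>of_int (snd v)\<bar> \<le> norm2 v"
  using abs_Re_le_cmod[of "Complex (of_int (fst v)) (of_int (snd v))"]
    abs_Im_le_cmod[of "Complex (of_int (fst v)) (of_int (snd v))"]
  by (simp_all add: norm2_eq_norm)

lemma norm2_arc:
  assumes "e \<in> arcs Z2_lattice" "p \<in> {fst e, snd e}" "p' \<in> {fst e, snd e}"
  shows "norm2 (p - p') \<le> 1"
  using assms unfolding arcs_Z2_lattice_iff
  by (auto simp: norm2_def)

text \<open>A fixed fraction of the distance keeps the two bumps apart at the cost of only a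
  constant factor. The lower bound 1 keeps the logarithm nonnegative when \<open>v\<close> is close
  to the origin.\<close>

definition bump_radius :: "real \<Rightarrow> site \<Rightarrow> real" where
  "bump_radius c v = max 1 (c * norm2 v)"

definition bump_pair :: "real \<Rightarrow> real \<Rightarrow> site \<Rightarrow> site \<Rightarrow> real" where
  "bump_pair k c v z = log_bump (bump_radius c v) z - k * log_bump (bump_radius c v) (z - v)"

text \<open>Since \<open>site_sq\<close> is at least 1, a bump of radius 1 vanishes identically; a
  nonzero value therefore rules out that branch of the maximum.\<close>

lemma log_bump_radius_support:
  assumes "log_bump (bump_radius c v) z \<noteq> 0"
  shows "norm2 z < c * norm2 v" "c * norm2 v > 1"
proof -
  let ?r = "bump_radius c v"
  have r: "?r \<ge> 1" by (simp add: bump_radius_def)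
  have sq: "site_sq z < ?r\<^sup>2" by (rule log_bump_support[OF assms]) (use r in linarith)
  have "?r \<noteq> 1"
  proof
    assume "?r = 1"
    then show False using sq sq1_ge_1[of "of_int (fst z)" "of_int (snd z)"] by (simp add: site_sq_def)
  qed
  then show "c * norm2 v > 1" using r by (auto simp: bump_radius_def max_def split: if_splits)
  then show "norm2 z < c * norm2 v"
    using site_sq_lessD(3)[OF sq] by (simp add: bump_radius_def max_def split: if_splits)
qed

text \<open>Neither bump reaches the centre of the other, so the two heights simply add.\<close>

lemma bump_pair_value:
  assumes "0 < c" "c \<le> 1/4"
  shows "bump_pair k c v (0, 0) - bump_pair k c v v = (1 + k) / (2 * pi) * ln (bump_radius c v)"
proof -
  have far: "log_bump (bump_radius c v) z = 0" if "norm2 z = norm2 v" for z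
  proof (rule ccontr)
    assume nz: "log_bump (bump_radius c v) z \<noteq> 0"
    have "c * norm2 v \<le> 1 * norm2 v" using assms by (intro mult_right_mono norm2_nonneg) auto
    then show False using log_bump_radius_support(1)[OF nz] that by simp
  qed
  have "(0, 0) - v = - v" "v - v = (0, 0)" by (simp_all add: prod_eq_iff)
  then show ?thesis
    using far[of v] far[of "- v"] log_bump_0[of "bump_radius c v"]
    by (simp add: bump_pair_def norm2_uminus bump_radius_def add_divide_distrib distrib_right)
qed

lemma bump_pair_energy:
  obtains C where "C \<ge> 0"
    "\<And>k c v F \<alpha> \<alpha>'. 0 < c \<Longrightarrow> c \<le> 1/4 \<Longrightarrow> (k = 1 \<and> \<alpha> * \<alpha>' = 4) \<or> (k = 2 \<and> \<alpha> * \<alpha>' = 2) \<Longrightarrow>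
      finite F \<Longrightarrow> F \<subseteq> arcs Z2_lattice \<Longrightarrow>
      int_sector \<alpha> ((\<lambda>e. fst (fst e) - fst v) ` F) \<Longrightarrow> int_sector \<alpha>' ((\<lambda>e. snd (fst e) - snd v) ` F) \<Longrightarrow>
      (\<Sum>e\<in>F. (bump_pair k c v (snd e) - bump_pair k c v (fst e))\<^sup>2) \<le> (1 + k) / (2 * pi) * ln (bump_radius c v) + C \<and>
      (\<Sum>e\<in>F. \<bar>bump_pair k c v (snd e) - bump_pair k c v (fst e)\<bar> ^ 3) \<le> C"
proof -
  obtain C where C: "C \<ge> 0"
    "\<And>r c F \<alpha> \<alpha>'. r \<ge> 1 \<Longrightarrow> finite F \<Longrightarrow> F \<subseteq> arcs Z2_lattice \<Longrightarrow>
      int_sector \<alpha> ((\<lambda>e. fst (fst e) - fst c) ` F) \<Longrightarrow> int_sector \<alpha>' ((\<lambda>e. snd (fst e) - snd c) ` F) \<Longrightarrow>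
      (\<Sum>e\<in>F. (log_bump r (snd e - c) - log_bump r (fst e - c))\<^sup>2) \<le> real (\<alpha> * \<alpha>') / (8 * pi) * ln r + C \<and>
      (\<Sum>e\<in>F. \<bar>log_bump r (snd e - c) - log_bump r (fst e - c)\<bar> ^ 3) \<le> C"
    by (rule log_bump_energy) (rule that; blast)
  show ?thesis
  \<comment> \<open>The factor covers both \<open>1 + k\<^sup>2 \<le> 5\<close> and
    \<open>1 + k ^ 3 \<le> 9\<close> for \<open>k \<le> 2\<close>.\<close>
  proof (rule that[of "9 * C"])
    show "9 * C \<ge> 0" using C(1) by simp
  next
    fix k c :: real and v :: site and F :: "(site \<times> site) set" and \<alpha> \<alpha>' :: nat
    assume c: "0 < c" "c \<le> 1/4" and k: "(k = 1 \<and> \<alpha> * \<alpha>' = 4) \<or> (k = 2 \<and> \<alpha> * \<alpha>' = 2)"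
      and F: "finite F" "F \<subseteq> arcs Z2_lattice"
      and sec: "int_sector \<alpha> ((\<lambda>e. fst (fst e) - fst v) ` F)" "int_sector \<alpha>' ((\<lambda>e. snd (fst e) - snd v) ` F)"
    define r where "r = bump_radius c v"
    have r: "r \<ge> 1" by (simp add: r_def bump_radius_def)
    define d\<^sub>1 where "d\<^sub>1 = (\<lambda>e :: site \<times> site. log_bump r (snd e - 0) - log_bump r (fst e - 0))"
    define d\<^sub>2 where "d\<^sub>2 = (\<lambda>e :: site \<times> site. log_bump r (snd e - v) - log_bump r (fst e - v))"
    have d: "bump_pair k c v (snd e) - bump_pair k c v (fst e) = d\<^sub>1 e - k * d\<^sub>2 e" for e
      by (simp add: bump_pair_def d\<^sub>1_def d\<^sub>2_def r_def algebra_simps)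
    \<comment> \<open>Otherwise \<open>norm2 v < 1 + 2 * c * norm2 v < 3 * c * norm2 v\<close>,
      because a nonzero bump forces \<open>c * norm2 v > 1\<close>; this contradicts
      \<open>c \<le> 1/4\<close>.\<close>
    have disjoint: "d\<^sub>1 e = 0 \<or> d\<^sub>2 e = 0" if "e \<in> F" for e
    proof (rule ccontr)
      assume nz: "\<not> (d\<^sub>1 e = 0 \<or> d\<^sub>2 e = 0)"
      then have "log_bump r (fst e) \<noteq> 0 \<or> log_bump r (snd e) \<noteq> 0"
        "log_bump r (fst e - v) \<noteq> 0 \<or> log_bump r (snd e - v) \<noteq> 0"
        by (auto simp: d\<^sub>1_def d\<^sub>2_def)
      then obtain p p' where p: "p \<in> {fst e, snd e}" "log_bump r p \<noteq> 0"
        and p': "p' \<in> {fst e, snd e}" "log_bump r (p' - v) \<noteq> 0"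
        by blast
      have "norm2 (p - p') \<le> 1" using norm2_arc F(2) that p(1) p'(1) by blast
      moreover have "norm2 v \<le> norm2 p + norm2 (v - p)" using norm2_triangle[of p "v - p"] by simp
      moreover have "norm2 (v - p) \<le> norm2 (v - p') + norm2 (p' - p)" using norm2_triangle[of "v - p'" "p' - p"] by simp
      moreover have "norm2 (v - p') = norm2 (p' - v)" "norm2 (p' - p) = norm2 (p - p')"
        using norm2_uminus[of "p' - v"] norm2_uminus[of "p - p'"] by simp_all
      moreover have "norm2 p < c * norm2 v" "norm2 (p' - v) < c * norm2 v" "c * norm2 v > 1"
        using log_bump_radius_support p(2) p'(2) unfolding r_def by auto
      moreover have "c * norm2 v \<le> 1/4 * norm2 v" using c by (intro mult_right_mono norm2_nonneg) auto
      ultimately show False by linarith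
    qed
    have kpos: "k \<ge> 0" using k by auto
    have E1: "(\<Sum>e\<in>F. (d\<^sub>1 e)\<^sup>2) \<le> real (2 * 2) / (8 * pi) * ln r + C" "(\<Sum>e\<in>F. \<bar>d\<^sub>1 e\<bar> ^ 3) \<le> C"
      using C(2)[OF r F, of 2 0 2] by (simp_all add: d\<^sub>1_def)
    have E2: "(\<Sum>e\<in>F. (d\<^sub>2 e)\<^sup>2) \<le> real (\<alpha> * \<alpha>') / (8 * pi) * ln r + C" "(\<Sum>e\<in>F. \<bar>d\<^sub>2 e\<bar> ^ 3) \<le> C"
      using C(2)[OF r F sec] by (simp_all add: d\<^sub>2_def)
    have "(\<Sum>e\<in>F. (d\<^sub>1 e - k * d\<^sub>2 e)\<^sup>2) = (\<Sum>e\<in>F. (d\<^sub>1 e)\<^sup>2 + k\<^sup>2 * (d\<^sub>2 e)\<^sup>2)"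
    proof (rule sum.cong[OF refl])
      fix e assume "e \<in> F"
      from disjoint[OF this] show "(d\<^sub>1 e - k * d\<^sub>2 e)\<^sup>2 = (d\<^sub>1 e)\<^sup>2 + k\<^sup>2 * (d\<^sub>2 e)\<^sup>2"
        by (elim disjE) (simp_all add: power_mult_distrib)
    qed
    also have "\<dots> = (\<Sum>e\<in>F. (d\<^sub>1 e)\<^sup>2) + k\<^sup>2 * (\<Sum>e\<in>F. (d\<^sub>2 e)\<^sup>2)"
      by (simp add: sum.distrib sum_distrib_left)
    also have "\<dots> \<le> (real (2 * 2) / (8 * pi) * ln r + C) + k\<^sup>2 * (real (\<alpha> * \<alpha>') / (8 * pi) * ln r + C)"
      using E1 E2 by (intro add_mono mult_left_mono) auto
    also have "\<dots> = (1 + k) / (2 * pi) * ln r + (1 + k\<^sup>2) * C"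
    proof -
      have "(k = 1 \<and> real (\<alpha> * \<alpha>') = 4) \<or> (k = 2 \<and> real (\<alpha> * \<alpha>') = 2)"
        using k by (elim disjE conjE) (simp_all only: of_nat_numeral simp_thms)
      then show ?thesis
        by (elim disjE conjE) (simp_all del: of_nat_mult add: field_simps)
    qed
    also have "(1 + k\<^sup>2) * C \<le> 9 * C" using k C(1) by (intro mult_right_mono) auto
    finally have 1: "(\<Sum>e\<in>F. (d\<^sub>1 e - k * d\<^sub>2 e)\<^sup>2) \<le> (1 + k) / (2 * pi) * ln r + 9 * C" by simp
    have "(\<Sum>e\<in>F. \<bar>d\<^sub>1 e - k * d\<^sub>2 e\<bar> ^ 3) = (\<Sum>e\<in>F. \<bar>d\<^sub>1 e\<bar> ^ 3 + k ^ 3 * \<bar>d\<^sub>2 e\<bar> ^ 3)"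
    proof (rule sum.cong[OF refl])
      fix e assume "e \<in> F"
      from disjoint[OF this] show "\<bar>d\<^sub>1 e - k * d\<^sub>2 e\<bar> ^ 3 = \<bar>d\<^sub>1 e\<bar> ^ 3 + k ^ 3 * \<bar>d\<^sub>2 e\<bar> ^ 3"
        using kpos by (elim disjE) (simp_all add: power_mult_distrib abs_mult)
    qed
    also have "\<dots> = (\<Sum>e\<in>F. \<bar>d\<^sub>1 e\<bar> ^ 3) + k ^ 3 * (\<Sum>e\<in>F. \<bar>d\<^sub>2 e\<bar> ^ 3)"
      by (simp add: sum.distrib sum_distrib_left)
    also have "\<dots> \<le> C + k ^ 3 * C"
      using E1 E2 kpos by (intro add_mono mult_left_mono) auto
    also have "\<dots> \<le> 9 * C" using k C(1) by auto
    finally show "(\<Sum>e\<in>F. (bump_pair k c v (snd e) - bump_pair k c v (fst e))\<^sup>2) \<le> (1 + k) / (2 * pi) * ln (bump_radius c v) + 9 * C \<and>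
      (\<Sum>e\<in>F. \<bar>bump_pair k c v (snd e) - bump_pair k c v (fst e)\<bar> ^ 3) \<le> 9 * C"
      using 1 unfolding d r_def by simp
  qed
qed

text \<open>Returns from the radius to the distance. A bound on the exponent that is free of \<beta>
  makes the lost factor \<open>c powr (- p)\<close> at most \<open>1 / c\<^sup>2\<close>.\<close>

lemma bump_radius_powr_le:
  assumes c: "0 < c" "c \<le> 1" and "v \<noteq> (0, 0)" "0 \<le> p" "p \<le> 2"
  shows "bump_radius c v powr (- p) \<le> 1 / c\<^sup>2 * norm2 v powr (- p)"
proof -
  have v: "norm2 v > 0" by (rule norm2_pos[OF assms(3)])
  have "bump_radius c v powr (- p) \<le> (c * norm2 v) powr (- p)"
    using c v assms(4) by (intro powr_mono2') (auto simp: bump_radius_def)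
  also have "\<dots> = c powr (- p) * norm2 v powr (- p)"
    using c v by (simp add: powr_mult)
  also have "c powr (- p) \<le> c powr (- 2)"
    using c assms(5) by (intro powr_mono') auto
  also have "c powr (- 2) = 1 / c\<^sup>2" using c by (simp add: powr_minus_divide)
  finally show ?thesis using v by (simp add: mult_right_mono)
qed

lemma exponent_bounds:
  assumes "\<beta> \<ge> 1/3" "0 \<le> k" "k \<le> 2"
  shows "0 \<le> (1 + k) / (2 * pi) * (1 + M_err \<beta> / 2) / (2 * \<beta>)" "(1 + k) / (2 * pi) * (1 + M_err \<beta> / 2) / (2 * \<beta>) \<le> 2"
proof -
  have M: "0 \<le> M_err \<beta>" "M_err \<beta> \<le> 2" using assms M_err_nonneg M_err_le_2 by auto
  then show "0 \<le> (1 + k) / (2 * pi) * (1 + M_err \<beta> / 2) / (2 * \<beta>)" using assms by simp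
  have "(1 + k) * (1 + M_err \<beta> / 2) \<le> 3 * 2" using M assms by (intro mult_mono) auto
  moreover have "3 * (1/3) \<le> pi * \<beta>" using assms pi_gt3 by (intro mult_mono) auto
  ultimately have "(1 + k) * (1 + M_err \<beta> / 2) \<le> 2 * (2 * pi * (2 * \<beta>))" by linarith
  then show "(1 + k) / (2 * pi) * (1 + M_err \<beta> / 2) / (2 * \<beta>) \<le> 2"
    using assms by (simp add: divide_simps)
qed

text \<open>The common source of the three two-point estimates. Only differences of \<open>u\<close>
  are prescribed, so \<open>u\<close> may live on a wired graph or be shifted by a constant to
  vanish at a pinned vertex. \<open>K\<close> does not depend on \<open>c\<close>.\<close>

lemma bump_pair_cos_le:
  obtains K where "K > 0"
    "\<And>k c v \<alpha> \<alpha>' \<beta> (G :: ('v, site \<times> site) pre_digraph) S F u \<eta> x y.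
      0 < c \<Longrightarrow> c \<le> 1/4 \<Longrightarrow> v \<noteq> (0, 0) \<Longrightarrow> (k = 1 \<and> \<alpha> * \<alpha>' = 4) \<or> (k = 2 \<and> \<alpha> * \<alpha>' = 2) \<Longrightarrow>
      finite F \<Longrightarrow> F \<subseteq> arcs Z2_lattice \<Longrightarrow>
      int_sector \<alpha> ((\<lambda>e. fst (fst e) - fst v) ` F) \<Longrightarrow> int_sector \<alpha>' ((\<lambda>e. snd (fst e) - snd v) ` F) \<Longrightarrow>
      \<beta> \<ge> 1/3 \<Longrightarrow> finite S \<Longrightarrow> (\<And>w. w \<notin> S \<Longrightarrow> u w = 0) \<Longrightarrow>
      (\<And>e. e \<in> F \<Longrightarrow> u (head G e) - u (tail G e) = bump_pair k c v (snd e) - bump_pair k c v (fst e)) \<Longrightarrow>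
      u x - u y = bump_pair k c v (0, 0) - bump_pair k c v v \<Longrightarrow>
      (\<integral>\<theta>. cos (override_on \<eta> \<theta> S x - override_on \<eta> \<theta> S y) *
           villain_product G F \<beta> (override_on \<eta> \<theta> S) \<partial>Pi\<^sub>M S (\<lambda>_. angle_space))
      \<le> K / c\<^sup>2 * norm2 v powr (- ((1 + k) * (1 + M_err \<beta> / 2) / (4 * pi * \<beta>))) *
        (\<integral>\<theta>. villain_product G F \<beta> (override_on \<eta> \<theta> S) \<partial>Pi\<^sub>M S (\<lambda>_. angle_space))"
proof -
  obtain C where C: "C \<ge> 0"
    "\<And>k c v F \<alpha> \<alpha>'. 0 < c \<Longrightarrow> c \<le> 1/4 \<Longrightarrow> (k = 1 \<and> \<alpha> * \<alpha>' = 4) \<or> (k = 2 \<and> \<alpha> * \<alpha>' = 2) \<Longrightarrow>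
      finite F \<Longrightarrow> F \<subseteq> arcs Z2_lattice \<Longrightarrow>
      int_sector \<alpha> ((\<lambda>e. fst (fst e) - fst v) ` F) \<Longrightarrow> int_sector \<alpha>' ((\<lambda>e. snd (fst e) - snd v) ` F) \<Longrightarrow>
      (\<Sum>e\<in>F. (bump_pair k c v (snd e) - bump_pair k c v (fst e))\<^sup>2) \<le> (1 + k) / (2 * pi) * ln (bump_radius c v) + C \<and>
      (\<Sum>e\<in>F. \<bar>bump_pair k c v (snd e) - bump_pair k c v (fst e)\<bar> ^ 3) \<le> C"
    by (rule bump_pair_energy) (rule that; blast)
  obtain C' where C': "C' \<ge> 0"
    "\<And>\<beta> (G :: ('v, site \<times> site) pre_digraph) S F u \<eta> x y. \<beta> \<ge> 1/3 \<Longrightarrow> finite S \<Longrightarrow> finite F \<Longrightarrow>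
      (\<And>v. v \<notin> S \<Longrightarrow> u v = 0) \<Longrightarrow>
      (\<integral>\<theta>. cos (override_on \<eta> \<theta> S x - override_on \<eta> \<theta> S y) *
           villain_product G F \<beta> (override_on \<eta> \<theta> S) \<partial>Pi\<^sub>M S (\<lambda>_. angle_space))
      \<le> exp (- (u x - u y) / \<beta> + (1 - M_err \<beta> / 2) / (2 * \<beta>) * (\<Sum>e\<in>F. (u (head G e) - u (tail G e))\<^sup>2)
             + C' * (\<Sum>e\<in>F. \<bar>u (head G e) - u (tail G e)\<bar> ^ 3)) *
        (\<integral>\<theta>. villain_product G F \<beta> (override_on \<eta> \<theta> S) \<partial>Pi\<^sub>M S (\<lambda>_. angle_space))"
    by (rule villain_cos_integral_le_energy) (rule that; blast)
  show ?thesis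
  proof (rule that[of "exp (5 * C + C' * C)"])
    fix k c :: real and v :: site and \<alpha> \<alpha>' :: nat and \<beta> :: real
      and G :: "('v, site \<times> site) pre_digraph" and S :: "'v set" and F :: "(site \<times> site) set"
      and u \<eta> :: "'v \<Rightarrow> real" and x y :: 'v
    assume c: "0 < c" "c \<le> 1/4" and v: "v \<noteq> (0, 0)" and k: "(k = 1 \<and> \<alpha> * \<alpha>' = 4) \<or> (k = 2 \<and> \<alpha> * \<alpha>' = 2)"
      and F: "finite F" "F \<subseteq> arcs Z2_lattice"
      and sec: "int_sector \<alpha> ((\<lambda>e. fst (fst e) - fst v) ` F)" "int_sector \<alpha>' ((\<lambda>e. snd (fst e) - snd v) ` F)"
      and \<beta>: "\<beta> \<ge> 1/3" and S: "finite S" and u0: "\<And>w. w \<notin> S \<Longrightarrow> u w = 0"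
      and du: "\<And>e. e \<in> F \<Longrightarrow> u (head G e) - u (tail G e) = bump_pair k c v (snd e) - bump_pair k c v (fst e)"
      and uxy: "u x - u y = bump_pair k c v (0, 0) - bump_pair k c v v"
    let ?I = "\<integral>\<theta>. villain_product G F \<beta> (override_on \<eta> \<theta> S) \<partial>Pi\<^sub>M S (\<lambda>_. angle_space)"
    have I: "?I \<ge> 0" using \<beta> by (intro Bochner_Integration.integral_nonneg villain_product_nonneg) auto
    define D where "D = (\<Sum>e\<in>F. (u (head G e) - u (tail G e))\<^sup>2)"
    define Q where "Q = (\<Sum>e\<in>F. \<bar>u (head G e) - u (tail G e)\<bar> ^ 3)"
    have DQ: "D \<le> (1 + k) / (2 * pi) * ln (bump_radius c v) + C" "Q \<le> C"
      using C(2)[OF c k F sec] by (simp_all add: D_def Q_def du)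
    define p where "p = (1 + k) / (2 * pi) * (1 + M_err \<beta> / 2) / (2 * \<beta>)"
    have k02: "0 \<le> k" "k \<le> 2" using k by auto
    have p: "0 \<le> p" "p \<le> 2" using exponent_bounds[OF \<beta> k02] by (auto simp: p_def)
    have p_eq: "p = (1 + k) * (1 + M_err \<beta> / 2) / (4 * pi * \<beta>)" by (simp add: p_def)
    have "exp (- (u x - u y) / \<beta> + (1 - M_err \<beta> / 2) / (2 * \<beta>) * D + C' * Q) \<le>
        exp (5 * C + C' * C) * bump_radius c v powr (- p)"
      unfolding p_def
    proof (rule energy_exponent_le[OF \<beta> _ DQ C'(1) C(1)])
      show "(1 + k) / (2 * pi) * ln (bump_radius c v) - C \<le> u x - u y"
        using bump_pair_value[OF c, of k v] C(1) by (simp add: uxy)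
    qed (simp add: bump_radius_def)
    also have "\<dots> \<le> exp (5 * C + C' * C) * (1 / c\<^sup>2 * norm2 v powr (- p))"
      using c by (intro mult_left_mono bump_radius_powr_le v p) auto
    finally have le: "exp (- (u x - u y) / \<beta> + (1 - M_err \<beta> / 2) / (2 * \<beta>) * D + C' * Q) \<le>
        exp (5 * C + C' * C) / c\<^sup>2 * norm2 v powr (- p)" by simp
    have "(\<integral>\<theta>. cos (override_on \<eta> \<theta> S x - override_on \<eta> \<theta> S y) *
           villain_product G F \<beta> (override_on \<eta> \<theta> S) \<partial>Pi\<^sub>M S (\<lambda>_. angle_space)) \<le>
        exp (- (u x - u y) / \<beta> + (1 - M_err \<beta> / 2) / (2 * \<beta>) * D + C' * Q) * ?I"
      unfolding D_def Q_def by (rule C'(2)[OF \<beta> S F(1) u0])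
    also have "\<dots> \<le> exp (5 * C + C' * C) / c\<^sup>2 * norm2 v powr (- p) * ?I"
      by (rule mult_right_mono[OF le I])
    finally show "(\<integral>\<theta>. cos (override_on \<eta> \<theta> S x - override_on \<eta> \<theta> S y) *
           villain_product G F \<beta> (override_on \<eta> \<theta> S) \<partial>Pi\<^sub>M S (\<lambda>_. angle_space))
      \<le> exp (5 * C + C' * C) / c\<^sup>2 * norm2 v powr (- ((1 + k) * (1 + M_err \<beta> / 2) / (4 * pi * \<beta>))) * ?I"
      by (simp only: p_eq)
  qed simp
qed

section \<open>The correlation bounds\<close>

lemma finite_lattice_box: "finite (lattice_box k)"
  by (simp add: lattice_box_def)

lemma mem_lattice_box_iff: "z \<in> lattice_box k \<longleftrightarrow> \<bar>fst z\<bar> \<le> k \<and> \<bar>snd z\<bar> \<le> k"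
  by (cases z) (auto simp: lattice_box_def)

lemma edges_meeting_subset: "edges_meeting S \<subseteq> arcs Z2_lattice"
  by (auto simp: edges_meeting_def)

section \<open>Zero boundary conditions\<close>

lemma zero_box_simps:
  "verts (zero_box n) = insert None (Some ` lattice_box (int n))"
  "arcs (zero_box n) = edges_meeting (lattice_box (int n))"
  "head (zero_box n) e = wire (lattice_box (int n)) (snd e)"
  "tail (zero_box n) e = wire (lattice_box (int n)) (fst e)"
  by (simp_all add: zero_box_def)

lemma zero_box_interior: "verts (zero_box n) - {None} = Some ` lattice_box (int n)"
  by (auto simp: zero_box_simps)

lemma zero_box_wf: "head (zero_box n) e \<in> verts (zero_box n) \<and> tail (zero_box n) e \<in> verts (zero_box n)"
  by (auto simp: zero_box_simps wire_def)

text \<open>A function that vanishes off the box extends by 0 to the vertex at infinity, and its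
  increments along wired edges are those on the lattice.\<close>

lemma case_option_wire:
  assumes "\<And>z. z \<notin> S \<Longrightarrow> b z = 0"
  shows "(case wire S z of None \<Rightarrow> 0 | Some w \<Rightarrow> b w) = b z"
  using assms by (simp add: wire_def)

text \<open>The angle at infinity is 0 under the law, so the one-point function is a two-point
  function to which the shift applies.\<close>

lemma villain_zero_cos_pinned:
  "(\<integral>\<theta>. cos (\<theta> (Some (0, 0))) \<partial>villain_zero n \<beta>) = (\<integral>\<theta>. cos (\<theta> (Some (0, 0)) - \<theta> None) \<partial>villain_zero n \<beta>)"
proof -
  let ?V = "verts (zero_box n)"
  let ?N = "Pi\<^sub>M ?V (\<lambda>_. angle_space)"
  let ?D = "normalized_density (Pi\<^sub>M (?V - {None}) (\<lambda>_. angle_space))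
    (\<lambda>\<theta>. villain_product (zero_box n) (arcs (zero_box n)) \<beta> (\<theta>(None := 0)))"
  have mem: "Some (0, 0) \<in> ?V" "None \<in> ?V" by (auto simp: zero_box_simps mem_lattice_box_iff)
  have coord: "(\<lambda>\<theta>. \<theta> v) \<in> borel_measurable ?N" if "v \<in> ?V" for v
    using measurable_to_angle_space[OF measurable_component_singleton[OF that]] .
  have "(\<lambda>\<theta>. \<theta>(None := 0)) \<in> measurable (Pi\<^sub>M (?V - {None}) (\<lambda>_. angle_space)) ?N"
    by (rule measurable_fun_upd[where J = "?V - {None}"]) (use mem in \<open>auto simp: space_angle_space\<close>)
  then have meas: "(\<lambda>\<theta>. \<theta>(None := 0)) \<in> measurable ?D ?N"
    by (simp add: normalized_density_def)
  have cos: "(\<lambda>\<theta>. cos (\<theta> (Some (0, 0)))) \<in> borel_measurable ?N"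
    "(\<lambda>\<theta>. cos (\<theta> (Some (0, 0)) - \<theta> None)) \<in> borel_measurable ?N"
    using coord[OF mem(1)] coord[OF mem(2)] by measurable
  show ?thesis
    unfolding villain_zero_def villain_def integral_distr[OF meas cos(1)] integral_distr[OF meas cos(2)]
    by simp
qed

lemma log_bump_box:
  assumes "log_bump (real n) z \<noteq> 0" "n \<ge> 1"
  shows "z \<in> lattice_box (int n)"
proof -
  have "site_sq z < (real n)\<^sup>2" by (rule log_bump_support[OF assms(1)]) (use assms in simp)
  from site_sq_lessD[OF this] assms(2)
  have "\<bar>real_of_int (fst z)\<bar> < real n" "\<bar>real_of_int (snd z)\<bar> < real n" by simp_all
  then show ?thesis by (simp add: mem_lattice_box_iff) linarith
qed

lemma villain_zero_one_point:
  obtains K where "K > 0"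
    "\<And>n \<beta>. n \<ge> 1 \<Longrightarrow> \<beta> \<ge> 1/3 \<Longrightarrow>
      (\<integral>\<theta>. cos (\<theta> (Some (0, 0))) \<partial>villain_zero n \<beta>) \<le> K * real n powr (- ((1 + M_err \<beta> / 2) / (4 * pi * \<beta>)))"
proof -
  obtain C where C: "C \<ge> 0"
    "\<And>r c F \<alpha> \<alpha>'. r \<ge> 1 \<Longrightarrow> finite F \<Longrightarrow> F \<subseteq> arcs Z2_lattice \<Longrightarrow>
      int_sector \<alpha> ((\<lambda>e. fst (fst e) - fst c) ` F) \<Longrightarrow> int_sector \<alpha>' ((\<lambda>e. snd (fst e) - snd c) ` F) \<Longrightarrow>
      (\<Sum>e\<in>F. (log_bump r (snd e - c) - log_bump r (fst e - c))\<^sup>2) \<le> real (\<alpha> * \<alpha>') / (8 * pi) * ln r + C \<and>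
      (\<Sum>e\<in>F. \<bar>log_bump r (snd e - c) - log_bump r (fst e - c)\<bar> ^ 3) \<le> C"
    by (rule log_bump_energy) (rule that; blast)
  obtain C' where C': "C' \<ge> 0"
    "\<And>\<beta> (G :: (site option, site \<times> site) pre_digraph) S F u \<eta> x y. \<beta> \<ge> 1/3 \<Longrightarrow> finite S \<Longrightarrow> finite F \<Longrightarrow>
      (\<And>v. v \<notin> S \<Longrightarrow> u v = 0) \<Longrightarrow>
      (\<integral>\<theta>. cos (override_on \<eta> \<theta> S x - override_on \<eta> \<theta> S y) *
           villain_product G F \<beta> (override_on \<eta> \<theta> S) \<partial>Pi\<^sub>M S (\<lambda>_. angle_space))
      \<le> exp (- (u x - u y) / \<beta> + (1 - M_err \<beta> / 2) / (2 * \<beta>) * (\<Sum>e\<in>F. (u (head G e) - u (tail G e))\<^sup>2)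
             + C' * (\<Sum>e\<in>F. \<bar>u (head G e) - u (tail G e)\<bar> ^ 3)) *
        (\<integral>\<theta>. villain_product G F \<beta> (override_on \<eta> \<theta> S) \<partial>Pi\<^sub>M S (\<lambda>_. angle_space))"
    by (rule villain_cos_integral_le_energy) (rule that; blast)
  show ?thesis
  proof (rule that[of "exp (5 * C + C' * C)"])
    fix n :: nat and \<beta> :: real
    assume n: "n \<ge> 1" and \<beta>: "\<beta> \<ge> 1/3"
    let ?G = "zero_box n" and ?B = "lattice_box (int n)"
    let ?F = "arcs ?G" and ?S = "verts ?G - {None}"
    \<comment> \<open>A single bump of radius \<open>n\<close>: it fits in the box and is 0 at the
      vertex at infinity.\<close>
    define u where "u = (\<lambda>v. case v of None \<Rightarrow> 0 | Some z \<Rightarrow> log_bump (real n) z)"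
    have u0: "u v = 0" if "v \<notin> ?S" for v
    proof (cases v)
      case (Some z)
      then have "z \<notin> ?B" using that by (auto simp: zero_box_interior)
      then show ?thesis using log_bump_box[OF _ n, of z] Some by (auto simp: u_def)
    qed (simp add: u_def)
    have wire: "u (wire ?B z) = log_bump (real n) z" for z
      unfolding u_def by (rule case_option_wire) (use log_bump_box[OF _ n] in blast)
    have fin: "finite ?F" "finite ?S" "?F \<subseteq> arcs Z2_lattice"
      by (simp_all add: zero_box_interior zero_box_simps finite_edges_meeting finite_lattice_box edges_meeting_subset)
    have bounds: "(\<Sum>e\<in>?F. (u (head ?G e) - u (tail ?G e))\<^sup>2) \<le> 1 / (2 * pi) * ln (real n) + C"
      "(\<Sum>e\<in>?F. \<bar>u (head ?G e) - u (tail ?G e)\<bar> ^ 3) \<le> C"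
      using C(2)[of "real n" ?F 2 0 2] n fin by (simp_all add: zero_box_simps(3,4) wire)
    have val: "u (Some (0, 0)) - u None = 1 / (2 * pi) * ln (real n)"
      using n by (simp add: u_def log_bump_0)
    define b where "b = exp (5 * C + C' * C) * real n powr (- (1 / (2 * pi) * (1 + M_err \<beta> / 2) / (2 * \<beta>)))"
    have le_b: "exp (- (u (Some (0, 0)) - u None) / \<beta> + (1 - M_err \<beta> / 2) / (2 * \<beta>) * (\<Sum>e\<in>?F. (u (head ?G e) - u (tail ?G e))\<^sup>2)
             + C' * (\<Sum>e\<in>?F. \<bar>u (head ?G e) - u (tail ?G e)\<bar> ^ 3)) \<le> b"
      unfolding b_def
      by (rule energy_exponent_le[OF \<beta> _ bounds C'(1) C(1)]) (use val C(1) n in auto)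
    have "(\<integral>\<theta>. cos (\<theta> (Some (0, 0)) - \<theta> None) \<partial>villain_zero n \<beta>) \<le> b"
      unfolding villain_zero_def
    proof (rule villain_cos_le)
      show "(\<integral>\<theta>. cos (override_on (\<lambda>_. 0) \<theta> ?S (Some (0, 0)) - override_on (\<lambda>_. 0) \<theta> ?S None) *
           villain_product ?G ?F \<beta> (override_on (\<lambda>_. 0) \<theta> ?S) \<partial>Pi\<^sub>M ?S (\<lambda>_. angle_space))
        \<le> b * (\<integral>\<theta>. villain_product ?G ?F \<beta> (override_on (\<lambda>_. 0) \<theta> ?S) \<partial>Pi\<^sub>M ?S (\<lambda>_. angle_space))"
        by (rule order_trans[OF C'(2)[OF \<beta> fin(2,1) u0] mult_right_mono[OF le_b]])
           (use \<beta> in \<open>auto intro!: Bochner_Integration.integral_nonneg villain_product_nonneg\<close>)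
    qed (use \<beta> zero_box_wf in \<open>auto simp: b_def zero_box_simps(1) mem_lattice_box_iff\<close>)
    then show "(\<integral>\<theta>. cos (\<theta> (Some (0, 0))) \<partial>villain_zero n \<beta>) \<le>
        exp (5 * C + C' * C) * real n powr (- ((1 + M_err \<beta> / 2) / (4 * pi * \<beta>)))"
      unfolding villain_zero_cos_pinned b_def by (simp add: mult.assoc)
  qed simp
qed

lemma bump_pair_supportD:
  assumes "bump_pair k c v z \<noteq> 0"
  shows "norm2 z < c * norm2 v \<or> norm2 (z - v) < c * norm2 v"
proof -
  have "log_bump (bump_radius c v) z \<noteq> 0 \<or> log_bump (bump_radius c v) (z - v) \<noteq> 0"
    using assms by (auto simp: bump_pair_def)
  then show ?thesis using log_bump_radius_support(1) by blast
qed

lemma double_exponent: "(1 + 1) * t / (4 * pi * \<beta>) = t / (2 * pi * \<beta>)"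
  by simp

lemma villain_zero_two_point:
  assumes "\<delta> > 0"
  obtains K where "K > 0"
    "\<And>n \<beta> v. n \<ge> 1 \<Longrightarrow> \<beta> \<ge> 1/3 \<Longrightarrow> v \<in> lattice_box \<lfloor>(1 - \<delta>) * real n\<rfloor> \<Longrightarrow> v \<noteq> (0, 0) \<Longrightarrow>
      (\<integral>\<theta>. cos (\<theta> (Some (0, 0)) - \<theta> (Some v)) \<partial>villain_zero n \<beta>)
        \<le> K * norm2 v powr (- ((1 + M_err \<beta> / 2) / (2 * pi * \<beta>)))"
proof -
  obtain K where K: "K > 0"
    "\<And>k c v \<alpha> \<alpha>' \<beta> (G :: (site option, site \<times> site) pre_digraph) S F u \<eta> x y.
      0 < c \<Longrightarrow> c \<le> 1/4 \<Longrightarrow> v \<noteq> (0, 0) \<Longrightarrow> (k = 1 \<and> \<alpha> * \<alpha>' = 4) \<or> (k = 2 \<and> \<alpha> * \<alpha>' = 2) \<Longrightarrow>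
      finite F \<Longrightarrow> F \<subseteq> arcs Z2_lattice \<Longrightarrow>
      int_sector \<alpha> ((\<lambda>e. fst (fst e) - fst v) ` F) \<Longrightarrow> int_sector \<alpha>' ((\<lambda>e. snd (fst e) - snd v) ` F) \<Longrightarrow>
      \<beta> \<ge> 1/3 \<Longrightarrow> finite S \<Longrightarrow> (\<And>w. w \<notin> S \<Longrightarrow> u w = 0) \<Longrightarrow>
      (\<And>e. e \<in> F \<Longrightarrow> u (head G e) - u (tail G e) = bump_pair k c v (snd e) - bump_pair k c v (fst e)) \<Longrightarrow>
      u x - u y = bump_pair k c v (0, 0) - bump_pair k c v v \<Longrightarrow>
      (\<integral>\<theta>. cos (override_on \<eta> \<theta> S x - override_on \<eta> \<theta> S y) *
           villain_product G F \<beta> (override_on \<eta> \<theta> S) \<partial>Pi\<^sub>M S (\<lambda>_. angle_space))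
      \<le> K / c\<^sup>2 * norm2 v powr (- ((1 + k) * (1 + M_err \<beta> / 2) / (4 * pi * \<beta>))) *
        (\<integral>\<theta>. villain_product G F \<beta> (override_on \<eta> \<theta> S) \<partial>Pi\<^sub>M S (\<lambda>_. angle_space))"
    by (rule bump_pair_cos_le) (rule that; blast)
  \<comment> \<open>Since \<open>norm2 v \<le> 2 * n\<close>, the bound
    \<open>c \<le> \<delta> / 2\<close> gives radius at most \<open>\<delta> * n\<close>, the
    distance left between \<open>v\<close> and the sides of the box; \<open>1/4\<close> separates
    the bumps and keeps the one at the origin inside.\<close>
  define c where "c = min (1/4) (\<delta> / 2)"
  have c: "0 < c" "c \<le> 1/4" "c \<le> \<delta> / 2" using assms by (auto simp: c_def)
  show ?thesis
  proof (rule that[of "K / c\<^sup>2"])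
    show "K / c\<^sup>2 > 0" using K(1) c by simp
  next
    fix n :: nat and \<beta> :: real and v :: site
    assume n: "n \<ge> 1" and \<beta>: "\<beta> \<ge> 1/3" and v: "v \<in> lattice_box \<lfloor>(1 - \<delta>) * real n\<rfloor>" "v \<noteq> (0, 0)"
    let ?G = "zero_box n" and ?B = "lattice_box (int n)"
    let ?F = "arcs ?G" and ?S = "verts ?G - {None}"
    define m where "m = (1 - \<delta>) * real n"
    have vm: "\<bar>real_of_int (fst v)\<bar> \<le> m" "\<bar>real_of_int (snd v)\<bar> \<le> m"
      using v(1) unfolding mem_lattice_box_iff m_def by linarith+
    have "\<delta> * real n \<ge> 0" using assms by simp
    then have mn: "m \<le> real n" by (simp add: m_def algebra_simps)
    have "norm2 v \<le> \<bar>real_of_int (fst v)\<bar> + \<bar>real_of_int (snd v)\<bar>"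
      unfolding norm2_def by (rule sqrt_sum_squares_le_sum_abs)
    then have "norm2 v \<le> 2 * real n" using vm mn by linarith
    have "c * norm2 v \<le> c * (2 * real n)"
      using \<open>norm2 v \<le> 2 * real n\<close> c by (intro mult_left_mono) auto
    moreover have "c * (2 * real n) \<le> (\<delta> / 2) * (2 * real n)" "c * (2 * real n) \<le> (1/4) * (2 * real n)"
      using c by (intro mult_right_mono; simp)+
    ultimately have cv: "c * norm2 v \<le> \<delta> * real n" "c * norm2 v \<le> real n" by auto
    have v_box: "v \<in> ?B" using vm mn by (simp add: mem_lattice_box_iff) linarith
    have box: "z \<in> ?B" if "bump_pair 1 c v z \<noteq> 0" for z
    proof -
      have "\<bar>real_of_int (fst z)\<bar> \<le> real n \<and> \<bar>real_of_int (snd z)\<bar> \<le> real n"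
        using bump_pair_supportD[OF that]
      proof
        assume "norm2 z < c * norm2 v"
        then show ?thesis using abs_le_norm2[of z] cv(2) by linarith
      next
        assume *: "norm2 (z - v) < c * norm2 v"
        have "\<bar>real_of_int (fst z) - real_of_int (fst v)\<bar> \<le> norm2 (z - v)"
          "\<bar>real_of_int (snd z) - real_of_int (snd v)\<bar> \<le> norm2 (z - v)"
          using abs_le_norm2[of "z - v"] by simp_all
        moreover have "m + \<delta> * real n = real n" by (simp add: m_def algebra_simps)
        ultimately show ?thesis using * vm cv(1) by linarith
      qed
      then show ?thesis by (simp add: mem_lattice_box_iff) linarith
    qed
    define u where "u = (\<lambda>w. case w of None \<Rightarrow> 0 | Some z \<Rightarrow> bump_pair 1 c v z)"
    have u0: "u w = 0" if "w \<notin> ?S" for w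
    proof (cases w)
      case (Some z)
      then have "z \<notin> ?B" using that by (auto simp: zero_box_interior)
      then show ?thesis using box[of z] Some by (auto simp: u_def)
    qed (simp add: u_def)
    have wire: "u (wire ?B z) = bump_pair 1 c v z" for z
      unfolding u_def by (rule case_option_wire) (use box in blast)
    have fin: "finite ?F" "finite ?S" "?F \<subseteq> arcs Z2_lattice"
      by (simp_all add: zero_box_interior zero_box_simps finite_edges_meeting finite_lattice_box edges_meeting_subset)
    have k: "((1::real) = 1 \<and> (2::nat) * 2 = 4) \<or> ((1::real) = 2 \<and> (2::nat) * 2 = 2)" by simp
    have "(\<integral>\<theta>. cos (\<theta> (Some (0, 0)) - \<theta> (Some v)) \<partial>villain_zero n \<beta>) \<le>
        K / c\<^sup>2 * norm2 v powr (- ((1 + 1) * (1 + M_err \<beta> / 2) / (4 * pi * \<beta>)))"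
      unfolding villain_zero_def
    proof (rule villain_cos_le)
      show "(\<integral>\<theta>. cos (override_on (\<lambda>_. 0) \<theta> ?S (Some (0, 0)) - override_on (\<lambda>_. 0) \<theta> ?S (Some v)) *
           villain_product ?G ?F \<beta> (override_on (\<lambda>_. 0) \<theta> ?S) \<partial>Pi\<^sub>M ?S (\<lambda>_. angle_space))
        \<le> K / c\<^sup>2 * norm2 v powr (- ((1 + 1) * (1 + M_err \<beta> / 2) / (4 * pi * \<beta>))) *
          (\<integral>\<theta>. villain_product ?G ?F \<beta> (override_on (\<lambda>_. 0) \<theta> ?S) \<partial>Pi\<^sub>M ?S (\<lambda>_. angle_space))"
      proof (rule K(2)[OF c(1,2) v(2) k fin(1,3) int_sector_2 int_sector_2 \<beta> fin(2) u0])
        show "u (head ?G e) - u (tail ?G e) = bump_pair 1 c v (snd e) - bump_pair 1 c v (fst e)" for e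
          by (simp only: zero_box_simps(3,4) wire)
        show "u (Some (0, 0)) - u (Some v) = bump_pair 1 c v (0, 0) - bump_pair 1 c v v"
          by (simp add: u_def)
      qed
    next
      show "None \<in> verts ?G" "Some (0, 0) \<in> verts ?G" "Some v \<in> verts ?G"
        using v_box by (auto simp: zero_box_simps(1) mem_lattice_box_iff)
      show "head ?G e \<in> verts ?G \<and> tail ?G e \<in> verts ?G" for e
        by (rule zero_box_wf)
    qed (use \<beta> K(1) in auto)
    then show "(\<integral>\<theta>. cos (\<theta> (Some (0, 0)) - \<theta> (Some v)) \<partial>villain_zero n \<beta>) \<le>
        K / c\<^sup>2 * norm2 v powr (- ((1 + M_err \<beta> / 2) / (2 * pi * \<beta>)))"
      unfolding double_exponent .
  qed
qed

section \<open>Free boundary conditions\<close>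

lemma free_box_simps:
  "verts (free_box n) = lattice_box (int n)"
  "arcs (free_box n) = {e \<in> arcs Z2_lattice. fst e \<in> lattice_box (int n) \<and> snd e \<in> lattice_box (int n)}"
  "head (free_box n) = snd" "tail (free_box n) = fst"
  by (simp_all add: free_box_def induce_subgraph_def Z2_lattice_def)

lemma villain_free_two_point:
  obtains K where "K > 0"
    "\<And>n \<beta> v. n \<ge> 1 \<Longrightarrow> \<beta> \<ge> 1/3 \<Longrightarrow> v \<in> box_boundary (int n) \<Longrightarrow>
      (\<integral>\<theta>. cos (\<theta> (0, 0) - \<theta> v) \<partial>villain_free n \<beta>)
        \<le> K * norm2 v powr (- (3 * (1 + M_err \<beta> / 2) / (4 * pi * \<beta>)))"
proof -
  obtain K where K: "K > 0"
    "\<And>k c v \<alpha> \<alpha>' \<beta> (G :: (site, site \<times> site) pre_digraph) S F u \<eta> x y.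
      0 < c \<Longrightarrow> c \<le> 1/4 \<Longrightarrow> v \<noteq> (0, 0) \<Longrightarrow> (k = 1 \<and> \<alpha> * \<alpha>' = 4) \<or> (k = 2 \<and> \<alpha> * \<alpha>' = 2) \<Longrightarrow>
      finite F \<Longrightarrow> F \<subseteq> arcs Z2_lattice \<Longrightarrow>
      int_sector \<alpha> ((\<lambda>e. fst (fst e) - fst v) ` F) \<Longrightarrow> int_sector \<alpha>' ((\<lambda>e. snd (fst e) - snd v) ` F) \<Longrightarrow>
      \<beta> \<ge> 1/3 \<Longrightarrow> finite S \<Longrightarrow> (\<And>w. w \<notin> S \<Longrightarrow> u w = 0) \<Longrightarrow>
      (\<And>e. e \<in> F \<Longrightarrow> u (head G e) - u (tail G e) = bump_pair k c v (snd e) - bump_pair k c v (fst e)) \<Longrightarrow>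
      u x - u y = bump_pair k c v (0, 0) - bump_pair k c v v \<Longrightarrow>
      (\<integral>\<theta>. cos (override_on \<eta> \<theta> S x - override_on \<eta> \<theta> S y) *
           villain_product G F \<beta> (override_on \<eta> \<theta> S) \<partial>Pi\<^sub>M S (\<lambda>_. angle_space))
      \<le> K / c\<^sup>2 * norm2 v powr (- ((1 + k) * (1 + M_err \<beta> / 2) / (4 * pi * \<beta>))) *
        (\<integral>\<theta>. villain_product G F \<beta> (override_on \<eta> \<theta> S) \<partial>Pi\<^sub>M S (\<lambda>_. angle_space))"
    by (rule bump_pair_cos_le) (rule that; blast)
  show ?thesis
  proof (rule that[of "K / (1/4)\<^sup>2"])
    show "K / (1/4)\<^sup>2 > 0" using K(1) by simp
  next
    fix n :: nat and \<beta> :: real and v :: site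
    assume n: "n \<ge> 1" and \<beta>: "\<beta> \<ge> 1/3" and v: "v \<in> box_boundary (int n)"
    let ?G = "free_box n" and ?B = "lattice_box (int n)"
    let ?F = "arcs ?G" and ?S = "verts ?G - {(0, 0)}"
    have v_box: "v \<in> ?B" and v_bd: "\<bar>fst v\<bar> = int n \<or> \<bar>snd v\<bar> = int n"
      using v by (auto simp: box_boundary_def)
    have v0: "v \<noteq> (0, 0)" using v_bd n by auto
    have fin: "finite ?F" "?F \<subseteq> arcs Z2_lattice" "finite ?S"
    proof -
      have "?F \<subseteq> edges_meeting ?B" by (auto simp: free_box_simps edges_meeting_def Z2_lattice_def)
      then show "finite ?F" using finite_edges_meeting[OF finite_lattice_box] by (rule finite_subset)
    qed (auto simp: free_box_simps finite_lattice_box)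
    have tails: "\<bar>fst (fst e)\<bar> \<le> int n" "\<bar>snd (fst e)\<bar> \<le> int n" if "e \<in> ?F" for e
      using that by (auto simp: free_box_simps mem_lattice_box_iff)
    \<comment> \<open>Seen from a boundary point, all tails lie on one side in the coordinate that
      attains the maximal modulus; at a corner either choice works.\<close>
    have "\<exists>\<alpha> \<alpha>'. \<alpha> * \<alpha>' = (2 :: nat) \<and> int_sector \<alpha> ((\<lambda>e. fst (fst e) - fst v) ` ?F) \<and>
        int_sector \<alpha>' ((\<lambda>e. snd (fst e) - snd v) ` ?F)"
      using v_bd
    proof
      assume "\<bar>fst v\<bar> = int n"
      then have "int_sector 1 ((\<lambda>e. fst (fst e) - fst v) ` ?F)"
        using tails(1) unfolding int_sector_def by (cases "fst v \<ge> 0") fastforce+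
      then show ?thesis by (intro exI[of _ 1] exI[of _ 2]) simp
    next
      assume "\<bar>snd v\<bar> = int n"
      then have "int_sector 1 ((\<lambda>e. snd (fst e) - snd v) ` ?F)"
        using tails(2) unfolding int_sector_def by (cases "snd v \<ge> 0") fastforce+
      then show ?thesis by (intro exI[of _ 2] exI[of _ 1]) simp
    qed
    then obtain \<alpha> \<alpha>' where \<alpha>: "\<alpha> * \<alpha>' = (2 :: nat)" and sec: "int_sector \<alpha> ((\<lambda>e. fst (fst e) - fst v) ` ?F)"
        "int_sector \<alpha>' ((\<lambda>e. snd (fst e) - snd v) ` ?F)" by blast
    have k: "((2::real) = 1 \<and> \<alpha> * \<alpha>' = 4) \<or> ((2::real) = 2 \<and> \<alpha> * \<alpha>' = 2)" using \<alpha> by simp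
    define w where "w = bump_pair 2 (1/4) v"
    \<comment> \<open>The law is pinned at the origin, where \<open>u\<close> must vanish;
      subtracting the constant leaves all differences inside the box unchanged.\<close>
    define u where "u = (\<lambda>z. if z \<in> ?B then w z - w (0, 0) else 0)"
    have u0: "u z = 0" if "z \<notin> ?S" for z
      using that by (auto simp: u_def free_box_simps)
    have "(\<integral>\<theta>. cos (\<theta> (0, 0) - \<theta> v) \<partial>villain_free n \<beta>) \<le>
        K / (1/4)\<^sup>2 * norm2 v powr (- ((1 + 2) * (1 + M_err \<beta> / 2) / (4 * pi * \<beta>)))"
      unfolding villain_free_def
    proof (rule villain_cos_le)
      show "(\<integral>\<theta>. cos (override_on (\<lambda>_. 0) \<theta> ?S (0, 0) - override_on (\<lambda>_. 0) \<theta> ?S v) *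
           villain_product ?G ?F \<beta> (override_on (\<lambda>_. 0) \<theta> ?S) \<partial>Pi\<^sub>M ?S (\<lambda>_. angle_space))
        \<le> K / (1/4)\<^sup>2 * norm2 v powr (- ((1 + 2) * (1 + M_err \<beta> / 2) / (4 * pi * \<beta>))) *
          (\<integral>\<theta>. villain_product ?G ?F \<beta> (override_on (\<lambda>_. 0) \<theta> ?S) \<partial>Pi\<^sub>M ?S (\<lambda>_. angle_space))"
      proof (rule K(2)[OF _ _ v0 k fin(1,2) sec \<beta> fin(3) u0])
        show "u (head ?G e) - u (tail ?G e) = bump_pair 2 (1/4) v (snd e) - bump_pair 2 (1/4) v (fst e)" if "e \<in> ?F" for e
          using that by (simp add: free_box_simps u_def w_def)
        show "u (0, 0) - u v = bump_pair 2 (1/4) v (0, 0) - bump_pair 2 (1/4) v v"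
          using v_box by (simp add: u_def w_def mem_lattice_box_iff)
      qed auto
    qed (use \<beta> K(1) v_box in \<open>auto simp: free_box_simps mem_lattice_box_iff\<close>)
    then show "(\<integral>\<theta>. cos (\<theta> (0, 0) - \<theta> v) \<partial>villain_free n \<beta>) \<le>
        K / (1/4)\<^sup>2 * norm2 v powr (- (3 * (1 + M_err \<beta> / 2) / (4 * pi * \<beta>)))"
      by simp
  qed
qed

section \<open>Infinite volume\<close>

lemma villain_gibbs_two_point:
  obtains K where "K > 0"
    "\<And>\<beta> \<mu> v. \<beta> \<ge> 1/3 \<Longrightarrow> villain_gibbs_state \<beta> \<mu> \<Longrightarrow> v \<noteq> (0, 0) \<Longrightarrow>
      (\<integral>\<theta>. cos (\<theta> (0, 0) - \<theta> v) \<partial>\<mu>) \<le> K * norm2 v powr (- ((1 + M_err \<beta> / 2) / (2 * pi * \<beta>)))"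
proof -
  obtain K where K: "K > 0"
    "\<And>k c v \<alpha> \<alpha>' \<beta> (G :: (site, site \<times> site) pre_digraph) S F u \<eta> x y.
      0 < c \<Longrightarrow> c \<le> 1/4 \<Longrightarrow> v \<noteq> (0, 0) \<Longrightarrow> (k = 1 \<and> \<alpha> * \<alpha>' = 4) \<or> (k = 2 \<and> \<alpha> * \<alpha>' = 2) \<Longrightarrow>
      finite F \<Longrightarrow> F \<subseteq> arcs Z2_lattice \<Longrightarrow>
      int_sector \<alpha> ((\<lambda>e. fst (fst e) - fst v) ` F) \<Longrightarrow> int_sector \<alpha>' ((\<lambda>e. snd (fst e) - snd v) ` F) \<Longrightarrow>
      \<beta> \<ge> 1/3 \<Longrightarrow> finite S \<Longrightarrow> (\<And>w. w \<notin> S \<Longrightarrow> u w = 0) \<Longrightarrow>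
      (\<And>e. e \<in> F \<Longrightarrow> u (head G e) - u (tail G e) = bump_pair k c v (snd e) - bump_pair k c v (fst e)) \<Longrightarrow>
      u x - u y = bump_pair k c v (0, 0) - bump_pair k c v v \<Longrightarrow>
      (\<integral>\<theta>. cos (override_on \<eta> \<theta> S x - override_on \<eta> \<theta> S y) *
           villain_product G F \<beta> (override_on \<eta> \<theta> S) \<partial>Pi\<^sub>M S (\<lambda>_. angle_space))
      \<le> K / c\<^sup>2 * norm2 v powr (- ((1 + k) * (1 + M_err \<beta> / 2) / (4 * pi * \<beta>))) *
        (\<integral>\<theta>. villain_product G F \<beta> (override_on \<eta> \<theta> S) \<partial>Pi\<^sub>M S (\<lambda>_. angle_space))"
    by (rule bump_pair_cos_le) (rule that; blast)
  show ?thesis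
  proof (rule that[of "K / (1/4)\<^sup>2"])
    show "K / (1/4)\<^sup>2 > 0" using K(1) by simp
  next
    fix \<beta> :: real and \<mu> :: "(site \<Rightarrow> real) measure" and v :: site
    assume \<beta>: "\<beta> \<ge> 1/3" and gibbs: "villain_gibbs_state \<beta> \<mu>" and v: "v \<noteq> (0, 0)"
    \<comment> \<open>Both bumps lie within distance \<open>(1 + 1/4) * norm2 v\<close> of the
      origin, so conditioning outside this box leaves every shifted angle free. The estimate is
      uniform in \<eta> and survives averaging over it.\<close>
    define N where "N = \<lceil>2 * norm2 v\<rceil>"
    let ?S = "lattice_box N"
    have S0: "bump_pair 1 (1/4) v z = 0" if "z \<notin> ?S" for z
    proof (rule ccontr)
      assume "bump_pair 1 (1/4) v z \<noteq> 0"
      from bump_pair_supportD[OF this] have "norm2 z \<le> 2 * norm2 v"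
        using norm2_triangle[of "z - v" v] norm2_nonneg[of v] by auto
      then have "\<bar>real_of_int (fst z)\<bar> \<le> 2 * norm2 v" "\<bar>real_of_int (snd z)\<bar> \<le> 2 * norm2 v"
        using abs_le_norm2[of z] by linarith+
      then have "z \<in> ?S" unfolding mem_lattice_box_iff N_def by linarith
      with that show False by blast
    qed
    have k: "((1::real) = 1 \<and> (2::nat) * 2 = 4) \<or> ((1::real) = 2 \<and> (2::nat) * 2 = 2)" by simp
    have "(\<integral>\<theta>. cos (\<theta> (0, 0) - \<theta> v) \<partial>\<mu>) \<le>
        K / (1/4)\<^sup>2 * norm2 v powr (- ((1 + 1) * (1 + M_err \<beta> / 2) / (4 * pi * \<beta>)))"
    proof (rule gibbs_state_cos_le[OF _ gibbs finite_lattice_box[of N]])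
      fix \<eta> :: "site \<Rightarrow> real"
      show "(\<integral>\<theta>. cos (override_on \<eta> \<theta> ?S (0, 0) - override_on \<eta> \<theta> ?S v) *
           villain_product Z2_lattice (edges_meeting ?S) \<beta> (override_on \<eta> \<theta> ?S) \<partial>Pi\<^sub>M ?S (\<lambda>_. angle_space))
        \<le> K / (1/4)\<^sup>2 * norm2 v powr (- ((1 + 1) * (1 + M_err \<beta> / 2) / (4 * pi * \<beta>))) *
          (\<integral>\<theta>. villain_product Z2_lattice (edges_meeting ?S) \<beta> (override_on \<eta> \<theta> ?S) \<partial>Pi\<^sub>M ?S (\<lambda>_. angle_space))"
        by (rule K(2)[OF _ _ v k finite_edges_meeting[OF finite_lattice_box] edges_meeting_subset
              int_sector_2 int_sector_2 \<beta> finite_lattice_box S0])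
           (simp_all add: Z2_lattice_def)
    qed (use \<beta> K(1) in auto)
    then show "(\<integral>\<theta>. cos (\<theta> (0, 0) - \<theta> v) \<partial>\<mu>) \<le>
        K / (1/4)\<^sup>2 * norm2 v powr (- ((1 + M_err \<beta> / 2) / (2 * pi * \<beta>)))"
      unfolding double_exponent .
  qed
qed

theorem corollary1p4:
  shows
    "(\<forall>\<delta>>0. \<exists>K>0. \<forall>n\<ge>1. \<forall>\<beta>\<ge>1/3.
        (\<integral>\<theta>. cos (\<theta> (Some (0, 0))) \<partial>villain_zero n \<beta>)
          \<le> K * real n powr (- ((1 + M_err \<beta> / 2) / (4 * pi * \<beta>))) \<and>
        (\<forall>v \<in> lattice_box \<lfloor>(1 - \<delta>) * real n\<rfloor>. v \<noteq> (0, 0) \<longrightarrow>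
           (\<integral>\<theta>. cos (\<theta> (Some (0, 0)) - \<theta> (Some v)) \<partial>villain_zero n \<beta>)
             \<le> K * norm2 v powr (- ((1 + M_err \<beta> / 2) / (2 * pi * \<beta>))))) \<and>
     (\<exists>K. \<forall>n\<ge>1. \<forall>\<beta>\<ge>1/3. \<forall>v \<in> box_boundary (int n).
        (\<integral>\<theta>. cos (\<theta> (0, 0) - \<theta> v) \<partial>villain_free n \<beta>)
          \<le> K * norm2 v powr (- (3 * (1 + M_err \<beta> / 2) / (4 * pi * \<beta>)))) \<and>
     (\<exists>K. \<forall>\<beta>\<ge>1/3. \<forall>\<mu>. villain_gibbs_state \<beta> \<mu> \<and> translation_invariant \<mu> \<longrightarrow>
        (\<forall>v. v \<noteq> (0, 0) \<longrightarrow>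
           (\<integral>\<theta>. cos (\<theta> (0, 0) - \<theta> v) \<partial>\<mu>)
             \<le> K * norm2 v powr (- ((1 + M_err \<beta> / 2) / (2 * pi * \<beta>)))))"
proof (intro conjI allI impI)
  fix \<delta> :: real
  assume "\<delta> > 0"
  obtain K\<^sub>1 where K\<^sub>1: "K\<^sub>1 > 0" "\<And>n \<beta>. n \<ge> 1 \<Longrightarrow> \<beta> \<ge> 1/3 \<Longrightarrow>
      (\<integral>\<theta>. cos (\<theta> (Some (0, 0))) \<partial>villain_zero n \<beta>) \<le> K\<^sub>1 * real n powr (- ((1 + M_err \<beta> / 2) / (4 * pi * \<beta>)))"
    by (rule villain_zero_one_point) (rule that; blast)
  obtain K\<^sub>2 where K\<^sub>2: "K\<^sub>2 > 0"
    "\<And>n \<beta> v. n \<ge> 1 \<Longrightarrow> \<beta> \<ge> 1/3 \<Longrightarrow> v \<in> lattice_box \<lfloor>(1 - \<delta>) * real n\<rfloor> \<Longrightarrow> v \<noteq> (0, 0) \<Longrightarrow>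
      (\<integral>\<theta>. cos (\<theta> (Some (0, 0)) - \<theta> (Some v)) \<partial>villain_zero n \<beta>)
        \<le> K\<^sub>2 * norm2 v powr (- ((1 + M_err \<beta> / 2) / (2 * pi * \<beta>)))"
    by (rule villain_zero_two_point[OF \<open>\<delta> > 0\<close>]) (rule that; blast)
  define K where "K = max K\<^sub>1 K\<^sub>2"
  have K: "K\<^sub>1 * t powr s \<le> K * t powr s" "K\<^sub>2 * t powr s \<le> K * t powr s" for t s
    by (auto simp: K_def intro!: mult_right_mono)
  show "\<exists>K>0. \<forall>n\<ge>1. \<forall>\<beta>\<ge>1/3.
        (\<integral>\<theta>. cos (\<theta> (Some (0, 0))) \<partial>villain_zero n \<beta>)
          \<le> K * real n powr (- ((1 + M_err \<beta> / 2) / (4 * pi * \<beta>))) \<and>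
        (\<forall>v \<in> lattice_box \<lfloor>(1 - \<delta>) * real n\<rfloor>. v \<noteq> (0, 0) \<longrightarrow>
           (\<integral>\<theta>. cos (\<theta> (Some (0, 0)) - \<theta> (Some v)) \<partial>villain_zero n \<beta>)
             \<le> K * norm2 v powr (- ((1 + M_err \<beta> / 2) / (2 * pi * \<beta>))))"
    by (intro exI[of _ K] conjI allI impI ballI)
       (use K\<^sub>1(1) in \<open>auto simp: K_def intro: order_trans[OF K\<^sub>1(2) K(1)[unfolded K_def]] order_trans[OF K\<^sub>2(2) K(2)[unfolded K_def]]\<close>)
next
  obtain K where "K > 0" "\<And>n \<beta> v. n \<ge> 1 \<Longrightarrow> \<beta> \<ge> 1/3 \<Longrightarrow> v \<in> box_boundary (int n) \<Longrightarrow>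
      (\<integral>\<theta>. cos (\<theta> (0, 0) - \<theta> v) \<partial>villain_free n \<beta>)
        \<le> K * norm2 v powr (- (3 * (1 + M_err \<beta> / 2) / (4 * pi * \<beta>)))"
    by (rule villain_free_two_point) (rule that; blast)
  then show "\<exists>K. \<forall>n\<ge>1. \<forall>\<beta>\<ge>1/3. \<forall>v \<in> box_boundary (int n).
        (\<integral>\<theta>. cos (\<theta> (0, 0) - \<theta> v) \<partial>villain_free n \<beta>)
          \<le> K * norm2 v powr (- (3 * (1 + M_err \<beta> / 2) / (4 * pi * \<beta>)))"
    by blast
next
  obtain K where "K > 0" "\<And>\<beta> \<mu> v. \<beta> \<ge> 1/3 \<Longrightarrow> villain_gibbs_state \<beta> \<mu> \<Longrightarrow> v \<noteq> (0, 0) \<Longrightarrow>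
      (\<integral>\<theta>. cos (\<theta> (0, 0) - \<theta> v) \<partial>\<mu>) \<le> K * norm2 v powr (- ((1 + M_err \<beta> / 2) / (2 * pi * \<beta>)))"
    by (rule villain_gibbs_two_point) (rule that; blast)
  then show "\<exists>K. \<forall>\<beta>\<ge>1/3. \<forall>\<mu>. villain_gibbs_state \<beta> \<mu> \<and> translation_invariant \<mu> \<longrightarrow>
        (\<forall>v. v \<noteq> (0, 0) \<longrightarrow>
           (\<integral>\<theta>. cos (\<theta> (0, 0) - \<theta> v) \<partial>\<mu>)
             \<le> K * norm2 v powr (- ((1 + M_err \<beta> / 2) / (2 * pi * \<beta>))))"
    by blast
qed

end
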